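(* Let $\omega\in\{\mathbf 0,\mathbf 1,\mathbf 2\}^\infty$ be a string satisfying Assumption $(\mathrm{Fr}(D))$. Then for every $\beta\in\left(1-\frac1D,1\right)$ and every integer $A>\frac{D(1+\beta)}{2(1-\beta)}$ divisible by $D$, the measure $\mu_\beta$ on $G_\omega$ constructed with the parameters $k_n=A\lfloor\log_2 n\rfloor$ (see context) has non-trivial Poisson boundary, that is, there exists a non-constant bounded $\mu_\beta$-harmonic function on $G_\omega$.
   Context: **Grigorchuk groups.** The rooted binary tree $\mathsf T$ has the finite words over $\{0,1\}$ as vertices, and $\mathsf L_n$ is the set of words of length $n$. Automorphisms act from the right. An automorphism is written $g=(g_0,g_1)\tau$ with $\tau$ a permutation of $\{0,1\}$, meaning $(iw)\cdot g=(i\cdot\tau)(w\cdot g_i)$. Let $\varepsilon$ be the transposition of $0,1$ and $a=(id,id)\varepsilon$. Let $\{id,b,c,d\}$ be the Klein four-group. The letters $\mathbf 0,\mathbf 1,\mathbf 2$ denote the three non-trivial homomorphisms $\{id,b,c,d\}\to\{id,a\}$, vanishing on $d,c,b$ respectively. For $\omega=\omega_0\omega_1\ldots$ let $\mathfrak s\omega=\omega_1\omega_2\ldots$, and recursively $x_\omega=(\omega_0(x),x_{\mathfrak s\omega})$ for $x\in\{b,c,d\}$. $G_\omega$ is generated by $S=\{a,b_\omega,c_\omega,d_\omega\}$. For an automorphism $h$ and a vertex $u$, $\iota(h,u)$ is the automorphism that fixes all vertices not having $u$ as a prefix and acts as $h$ on the subtree rooted at $u$. Write $[x,y]=xyx^{-1}y^{-1}$.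 **Assumption $(\mathrm{Fr}(D))$**, $D\in\mathbb N$: for every integer $k\ge0$, the string $\omega_{kD}\ldots\omega_{kD+D-1}$ contains at least one of $\mathbf{201},\mathbf{211}$ as a substring. Let $m_k$ be the smallest number in $\{0,\ldots,D-3\}$ with $\omega_{kD+m_k}\omega_{kD+m_k+1}\omega_{kD+m_k+2}\in\{\mathbf{201},\mathbf{211}\}$, and let $I_\omega=\{kD+m_k+3:\ k\ge0\}$. **Substitutions.** Define self-substitutions of $\{ab,ac,ad\}^*$ by $\zeta_{\mathbf 0}: ab\mapsto abab,\ ac\mapsto acac,\ ad\mapsto abadac$; $\zeta_{\mathbf 1}: ab\mapsto abab,\ ac\mapsto adacab,\ ad\mapsto adad$; $\zeta_{\mathbf 2}: ab\mapsto acabad,\ ac\mapsto acac,\ ad\mapsto adad$. If $g\in G_{\mathfrak s^{n+1}\omega}$ is represented by a word in $\{ab_{\mathfrak s^{n+1}\omega},ac_{\mathfrak s^{n+1}\omega},ad_{\mathfrak s^{n+1}\omega}\}^*$, then $\zeta_{\omega_n}(g)\in G_{\mathfrak s^{n}\omega}$ is the element represented by the image word, read with the letters $a,b_{\mathfrak s^n\omega},c_{\mathfrak s^n\omega},d_{\mathfrak s^n\omega}$; this does not depend on the representing word. If instead $g^{-1}$ is represented by such a word (equivalently, $g$ is represented by a word in $\{ba,ca,da\}^*$), then $\zeta_{\omega_n}(g):=\zeta_{\omega_n}(g^{-1})^{-1}$. **Elements $g_n$.** For $n\ge1$, $g_n=\zeta_{\omega_0}\circ\cdots\circ\zeta_{\omega_{n-1}}(ab_{\mathfrak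 s^n\omega})$ if $\omega_{n-1}\ne\mathbf 2$, and $g_n=\zeta_{\omega_0}\circ\cdots\circ\zeta_{\omega_{n-1}}(ac_{\mathfrak s^n\omega})$ if $\omega_{n-1}=\mathbf 2$. **Index sets.** For $k,n$ divisible by $D$, let $\mathsf W_k^n=\{u=u_1\ldots u_k\in\mathsf L_k:\ u_i=1\text{ if }n+i\notin I_\omega\}$. For an integer $j$ let $\bar j\in\{0,\ldots,D-1\}$ be its residue mod $D$. For $k$ divisible by $D$ let $\ell(j,k)=\frac1D(j+D-\bar j+k)$ and $$\mathsf V_k^j=\left\{1^{D-\bar j}\,u\,1^{m_{\ell(j,k)}+2}\,0:\ u\in\mathsf W_k^{j+D-\bar j}\right\}.$$ **Conjugated elements.** For $v=v_1\ldots v_{k'}\in\mathsf V_k^j$ (with $k'=|v|$), define elements of $G_{\mathfrak s^j\omega}$: $h_i^v=id$ if $v_i=1$, and $h_i^v=\iota([b_{\mathfrak s^{j+i-2}\omega},a],v_1\ldots v_{i-2})$ if $v_i=0$. Set $$\mathfrak c_j^v=(h_1^vh_2^v\cdots h_{k'}^v)^{-1}c_{\mathfrak s^j\omega}(h_1^vh_2^v\cdots h_{k'}^v),\qquad \tilde g_j^v=\zeta_{\omega_0}\circ\cdots\circ\zeta_{\omega_{j-1}}(a\,\mathfrak c_j^v)\in G_\omega.$$ **The measures.** Let $(k_n)$ be a sequence of positive integers divisible by $D$. For $n$ divisible by $D$ and $1\le j\le n$, define $\mathfrak F_{j,n}\subset G_\omega$ as follows. If $\omega_{j-1}=\mathbf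 2$ and $n-k_n<j\le n$, let $\mathfrak F_{j,n}=\{\tilde g_j^v:\ v\in\mathsf V_{2k_n}^j,\ |1^\infty\wedge v|\ge n-j+D\}$ (indexed by these $v$), where $|1^\infty\wedge v|$ is the length of the longest common prefix of $1^\infty$ and $v$. Otherwise let $\mathfrak F_{j,n}=\{g_j\}$. Let $\upsilon_n$ be the distribution of $\gamma_n^{\epsilon_n}\cdots\gamma_1^{\epsilon_1}$, where $\epsilon_i,\gamma_i$ ($1\le i\le n$) are independent, $\epsilon_i$ is uniform on $\{0,1\}$ and $\gamma_i$ is uniform on $\mathfrak F_{i,n}$. Let $\check\upsilon_n(g)=\upsilon_n(g^{-1})$. For $\beta\in(0,1)$ let $$\mu_\beta=\frac12\mathbf u_S+\frac12\sum_{n\in\mathbb N,\ D|n}C_\beta2^{-n\beta}(\upsilon_n+\check\upsilon_n),$$ where $\mathbf u_S$ is the uniform measure on $S=\{a,b_\omega,c_\omega,d_\omega\}$ and $C_\beta>0$ is the normalization constant making $\mu_\beta$ a probability measure. A function $f$ on $G_\omega$ is $\mu$-harmonic if $f(x)=\sum_yf(xy)\mu(y)$ for all $x$. *)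

theory Defs
  imports
    "HOL-Algebra.Generated_Groups"
    "HOL-Library.Sublist"
    "HOL-Probability.Probability"
begin

section \<open>Automorphisms of the rooted binary tree\<close>

text \<open>
  Vertices are words over $\{0,1\}$, encoded as lists of booleans with \<open>False\<close> for $0$ and
  \<open>True\<close> for $1$. Automorphisms act from the right: $w \cdot g$ is \<open>g w\<close>, and hence the
  product $gh$ is the composition \<open>h \<circ> g\<close>.
\<close>

type_synonym vertex = "bool list"
type_synonym tree_map = "vertex \<Rightarrow> vertex"

definition Aut_T :: "tree_map monoid" where
  "Aut_T = \<lparr>carrier = {g. bij g \<and> (\<forall>u v. prefix (g u) (g v) \<longleftrightarrow> prefix u v)},
            monoid.mult = (\<lambda>g h. h \<circ> g),
            one = id\<rparr>"

lemma group_Aut_T: "group Aut_T"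
proof (rule groupI)
  fix x assume x: "x \<in> carrier Aut_T"
  define y where "y = inv_into UNIV x"
  have xy: "x (y w) = w" for w
    using x by (simp add: y_def Aut_T_def bij_is_surj surj_f_inv_f)
  have "bij y"
    using x by (simp add: y_def Aut_T_def bij_imp_bij_inv)
  moreover have "prefix (y u) (y v) \<longleftrightarrow> prefix u v" for u v
  proof -
    have "prefix (x (y u)) (x (y v)) \<longleftrightarrow> prefix (y u) (y v)"
      using x by (simp add: Aut_T_def)
    then show ?thesis by (simp add: xy)
  qed
  ultimately have "y \<in> carrier Aut_T"
    by (simp add: Aut_T_def)
  moreover have "y \<otimes>\<^bsub>Aut_T\<^esub> x = \<one>\<^bsub>Aut_T\<^esub>"
    by (simp add: Aut_T_def fun_eq_iff xy)
  ultimately show "\<exists>y\<in>carrier Aut_T. y \<otimes>\<^bsub>Aut_T\<^esub> x = \<one>\<^bsub>Aut_T\<^esub>"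
    by blast
qed (auto simp: Aut_T_def bij_comp)

abbreviation mult_T :: "tree_map \<Rightarrow> tree_map \<Rightarrow> tree_map" (infixl "\<cdot>" 70) where
  "g \<cdot> h \<equiv> g \<otimes>\<^bsub>Aut_T\<^esub> h"

abbreviation inv_T :: "tree_map \<Rightarrow> tree_map" where
  "inv_T g \<equiv> inv\<^bsub>Aut_T\<^esub> g"

abbreviation prod_T :: "tree_map list \<Rightarrow> tree_map" where
  "prod_T gs \<equiv> foldr (\<cdot>) gs \<one>\<^bsub>Aut_T\<^esub>"

definition comm_T :: "tree_map \<Rightarrow> tree_map \<Rightarrow> tree_map" where
  "comm_T x y = x \<cdot> y \<cdot> inv_T x \<cdot> inv_T y"

text \<open>The automorphism $(g_0,g_1)\tau$ of the wreath recursion.\<close>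

fun wreath :: "tree_map \<Rightarrow> tree_map \<Rightarrow> (bool \<Rightarrow> bool) \<Rightarrow> tree_map" where
  "wreath g0 g1 \<tau> [] = []"
| "wreath g0 g1 \<tau> (i # w) = \<tau> i # (if i then g1 else g0) w"

definition iota :: "tree_map \<Rightarrow> vertex \<Rightarrow> tree_map" where
  "iota h u w = (if prefix u w then u @ h (drop (length u) w) else w)"


section \<open>Grigorchuk groups\<close>

text \<open>\<open>klein\<close> consists of the three non-trivial elements of the Klein four-group.\<close>

datatype letter = L0 | L1 | L2
datatype klein = Kb | Kc | Kd

definition shift :: "nat \<Rightarrow> (nat \<Rightarrow> letter) \<Rightarrow> (nat \<Rightarrow> letter)" where
  "shift n \<omega> = (\<lambda>i. \<omega> (n + i))"

definition gen_a :: tree_map where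
  "gen_a = wreath id id Not"

fun letter_hom :: "letter \<Rightarrow> klein \<Rightarrow> tree_map" where
  "letter_hom L0 x = (if x = Kd then id else gen_a)"
| "letter_hom L1 x = (if x = Kc then id else gen_a)"
| "letter_hom L2 x = (if x = Kb then id else gen_a)"

text \<open>
  \<open>gen \<omega> x\<close> is $x_\omega$; the recursion is on the vertex acted upon, and \<open>gen_wreath\<close> below is
  the defining equation $x_\omega = (\omega_0(x), x_{\mathfrak s\omega})$.
\<close>

fun gen :: "(nat \<Rightarrow> letter) \<Rightarrow> klein \<Rightarrow> tree_map" where
  "gen \<omega> x [] = []"
| "gen \<omega> x (False # w) = False # letter_hom (\<omega> 0) x w"
| "gen \<omega> x (True # w) = True # gen (shift 1 \<omega>) x w"

lemma gen_wreath: "gen \<omega> x = wreath (letter_hom (\<omega> 0) x) (gen (shift 1 \<omega>) x) id"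
proof
  fix w show "gen \<omega> x w = wreath (letter_hom (\<omega> 0) x) (gen (shift 1 \<omega>) x) id w"
    by (cases "(\<omega>, x, w)" rule: gen.cases) auto
qed

definition gen_set :: "(nat \<Rightarrow> letter) \<Rightarrow> tree_map set" where
  "gen_set \<omega> = {gen_a, gen \<omega> Kb, gen \<omega> Kc, gen \<omega> Kd}"

definition grig :: "(nat \<Rightarrow> letter) \<Rightarrow> tree_map monoid" where
  "grig \<omega> = subgroup_generated Aut_T (gen_set \<omega>)"

lemma gen_set_subset: "gen_set \<omega> \<subseteq> carrier Aut_T"
proof -
  have a2: "gen_a (gen_a w) = w" for w by (cases w) (auto simp: gen_a_def)
  have ap: "prefix (gen_a u) (gen_a v) \<longleftrightarrow> prefix u v" for u v
    by (cases u; cases v) (auto simp: gen_a_def)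
  have h2: "letter_hom l x (letter_hom l x w) = w" for l x w
    by (cases l) (auto simp: a2)
  have hp: "prefix (letter_hom l x u) (letter_hom l x v) \<longleftrightarrow> prefix u v" for l x u v
    by (cases l) (auto simp: ap)
  have g2: "gen \<omega> x (gen \<omega> x w) = w" for \<omega> x w
    by (induction \<omega> x w rule: gen.induct) (auto simp: h2)
  have gp: "prefix (gen \<omega> x u) (gen \<omega> x v) \<longleftrightarrow> prefix u v" for \<omega> x u v
  proof (induction \<omega> x u arbitrary: v rule: gen.induct)
    case (2 \<omega> x w) show ?case by (cases "(\<omega>, x, v)" rule: gen.cases) (auto simp: hp)
  next
    case (3 \<omega> x w) then show ?case by (cases "(\<omega>, x, v)" rule: gen.cases) auto
  qed auto
  show ?thesis
    using o_bij[of gen_a gen_a] o_bij[of "gen \<omega> x" "gen \<omega> x" for x]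
    by (auto simp: gen_set_def Aut_T_def ap gp fun_eq_iff a2 g2)
qed


section \<open>The frequency assumption\<close>

definition marked :: "(nat \<Rightarrow> letter) \<Rightarrow> nat \<Rightarrow> bool" where
  "marked \<omega> i \<longleftrightarrow> [\<omega> i, \<omega> (i + 1), \<omega> (i + 2)] \<in> {[L2, L0, L1], [L2, L1, L1]}"

definition Fr :: "nat \<Rightarrow> (nat \<Rightarrow> letter) \<Rightarrow> bool" where
  "Fr D \<omega> \<longleftrightarrow> (\<forall>k. \<exists>m. m + 3 \<le> D \<and> marked \<omega> (k * D + m))"

definition mk :: "nat \<Rightarrow> (nat \<Rightarrow> letter) \<Rightarrow> nat \<Rightarrow> nat" where
  "mk D \<omega> k = (LEAST m. m + 3 \<le> D \<and> marked \<omega> (k * D + m))"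

definition I_set :: "nat \<Rightarrow> (nat \<Rightarrow> letter) \<Rightarrow> nat set" where
  "I_set D \<omega> = {k * D + mk D \<omega> k + 3 |k. True}"


section \<open>Substitutions\<close>

text \<open>A word $ax_1\,ax_2\cdots ax_r$ over $\{ab,ac,ad\}$ is encoded as the list of the $x_i$.\<close>

fun subst_letter :: "letter \<Rightarrow> klein \<Rightarrow> klein list" where
  "subst_letter L0 Kb = [Kb, Kb]"
| "subst_letter L0 Kc = [Kc, Kc]"
| "subst_letter L0 Kd = [Kb, Kd, Kc]"
| "subst_letter L1 Kb = [Kb, Kb]"
| "subst_letter L1 Kc = [Kd, Kc, Kb]"
| "subst_letter L1 Kd = [Kd, Kd]"
| "subst_letter L2 Kb = [Kc, Kb, Kd]"
| "subst_letter L2 Kc = [Kc, Kc]"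
| "subst_letter L2 Kd = [Kd, Kd]"

definition subst_word :: "letter \<Rightarrow> klein list \<Rightarrow> klein list" where
  "subst_word l w = concat (map (subst_letter l) w)"

definition eval_word :: "(nat \<Rightarrow> letter) \<Rightarrow> klein list \<Rightarrow> tree_map" where
  "eval_word \<omega> w = prod_T (map (\<lambda>x. gen_a \<cdot> gen \<omega> x) w)"

definition represented :: "(nat \<Rightarrow> letter) \<Rightarrow> tree_map \<Rightarrow> bool" where
  "represented \<omega> g \<longleftrightarrow> (\<exists>w. eval_word \<omega> w = g)"

text \<open>
  \<open>zeta_word \<rho>\<close> and \<open>zeta \<rho>\<close> are $\zeta_{\rho_0}$ as a partial map from $G_{\mathfrak s\rho}$ to
  $G_\rho$. The value does not depend on the representing word, which is chosen arbitrarily.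
\<close>

definition zeta_word :: "(nat \<Rightarrow> letter) \<Rightarrow> tree_map \<Rightarrow> tree_map" where
  "zeta_word \<rho> g = eval_word \<rho> (subst_word (\<rho> 0) (SOME w. eval_word (shift 1 \<rho>) w = g))"

definition zeta :: "(nat \<Rightarrow> letter) \<Rightarrow> tree_map \<Rightarrow> tree_map" where
  "zeta \<rho> g =
    (if represented (shift 1 \<rho>) g then zeta_word \<rho> g
     else if represented (shift 1 \<rho>) (inv_T g) then inv_T (zeta_word \<rho> (inv_T g))
     else undefined)"

text \<open>\<open>zeta_iter \<omega> n\<close> is $\zeta_{\omega_0}\circ\cdots\circ\zeta_{\omega_{n-1}}$,
  from $G_{\mathfrak s^n\omega}$ to $G_\omega$.\<close>

primrec zeta_iter :: "(nat \<Rightarrow> letter) \<Rightarrow> nat \<Rightarrow> tree_map \<Rightarrow> tree_map" where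
  "zeta_iter \<omega> 0 g = g"
| "zeta_iter \<omega> (Suc n) g = zeta_iter \<omega> n (zeta (shift n \<omega>) g)"

definition g_elt :: "(nat \<Rightarrow> letter) \<Rightarrow> nat \<Rightarrow> tree_map" where
  "g_elt \<omega> n =
    zeta_iter \<omega> n (gen_a \<cdot> gen (shift n \<omega>) (if \<omega> (n - 1) = L2 then Kc else Kb))"


section \<open>Index sets and conjugated elements\<close>

text \<open>Letters of a word are numbered from $1$, so $u_i$ is \<open>u ! (i - 1)\<close>.\<close>

definition W_set :: "nat \<Rightarrow> (nat \<Rightarrow> letter) \<Rightarrow> nat \<Rightarrow> nat \<Rightarrow> vertex set" where
  "W_set D \<omega> k n = {u. length u = k \<and> (\<forall>i\<in>{1..k}. n + i \<notin> I_set D \<omega> \<longrightarrow> u ! (i - 1) = True)}"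

definition V_set :: "nat \<Rightarrow> (nat \<Rightarrow> letter) \<Rightarrow> nat \<Rightarrow> nat \<Rightarrow> vertex set" where
  "V_set D \<omega> k j =
    {replicate (D - j mod D) True @ u
       @ replicate (mk D \<omega> ((j + D - j mod D + k) div D) + 2) True @ [False]
     |u. u \<in> W_set D \<omega> k (j + D - j mod D)}"

definition h_elt :: "(nat \<Rightarrow> letter) \<Rightarrow> nat \<Rightarrow> vertex \<Rightarrow> nat \<Rightarrow> tree_map" where
  "h_elt \<omega> j v i =
    (if v ! (i - 1) then \<one>\<^bsub>Aut_T\<^esub>
     else iota (comm_T (gen (shift (j + i - 2) \<omega>) Kb) gen_a) (take (i - 2) v))"

definition c_elt :: "(nat \<Rightarrow> letter) \<Rightarrow> nat \<Rightarrow> vertex \<Rightarrow> tree_map" where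
  "c_elt \<omega> j v =
    (let h = prod_T (map (h_elt \<omega> j v) [1..<Suc (length v)])
     in inv_T h \<cdot> gen (shift j \<omega>) Kc \<cdot> h)"

definition g_tilde :: "(nat \<Rightarrow> letter) \<Rightarrow> nat \<Rightarrow> vertex \<Rightarrow> tree_map" where
  "g_tilde \<omega> j v = zeta_iter \<omega> j (gen_a \<cdot> c_elt \<omega> j v)"


section \<open>The measures\<close>

text \<open>
  \<open>F_pmf D \<omega> k j n\<close> is the law of $\gamma_j$, uniform on the family $\mathfrak F_{j,n}$ indexed by
  vertices (counted with multiplicity if two vertices give the same element); \<open>takeWhile id v\<close> is $1^\infty\wedge v$.
\<close>

definition F_pmf :: "nat \<Rightarrow> (nat \<Rightarrow> letter) \<Rightarrow> (nat \<Rightarrow> nat) \<Rightarrow> nat \<Rightarrow> nat \<Rightarrow> tree_map pmf" where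
  "F_pmf D \<omega> k j n =
    (if \<omega> (j - 1) = L2 \<and> n < j + k n \<and> j \<le> n
     then map_pmf (g_tilde \<omega> j)
            (pmf_of_set {v \<in> V_set D \<omega> (2 * k n) j. length (takeWhile id v) \<ge> n - j + D})
     else return_pmf (g_elt \<omega> j))"

definition upsilon :: "nat \<Rightarrow> (nat \<Rightarrow> letter) \<Rightarrow> (nat \<Rightarrow> nat) \<Rightarrow> nat \<Rightarrow> tree_map pmf" where
  "upsilon D \<omega> k n =
    map_pmf
      (\<lambda>x. prod_T (map (\<lambda>i. case x i of (\<epsilon>, \<gamma>) \<Rightarrow> \<gamma> [^]\<^bsub>Aut_T\<^esub> \<epsilon>) (rev [1..<Suc n])))
      (Pi_pmf {1..n} undefined (\<lambda>i. pair_pmf (pmf_of_set {0, 1 :: nat}) (F_pmf D \<omega> k i n)))"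

text \<open>The push-forward under inversion, $\check\upsilon_n(g) = \upsilon_n(g^{-1})$.\<close>

definition upsilon_check :: "nat \<Rightarrow> (nat \<Rightarrow> letter) \<Rightarrow> (nat \<Rightarrow> nat) \<Rightarrow> nat \<Rightarrow> tree_map pmf" where
  "upsilon_check D \<omega> k n = map_pmf inv_T (upsilon D \<omega> k n)"

definition levels :: "nat \<Rightarrow> nat set" where
  "levels D = {n. 0 < n \<and> D dvd n}"

text \<open>The normalization constant; see \<open>mu_has_sum_1\<close>.\<close>

definition C_const :: "nat \<Rightarrow> real \<Rightarrow> real" where
  "C_const D \<beta> = 1 / (\<Sum>\<^sub>\<infinity>n\<in>levels D. 2 * 2 powr (- real n * \<beta>))"

definition mu :: "nat \<Rightarrow> (nat \<Rightarrow> letter) \<Rightarrow> (nat \<Rightarrow> nat) \<Rightarrow> real \<Rightarrow> tree_map \<Rightarrow> real" where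
  "mu D \<omega> k \<beta> g =
    1 / 2 * pmf (pmf_of_set (gen_set \<omega>)) g
    + 1 / 2 * (\<Sum>\<^sub>\<infinity>n\<in>levels D. C_const D \<beta> * 2 powr (- real n * \<beta>)
                 * (pmf (upsilon D \<omega> k n) g + pmf (upsilon_check D \<omega> k n) g))"

lemma pmf_has_sum_1: "(pmf p has_sum 1) UNIV"
proof -
  have abs: "Infinite_Set_Sum.abs_summable_on (pmf p) UNIV" by (rule pmf_abs_summable)
  then have "pmf p summable_on UNIV"
    by (metis abs_summable_equivalent abs_summable_summable)
  moreover have "infsum (pmf p) UNIV = 1"
    using abs by (metis infsetsum_infsum infsetsum_pmf_eq_1 top_greatest)
  ultimately show ?thesis by (metis has_sum_infsum)
qed

lemma mu_has_sum_1:
  assumes "0 < D" "0 < \<beta>"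
  shows "C_const D \<beta> > 0" and "(mu D \<omega> k \<beta> has_sum 1) UNIV"
proof -
  define w :: "nat \<Rightarrow> real" where "w n = 2 * 2 powr (- real n * \<beta>)" for n
  have w: "w n = 2 * (2 powr (- \<beta>)) ^ n" for n
    by (simp add: w_def powr_realpow[symmetric] powr_powr mult.commute)
  have "summable (\<lambda>n. 2 * (2 powr (- \<beta>)) ^ n)"
    using assms by (intro summable_mult summable_geometric) (simp add: powr_less_one)
  then have "w summable_on UNIV"
    unfolding w by (intro summable_nonneg_imp_summable_on) auto
  then have sw: "w summable_on levels D"
    by (rule summable_on_subset_banach) auto
  then obtain Z where Z: "(w has_sum Z) (levels D)"
    by (auto simp: summable_on_def)
  have D: "D \<in> levels D" using assms by (auto simp: levels_def)
  have "Z > 0"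
  proof (rule ccontr)
    assume "\<not> Z > 0"
    then have "w D = 0"
      using nonneg_has_sum_le_0D[OF Z] D by (auto simp: w_def)
    then show False by (simp add: w_def)
  qed
  have C: "C_const D \<beta> = 1 / Z"
    using infsumI[OF Z] unfolding C_const_def w_def[symmetric] by simp
  show "C_const D \<beta> > 0" using C \<open>Z > 0\<close> by simp
  define c :: "nat \<Rightarrow> real" where "c n = C_const D \<beta> * 2 powr (- real n * \<beta>)" for n
  define q where "q n g = pmf (upsilon D \<omega> k n) g + pmf (upsilon_check D \<omega> k n) g" for n g
  have c0: "c n \<ge> 0" for n using \<open>C_const D \<beta> > 0\<close> by (simp add: c_def)
  have q0: "q n g \<ge> 0" for n g by (simp add: q_def)
  have q2: "((\<lambda>g. c n * q n g) has_sum (c n * 2)) UNIV" for n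
  proof -
    have "(q n has_sum (1 + 1)) UNIV"
      unfolding q_def by (intro has_sum_add pmf_has_sum_1)
    from has_sum_cmult_right[OF this, of "c n"] show ?thesis by simp
  qed
  have c1: "((\<lambda>n. c n * 2) has_sum 1) (levels D)"
    using has_sum_cmult_right[OF Z, of "C_const D \<beta>"] C \<open>Z > 0\<close>
    by (simp add: c_def w_def mult_ac)
  have S: "(\<lambda>(n, g). c n * q n g) summable_on levels D \<times> UNIV"
    by (rule summable_on_SigmaI[where g = "\<lambda>n. c n * 2"])
       (use q2 c1 c0 q0 in \<open>auto simp: summable_on_def\<close>)
  have "((\<lambda>(n, g). c n * q n g) has_sum 1) (levels D \<times> UNIV)"
    by (rule has_sum_SigmaI[where g = "\<lambda>n. c n * 2"]) (use q2 c1 S in auto)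
  then have T: "((\<lambda>(g, n). c n * q n g) has_sum 1) (UNIV \<times> levels D)"
    by (subst has_sum_swap) (simp add: case_prod_unfold)
  have r: "((\<lambda>n. c n * q n g) has_sum (\<Sum>\<^sub>\<infinity>n\<in>levels D. c n * q n g)) (levels D)" for g
  proof (rule has_sum_infsum)
    have "(\<lambda>(g, n). c n * q n g) summable_on UNIV \<times> levels D"
      using T by (rule has_sum_imp_summable)
    then show "(\<lambda>n. c n * q n g) summable_on levels D"
      by (rule summable_on_SigmaD1) simp
  qed
  have "((\<lambda>g. \<Sum>\<^sub>\<infinity>n\<in>levels D. c n * q n g) has_sum 1) UNIV"
    by (rule has_sum_SigmaD[OF T]) (use r in auto)
  then have "((\<lambda>g. 1 / 2 * pmf (pmf_of_set (gen_set \<omega>)) g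
      + 1 / 2 * (\<Sum>\<^sub>\<infinity>n\<in>levels D. c n * q n g)) has_sum (1 / 2 * 1 + 1 / 2 * 1)) UNIV"
    by (intro has_sum_add has_sum_cmult_right pmf_has_sum_1)
  then show "(mu D \<omega> k \<beta> has_sum 1) UNIV"
    by (simp add: mu_def[abs_def] c_def q_def)
qed


section \<open>Poisson boundary\<close>

definition harmonic :: "('g, 'm) monoid_scheme \<Rightarrow> ('g \<Rightarrow> real) \<Rightarrow> ('g \<Rightarrow> real) \<Rightarrow> bool" where
  "harmonic G \<mu> f \<longleftrightarrow>
    (\<forall>x\<in>carrier G. ((\<lambda>y. f (x \<otimes>\<^bsub>G\<^esub> y) * \<mu> y) has_sum f x) (carrier G))"

definition nontrivial_poisson_boundary ::
    "('g, 'm) monoid_scheme \<Rightarrow> ('g \<Rightarrow> real) \<Rightarrow> bool" where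
  "nontrivial_poisson_boundary G \<mu> \<longleftrightarrow>
    (\<exists>f. harmonic G \<mu> f
       \<and> (\<exists>B. \<forall>x\<in>carrier G. \<bar>f x\<bar> \<le> B)
       \<and> (\<exists>x\<in>carrier G. \<exists>y\<in>carrier G. f x \<noteq> f y))"

end

theory Submission
  imports Defs
begin

text \<open>
  The Poisson boundary is detected by germs. Every $g\in G_\omega$ acts on the rays of the tree, and near a
  ray $x$ it acts like one of $id,b,c,d$ followed by a change of finitely many letters. Forgetting the
  difference between $id$ and $b$ and between $c$ and $d$ leaves a cocycle \<open>odd_germ\<close> with two values:
  the germ of $gh$ at $x$ is the sum of the germs of $g$ at $x$ and of $h$ at $x\cdot g$. The generators
  $a,b$ have trivial values everywhere, and $c,d$ have the nontrivial value at $1^\infty$ only. If along the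
  random walk $w_t$ the value at $1^\infty$ changes finitely often in expectation, it converges, and
  the probability of a nontrivial limit, as a function of the starting point, is a bounded
  harmonic function. It is not constant, because left multiplication by $c$ exchanges the two limits while the
  limit can be predicted after a long time (\<open>stabilization\<close>).

  The number of changes is estimated through the walk induced on the rays, as
  $\sum_t \mathbf E\, m(x_t)$, where $m(x)$ is the probability that a step has nontrivial germ at $x$.
  There are three ingredients.

  First, the factors of $\upsilon_n$ have a simple form. A substitution $\zeta$ applied to an element with an even
  number of special letters gives an element that fixes the first level and has conjugates of the given element as
  sections (\<open>zeta_iter_sections\<close>). Hence $\gamma_j$ fixes level $j$ and exchanges the children of each of its
  vertices. For any values of the factors, the $2^n$ choices of the exponents therefore move a ray to $2^n$
  different rays, and the transition probabilities of $\upsilon_n$ are at most $2^{-n}$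
  (\<open>cube_independence\<close>). This gives a Nash type inequality: the collision probability $u_t$ of two
  independent copies of the induced walk satisfies $u_{t+1}\le u_t-c\,u_t^{1+\beta}$, so that
  all transition probabilities in $t$ steps are $O(t^{-1/\beta})$ (\<open>heat_kernel\<close>). Since $1/\beta>1$, a
  function $w$ on rays with $w\le a$ and total mass at most $b$ has $\sum_t \mathbf E\,w(x_t)=O(a^{1-\beta}b^\beta)$
  (\<open>green_bound\<close>).

  Second, the rays at which $\gamma_j$ has nontrivial germ are counted. There are at most $2^j$ of them, one
  below each vertex of level $j$. For the conjugated elements $\mathfrak c_j^v$ the
  conjugating product has trivial germs and moves $1^\infty$ to $v1^\infty$, so that the germ of $c$ is moved from
  $1^\infty$ to $v1^\infty$ (\<open>c_elt_props\<close>). Different $v$ give disjoint sets of rays. Hence the factor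
  with index $j$ contributes nothing if $\omega_{j-1}\ne\mathbf 2$, and otherwise it contributes
  $O(|V|^{-(1-\beta)}2^{j\beta})$, where $|V|\ge 2^{(2k_n-(n-j))/D-1}$ is the number of admitted vertices if $n-k_n<j$, and $|V|=1$ otherwise (\<open>F_pmf_germs\<close>, \<open>card_V_far\<close>). Weighted by
  $2^{-n\beta}$ and summed over $j$ this is $O(2^{-2k_n(1-\beta)/D})=O(n^{-2A(1-\beta)/D})$, which is summable since
  $2A(1-\beta)/D>1+\beta>1$ (\<open>weight_sum\<close>).

  Third, the conjugating elements have to lie in the group, and words have to represent the elements that are
  substituted. For the former, the elements of $G_\omega$ that are trivial modulo each of the
  normal closures of $b$, $c$ and $d$ can be moved to a subtree (\<open>iota_core\<close>), and $[b,aca]$ is such an element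
  if $\omega_0=\mathbf 2$. For the latter, $ac$ has finite order, and it follows that all elements are represented
  by positive words (\<open>represented_all\<close>).
\<close>

(* The dot always denotes the product of automorphisms. *)
no_notation HLD_nxt (infixr "\<cdot>" 65)

section \<open>Tree automorphisms, rays and activities\<close>

lemma mult_T_apply: "(g \<cdot> h) w = h (g w)"
  by (simp add: Aut_T_def)

lemma one_T [simp]: "\<one>\<^bsub>Aut_T\<^esub> = id"
  by (simp add: Aut_T_def)

lemma mult_T_comp: "g \<cdot> h = h \<circ> g"
  by (simp add: Aut_T_def)

lemma mult_T_closed [simp]: "g \<in> carrier Aut_T \<Longrightarrow> h \<in> carrier Aut_T \<Longrightarrow> g \<cdot> h \<in> carrier Aut_T"
  by (rule monoid.m_closed[OF group.is_monoid[OF group_Aut_T]])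

lemma inv_T_closed [simp]: "g \<in> carrier Aut_T \<Longrightarrow> inv_T g \<in> carrier Aut_T"
  by (rule group.inv_closed[OF group_Aut_T])

text \<open>The simplifier unfolds \<open>id\<close> to an abstraction, so the rules about the identity are stated for both forms.\<close>

lemma id_in_Aut_T [simp]: "id \<in> carrier Aut_T" "(\<lambda>w. w) \<in> carrier Aut_T"
  by (auto simp: Aut_T_def bij_id[unfolded id_def])

lemma inv_T_apply [simp]:
  assumes "g \<in> carrier Aut_T"
  shows "inv_T g (g w) = w" "g (inv_T g w) = w"
  using group.r_inv[OF group_Aut_T assms] group.l_inv[OF group_Aut_T assms]
  by (metis id_apply mult_T_apply one_T)+

lemma inv_T_unique:
  assumes "g \<in> carrier Aut_T" "\<And>w. h (g w) = w"
  shows "inv_T g = h"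
  by (rule ext) (metis assms inv_T_apply(2))

lemma inv_T_involution:
  "g \<in> carrier Aut_T \<Longrightarrow> (\<And>w. g (g w) = w) \<Longrightarrow> inv_T g = g"
  by (rule inv_T_unique)

lemma inv_T_inv_T [simp]: "g \<in> carrier Aut_T \<Longrightarrow> inv_T (inv_T g) = g"
  by (rule group.inv_inv[OF group_Aut_T])

lemma inv_T_mult:
  "g \<in> carrier Aut_T \<Longrightarrow> h \<in> carrier Aut_T \<Longrightarrow> inv_T (g \<cdot> h) = inv_T h \<cdot> inv_T g"
  by (rule group.inv_mult_group[OF group_Aut_T])

lemma mult_T_assoc: "g \<cdot> h \<cdot> k = g \<cdot> (h \<cdot> k)"
  by (simp add: mult_T_comp o_assoc)

lemma mult_T_id [simp]: "g \<cdot> id = g" "id \<cdot> g = g" "g \<cdot> (\<lambda>w. w) = g" "(\<lambda>w. w) \<cdot> g = g"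
  by (simp_all add: mult_T_comp comp_def)

lemma Aut_T_prefix_iff: "g \<in> carrier Aut_T \<Longrightarrow> prefix (g u) (g v) \<longleftrightarrow> prefix u v"
  by (simp add: Aut_T_def)

lemma Aut_T_inj: "g \<in> carrier Aut_T \<Longrightarrow> g u = g v \<longleftrightarrow> u = v"
  by (metis inv_T_apply(1))

text \<open>The level of a vertex is the number of its proper prefixes, and so is an order invariant.\<close>

lemma Aut_T_length:
  assumes g: "g \<in> carrier Aut_T"
  shows "length (g u) = length u"
proof -
  have card: "card {p. prefix p u} = Suc (length u)" for u :: vertex
  proof -
    have "{p. prefix p u} = set (prefixes u)" by auto
    then show ?thesis by (simp add: distinct_card)
  qed
  have "bij_betw g {p. prefix p u} {p. prefix p (g u)}"
  proof (rule bij_betwI[where g = "inv_T g"])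
    show "inv_T g \<in> {p. prefix p (g u)} \<rightarrow> {p. prefix p u}"
      using g Aut_T_prefix_iff by fastforce
  qed (use g in \<open>auto simp: Aut_T_prefix_iff\<close>)
  then have "card {p. prefix p u} = card {p. prefix p (g u)}"
    by (rule bij_betw_same_card)
  then show ?thesis by (simp add: card)
qed

lemma Aut_T_take:
  assumes g: "g \<in> carrier Aut_T"
  shows "take n (g u) = g (take n u)"
proof -
  have "prefix (g (take n u)) (g u)"
    using g by (simp add: Aut_T_prefix_iff take_is_prefix)
  then obtain r where r: "g u = g (take n u) @ r" by (auto elim: prefixE)
  show ?thesis
  proof (cases "n \<le> length u")
    case True
    then show ?thesis using r g by (simp add: Aut_T_length)
  next
    case False
    then show ?thesis using g by (simp add: Aut_T_length)
  qed
qed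

lemma Aut_T_Nil [simp]: "g \<in> carrier Aut_T \<Longrightarrow> g [] = []"
  using Aut_T_length[of g "[]"] by simp

text \<open>The activity of $g$ at $u$ tells whether $g$ exchanges the two children of $u$. The image of the left child
  ends in $1$ exactly in this case.\<close>

definition activity :: "tree_map \<Rightarrow> vertex \<Rightarrow> bool" where
  "activity g u = last (g (u @ [False]))"

text \<open>An automorphism is determined by its activities. All later computations of images of rays and vertices go
  through this rule.\<close>

lemma Aut_T_snoc:
  assumes g: "g \<in> carrier Aut_T"
  shows "g (u @ [i]) = g u @ [i \<noteq> activity g u]"
proof -
  have *: "g (u @ [j]) = g u @ [last (g (u @ [j]))]" for j
  proof -
    have "length (g (u @ [j])) = Suc (length u)" using g by (simp add: Aut_T_length)
    then have "g (u @ [j]) = butlast (g (u @ [j])) @ [last (g (u @ [j]))]"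
      by (metis append_butlast_last_id list.size(3) nat.distinct(1))
    moreover have "butlast (g (u @ [j])) = g u"
      using Aut_T_take[OF g, of "length u" "u @ [j]"] g
      by (simp add: butlast_conv_take Aut_T_length)
    ultimately show ?thesis by simp
  qed
  have "g (u @ [True]) \<noteq> g (u @ [False])" using g by (simp add: Aut_T_inj)
  then have "last (g (u @ [True])) = (\<not> last (g (u @ [False])))"
    using *[of True] *[of False] by metis
  then have "last (g (u @ [i])) = (i \<noteq> activity g u)"
    by (cases i) (auto simp: activity_def)
  then show ?thesis using *[of i] by simp
qed

lemma activity_mult:
  assumes "g \<in> carrier Aut_T" "h \<in> carrier Aut_T"
  shows "activity (g \<cdot> h) u = (activity g u \<noteq> activity h (g u))"
  using assms by (simp add: activity_def[of "g \<cdot> h"] Aut_T_snoc mult_T_apply)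

lemma activity_id [simp]: "activity id u = False" "activity (\<lambda>w. w) u = False"
  by (simp_all add: activity_def)

subsection \<open>The action on rays\<close>

definition pref :: "(nat \<Rightarrow> bool) \<Rightarrow> nat \<Rightarrow> vertex" where
  "pref x n = map x [0..<n]"

text \<open>Automorphisms are defined on vertices; the image of a ray has the images of its prefixes as prefixes.\<close>

definition act :: "(nat \<Rightarrow> bool) \<Rightarrow> tree_map \<Rightarrow> (nat \<Rightarrow> bool)" where
  "act x g = (\<lambda>n. g (pref x (Suc n)) ! n)"

lemma length_pref [simp]: "length (pref x n) = n"
  by (simp add: pref_def)

lemma pref_Suc: "pref x (Suc n) = pref x n @ [x n]"
  by (simp add: pref_def)

lemma pref_0 [simp]: "pref x 0 = []"
  by (simp add: pref_def)

lemma nth_pref: "i < n \<Longrightarrow> pref x n ! i = x i"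
  by (simp add: pref_def)

lemma take_pref: "m \<le> n \<Longrightarrow> take m (pref x n) = pref x m"
  by (simp add: pref_def take_map)

lemma pref_eq_iff: "pref x n = pref y n \<longleftrightarrow> (\<forall>i<n. x i = y i)"
  by (auto simp: pref_def)

lemma pref_inject: "(\<And>n. pref x n = pref y n) \<Longrightarrow> x = y"
  by (rule ext) (metis pref_eq_iff lessI)

lemma pref_act:
  assumes "g \<in> carrier Aut_T"
  shows "pref (act x g) n = g (pref x n)"
proof (induction n)
  case (Suc n)
  have "g (pref x (Suc n)) = g (pref x n) @ [act x g n]"
    using assms by (simp add: act_def pref_Suc Aut_T_snoc Aut_T_length nth_append)
  then show ?case using Suc by (simp add: pref_Suc)
qed (use assms in simp)

lemma act_mult:
  assumes "g \<in> carrier Aut_T" "h \<in> carrier Aut_T"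
  shows "act x (g \<cdot> h) = act (act x g) h"
  by (rule pref_inject) (simp add: pref_act assms mult_T_apply)

lemma act_id [simp]: "act x id = x" "act x (\<lambda>w. w) = x"
  by (auto simp: act_def nth_pref)

lemma act_inv [simp]:
  assumes "g \<in> carrier Aut_T"
  shows "act (act x g) (inv_T g) = x" "act (act x (inv_T g)) g = x"
  by (rule pref_inject, simp add: pref_act assms)+

lemma bij_act: "g \<in> carrier Aut_T \<Longrightarrow> bij (\<lambda>x. act x g)"
  by (rule bij_betw_byWitness[where f' = "\<lambda>x. act x (inv_T g)"]) auto

lemma act_nth:
  assumes "g \<in> carrier Aut_T"
  shows "act x g n = (x n \<noteq> activity g (pref x n))"
  using assms by (simp add: act_def pref_Suc Aut_T_snoc Aut_T_length nth_append)

subsection \<open>Signs of levels\<close>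

text \<open>The sign of level n is a homomorphism to the group of signs because each automorphism permutes
  the level; these homomorphisms compute the parities of letter counts.\<close>

definition level_sign :: "nat \<Rightarrow> tree_map \<Rightarrow> int" where
  "level_sign n g = (\<Prod>u | length u = n. if activity g u then - 1 else 1)"

lemma finite_level: "finite {u :: vertex. length u = n}"
  using finite_lists_length_eq[of "UNIV :: bool set" n] by simp

lemma level_sign_mult:
  assumes g: "g \<in> carrier Aut_T" and h: "h \<in> carrier Aut_T"
  shows "level_sign n (g \<cdot> h) = level_sign n g * level_sign n h"
proof -
  have bij: "bij_betw g {u. length u = n} {u. length u = n}"
    by (rule bij_betwI[where g = "inv_T g"]) (use g in \<open>auto simp: Aut_T_length\<close>)
  have "level_sign n (g \<cdot> h) = (\<Prod>u | length u = n. (if activity g u then - 1 else 1) * (if activity h (g u) then - 1 else 1))"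
    unfolding level_sign_def by (rule prod.cong) (auto simp: activity_mult[OF g h])
  also have "\<dots> = level_sign n g * (\<Prod>u | length u = n. if activity h (g u) then - 1 else 1)"
    by (simp add: prod.distrib level_sign_def)
  also have "(\<Prod>u | length u = n. if activity h (g u) then - 1 else 1) = level_sign n h"
    unfolding level_sign_def by (rule prod.reindex_bij_betw[OF bij])
  finally show ?thesis .
qed

lemma level_sign_id [simp]: "level_sign n id = 1" "level_sign n (\<lambda>w. w) = 1"
  unfolding level_sign_def activity_id by simp_all

lemma level_sign_sq: "level_sign n g * level_sign n g = 1"
  by (simp add: level_sign_def flip: prod.distrib) (rule prod.neutral, simp)

lemma level_sign_inv:
  assumes "g \<in> carrier Aut_T"
  shows "level_sign n (inv_T g) = level_sign n g"
proof -
  have "level_sign n (inv_T g) * level_sign n g = 1"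
    using level_sign_mult[of "inv_T g" g n] group.l_inv[OF group_Aut_T assms] assms by simp
  then show ?thesis using level_sign_sq[of n g]
    by (metis mult.assoc mult.right_neutral mult_1)
qed

lemma level_sign_single:
  assumes "length v = n" "\<And>u. length u = n \<Longrightarrow> activity g u \<longleftrightarrow> u = v \<and> P"
  shows "level_sign n g = (if P then - 1 else 1)"
proof -
  have "level_sign n g = (\<Prod>u | length u = n. if u = v then (if P then - 1 else 1) else 1)"
    unfolding level_sign_def using assms by (intro prod.cong) auto
  also have "\<dots> = (if P then - 1 else 1)"
    using assms(1) by (subst prod.delta[OF finite_level]) auto
  finally show ?thesis .
qed

section \<open>Grigorchuk groups\<close>

lemma gen_a_simps [simp]: "gen_a [] = []" "gen_a (i # w) = (\<not> i) # w"
  by (simp_all add: gen_a_def)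

lemma gen_a_gen_a [simp]: "gen_a (gen_a w) = w"
  by (cases w) auto

lemma letter_hom_invol [simp]: "letter_hom l x (letter_hom l x w) = w"
  by (cases l) auto

lemma gen_gen [simp]: "gen \<omega> x (gen \<omega> x w) = w"
  by (induction \<omega> x w rule: gen.induct) auto

lemma gen_a_Aut [simp]: "gen_a \<in> carrier Aut_T" and gen_Aut [simp]: "gen \<omega> x \<in> carrier Aut_T"
  using gen_set_subset[of \<omega>] by (auto simp: gen_set_def intro: klein.exhaust[of x])

lemma inv_gen_a [simp]: "inv_T gen_a = gen_a" and inv_gen [simp]: "inv_T (gen \<omega> x) = gen \<omega> x"
  by (rule inv_T_involution; simp)+

fun moves :: "letter \<Rightarrow> klein \<Rightarrow> bool" where
  "moves L0 x = (x \<noteq> Kd)"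
| "moves L1 x = (x \<noteq> Kc)"
| "moves L2 x = (x \<noteq> Kb)"

lemma letter_hom_moves: "letter_hom l x = (if moves l x then gen_a else id)"
  by (cases l) auto

lemma activity_gen_a: "activity gen_a u \<longleftrightarrow> u = []"
  by (cases u) (auto simp: activity_def)

lemma activity_letter_hom: "activity (letter_hom l x) u \<longleftrightarrow> u = [] \<and> moves l x"
  by (auto simp: letter_hom_moves activity_gen_a)

lemma letter_hom_Aut [simp]: "letter_hom l x \<in> carrier Aut_T"
  by (simp add: letter_hom_moves)

lemma Aut_T_snoc_ne: "g \<in> carrier Aut_T \<Longrightarrow> g (w @ [i]) \<noteq> []"
  by (simp add: Aut_T_snoc)

lemma shift_shift [simp]: "shift m (shift n \<omega>) = shift (n + m) \<omega>"
  by (auto simp: shift_def add.assoc)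

lemma shift_apply: "shift n \<omega> i = \<omega> (n + i)"
  by (simp add: shift_def)

lemma shift_0 [simp]: "shift 0 \<omega> = \<omega>"
  by (auto simp: shift_def)

text \<open>The recursion $x_\omega=(\omega_0(x),x_{\mathfrak s\omega})$ stops at the first zero, so only the left
  children of vertices on the ray $1^\infty$ can be active.\<close>

lemma activity_gen:
  "activity (gen \<omega> x) u \<longleftrightarrow> (\<exists>m. u = replicate m True @ [False] \<and> moves (\<omega> m) x)"
proof (induction u arbitrary: \<omega>)
  case Nil
  show ?case by (simp add: activity_def)
next
  case (Cons i u)
  show ?case
  proof (cases i)
    case True
    have "activity (gen \<omega> x) (i # u) = activity (gen (shift 1 \<omega>) x) u"
      using True Aut_T_snoc_ne[of "gen (shift 1 \<omega>) x" u False] by (simp add: activity_def)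
    also have "\<dots> \<longleftrightarrow> (\<exists>m. i # u = replicate (Suc m) True @ [False] \<and> moves (\<omega> (Suc m)) x)"
      using Cons.IH[of "shift 1 \<omega>"] True by (simp add: shift_def)
    also have "\<dots> \<longleftrightarrow> (\<exists>m. i # u = replicate m True @ [False] \<and> moves (\<omega> m) x)"
      using True by (metis append_self_conv2 list.inject not0_implies_Suc replicate_0)
    finally show ?thesis .
  next
    case False
    have "activity (gen \<omega> x) (i # u) = activity (letter_hom (\<omega> 0) x) u"
      using False Aut_T_snoc_ne[of "letter_hom (\<omega> 0) x" u False] by (simp add: activity_def)
    also have "\<dots> \<longleftrightarrow> (\<exists>m. i # u = replicate m True @ [False] \<and> moves (\<omega> m) x)"
      unfolding activity_letter_hom
    proof safe
      fix m assume "i # u = replicate m True @ [False]"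
      then have "m = 0 \<and> u = []" using False by (cases m) auto
      then show "u = []" and "moves (\<omega> m) x \<Longrightarrow> moves (\<omega> 0) x" by auto
    next
      assume "u = []" "moves (\<omega> 0) x"
      then show "\<exists>m. [i] = replicate m True @ [False] \<and> moves (\<omega> m) x"
        using False by (intro exI[of _ 0]) simp
    qed
    finally show ?thesis .
  qed
qed

lemma level_sign_gen_a: "level_sign n gen_a = (if n = 0 then - 1 else 1)"
  by (rule level_sign_single[where v = "replicate n False"]) (auto simp: activity_gen_a)

lemma level_sign_gen_0: "level_sign 0 (gen \<omega> x) = 1"
  using level_sign_single[of "[]" 0 "gen \<omega> x" False] by (simp add: activity_gen)

lemma level_sign_gen_Suc: "level_sign (Suc n) (gen \<omega> x) = (if moves (\<omega> n) x then - 1 else 1)"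
  by (rule level_sign_single[where v = "replicate n True @ [False]"]) (auto simp: activity_gen)

subsection \<open>Membership in the group\<close>

abbreviation Grig :: "(nat \<Rightarrow> letter) \<Rightarrow> tree_map set" where
  "Grig \<omega> \<equiv> carrier (grig \<omega>)"

lemma Grig_eq: "Grig \<omega> = generate Aut_T (gen_set \<omega>)"
  using gen_set_subset[of \<omega>] by (simp add: grig_def carrier_subgroup_generated Int_absorb1)

lemma Grig_subset: "Grig \<omega> \<subseteq> carrier Aut_T"
  unfolding Grig_eq by (rule group.generate_incl[OF group_Aut_T gen_set_subset])

lemma Grig_Aut [simp]: "g \<in> Grig \<omega> \<Longrightarrow> g \<in> carrier Aut_T"
  using Grig_subset by blast

lemma Grig_mult [simp]: "g \<in> Grig \<omega> \<Longrightarrow> h \<in> Grig \<omega> \<Longrightarrow> g \<cdot> h \<in> Grig \<omega>"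
  unfolding Grig_eq by (rule generate.eng)

lemma Grig_id [simp]: "id \<in> Grig \<omega>" "(\<lambda>w. w) \<in> Grig \<omega>"
  unfolding Grig_eq using generate.one[of Aut_T "gen_set \<omega>"] by (auto simp: id_def)

lemma Grig_gen_a [simp]: "gen_a \<in> Grig \<omega>" and Grig_gen [simp]: "gen \<omega> x \<in> Grig \<omega>"
  unfolding Grig_eq by (rule generate.incl; cases x; simp add: gen_set_def)+

lemma Grig_inv [simp]: "g \<in> Grig \<omega> \<Longrightarrow> inv_T g \<in> Grig \<omega>"
  unfolding Grig_eq by (rule group.generate_m_inv_closed[OF group_Aut_T gen_set_subset])

text \<open>The generators are involutions, so inverses need no separate case.\<close>

lemma Grig_induct [consumes 1, case_names id a gen mult]:
  assumes "g \<in> Grig \<omega>" and "P id" "P gen_a" "\<And>x. P (gen \<omega> x)"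
    and "\<And>g h. g \<in> Grig \<omega> \<Longrightarrow> h \<in> Grig \<omega> \<Longrightarrow> P g \<Longrightarrow> P h \<Longrightarrow> P (g \<cdot> h)"
  shows "P g"
proof -
  have "g \<in> generate Aut_T (gen_set \<omega>)" using assms(1) by (simp add: Grig_eq)
  then show ?thesis
  proof (induction rule: generate.induct)
    case one
    then show ?case using assms(2) by (subst one_T)
  next
    case (incl h)
    then show ?case using assms by (auto simp: gen_set_def)
  next
    case (inv h)
    then have "inv_T h = h" by (auto simp: gen_set_def)
    then show ?case using inv assms by (auto simp: gen_set_def)
  next
    case (eng h1 h2)
    then show ?case using assms(5)[of h1 h2] by (simp add: Grig_eq)
  qed
qed

lemma gen_mult_klein:
  "gen \<omega> Kb (gen \<omega> Kc w) = gen \<omega> Kd w" "gen \<omega> Kc (gen \<omega> Kb w) = gen \<omega> Kd w"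
  "gen \<omega> Kb (gen \<omega> Kd w) = gen \<omega> Kc w" "gen \<omega> Kd (gen \<omega> Kb w) = gen \<omega> Kc w"
  "gen \<omega> Kc (gen \<omega> Kd w) = gen \<omega> Kb w" "gen \<omega> Kd (gen \<omega> Kc w) = gen \<omega> Kb w"
proof -
  have l: "x \<noteq> y \<Longrightarrow> y \<noteq> z \<Longrightarrow> x \<noteq> z \<Longrightarrow> letter_hom l x (letter_hom l y w) = letter_hom l z w" for l x y z w
    by (cases l; cases x; cases y; cases z) auto
  have "x \<noteq> y \<Longrightarrow> y \<noteq> z \<Longrightarrow> x \<noteq> z \<Longrightarrow> gen \<omega> x (gen \<omega> y w) = gen \<omega> z w" for x y z \<omega> w
  proof (induction w arbitrary: \<omega>)
    case (Cons i w)
    then show ?case by (cases i) (auto simp: l)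
  qed simp
  then show
    "gen \<omega> Kb (gen \<omega> Kc w) = gen \<omega> Kd w" "gen \<omega> Kc (gen \<omega> Kb w) = gen \<omega> Kd w"
    "gen \<omega> Kb (gen \<omega> Kd w) = gen \<omega> Kc w" "gen \<omega> Kd (gen \<omega> Kb w) = gen \<omega> Kc w"
    "gen \<omega> Kc (gen \<omega> Kd w) = gen \<omega> Kb w" "gen \<omega> Kd (gen \<omega> Kc w) = gen \<omega> Kb w"
    by auto
qed

section \<open>Germs along rays\<close>

text \<open>All that the algebra uses of the frequency assumption: $\mathbf 2$ separates $b$ from $c$ and $d$, while
  $\mathbf 1$ separates $c$ from $b$ and $d$.\<close>

definition rich :: "(nat \<Rightarrow> letter) \<Rightarrow> bool" where
  "rich \<omega> \<longleftrightarrow> (\<forall>N. (\<exists>n\<ge>N. \<omega> n = L1) \<and> (\<exists>n\<ge>N. \<omega> n = L2))"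

lemma rich_shift: "rich \<omega> \<Longrightarrow> rich (shift j \<omega>)"
  unfolding rich_def shift_apply
proof (intro allI conjI)
  fix N
  assume r: "\<forall>N. (\<exists>n\<ge>N. \<omega> n = L1) \<and> (\<exists>n\<ge>N. \<omega> n = L2)"
  have "\<exists>n\<ge>N. \<omega> (j + n) = l" if "\<exists>n\<ge>j + N. \<omega> n = l" for l
    using that by (metis add_leD1 add_le_cancel_left le_Suc_ex)
  then show "\<exists>n\<ge>N. \<omega> (j + n) = L1" "\<exists>n\<ge>N. \<omega> (j + n) = L2" using r by blast+
qed

lemma Fr_D: "Fr D \<omega> \<Longrightarrow> 3 \<le> D"
  unfolding Fr_def by (metis add_leD2)

lemma Fr_rich:
  assumes "Fr D \<omega>" shows "rich \<omega>"
  unfolding rich_def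
proof
  fix N
  obtain m where m: "marked \<omega> (N * D + m)" using assms by (auto simp: Fr_def)
  have "N * D + m \<ge> N" using Fr_D[OF assms] by (simp add: trans_le_add1)
  moreover have "\<omega> (N * D + m) = L2" "\<omega> (N * D + m + 2) = L1"
    using m by (auto simp: marked_def)
  ultimately show "(\<exists>n\<ge>N. \<omega> n = L1) \<and> (\<exists>n\<ge>N. \<omega> n = L2)"
    by (meson trans_le_add1)
qed

text \<open>The germ of an element of \<open>Grig \<rho>\<close> at a ray is one of $id,b,c,d$, seen at any deep vertex of the
  ray; the letter $\mathbf 2$ separates $\{id,b\}$ from $\{c,d\}$ by the activity at the left child.\<close>

definition has_germ :: "(nat \<Rightarrow> letter) \<Rightarrow> tree_map \<Rightarrow> (nat \<Rightarrow> bool) \<Rightarrow> bool \<Rightarrow> bool" where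
  "has_germ \<rho> g x s \<longleftrightarrow> (\<exists>N. \<forall>n\<ge>N. \<not> activity g (pref x n) \<and> (\<rho> n = L2 \<longrightarrow> activity g (pref x n @ [False]) = s))"

definition odd_germ :: "(nat \<Rightarrow> letter) \<Rightarrow> tree_map \<Rightarrow> (nat \<Rightarrow> bool) \<Rightarrow> bool" where
  "odd_germ \<rho> g x = has_germ \<rho> g x True"

abbreviation ones :: "nat \<Rightarrow> bool" where
  "ones \<equiv> (\<lambda>_. True)"

lemma has_germ_unique:
  assumes "rich \<rho>" "has_germ \<rho> g x s" "has_germ \<rho> g x t"
  shows "s = t"
proof -
  obtain N1 where 1: "\<And>n. n \<ge> N1 \<Longrightarrow> \<rho> n = L2 \<Longrightarrow> activity g (pref x n @ [False]) = s"
    using assms(2) by (auto simp: has_germ_def)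
  obtain N2 where 2: "\<And>n. n \<ge> N2 \<Longrightarrow> \<rho> n = L2 \<Longrightarrow> activity g (pref x n @ [False]) = t"
    using assms(3) by (auto simp: has_germ_def)
  obtain n where "n \<ge> max N1 N2" "\<rho> n = L2" using assms(1) unfolding rich_def by blast
  then show ?thesis using 1 2 by auto
qed

lemma has_germ_odd_germ: "rich \<rho> \<Longrightarrow> has_germ \<rho> g x s \<Longrightarrow> odd_germ \<rho> g x = s"
  unfolding odd_germ_def by (metis (full_types) has_germ_unique)

text \<open>Deep along $x$ the element $g$ maps the left child of a vertex of $x$ to the left child of a vertex of
  $x\cdot g$. Hence the germ of $h$ is read off along $x\cdot g$.\<close>

lemma has_germ_mult:
  assumes g: "g \<in> carrier Aut_T" and h: "h \<in> carrier Aut_T"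
    and "has_germ \<rho> g x s" "has_germ \<rho> h (act x g) t"
  shows "has_germ \<rho> (g \<cdot> h) x (s \<noteq> t)"
proof -
  obtain N1 where 1: "\<And>n. n \<ge> N1 \<Longrightarrow> \<not> activity g (pref x n) \<and> (\<rho> n = L2 \<longrightarrow> activity g (pref x n @ [False]) = s)"
    using assms(3) by (auto simp: has_germ_def)
  obtain N2 where 2: "\<And>n. n \<ge> N2 \<Longrightarrow> \<not> activity h (pref (act x g) n) \<and>
      (\<rho> n = L2 \<longrightarrow> activity h (pref (act x g) n @ [False]) = t)"
    using assms(4) by (auto simp: has_germ_def)
  show ?thesis
    unfolding has_germ_def
  proof (intro exI[of _ "max N1 N2"] allI impI)
    fix n assume "max N1 N2 \<le> n"
    then show "\<not> activity (g \<cdot> h) (pref x n) \<and> (\<rho> n = L2 \<longrightarrow> activity (g \<cdot> h) (pref x n @ [False]) = (s \<noteq> t))"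
      using 1[of n] 2[of n] by (auto simp: activity_mult[OF g h] pref_act[OF g] Aut_T_snoc[OF g])
  qed
qed

lemma has_germ_id: "has_germ \<rho> id x False"
  by (simp add: has_germ_def)

lemma has_germ_gen_a: "has_germ \<rho> gen_a x False"
  unfolding has_germ_def by (rule exI[of _ 1]) (auto simp: activity_gen_a pref_def)

text \<open>Away from $1^\infty$ the vertices of the ray leave the set of active vertices after the first zero. On
  $1^\infty$ the activities at the left children are given by the letters of $\rho$, and $\mathbf 2$ kills $b$ only.\<close>

lemma has_germ_gen: "has_germ \<rho> (gen \<rho> k) x (x = ones \<and> k \<noteq> Kb)"
proof (cases "x = ones")
  case True
  have "pref ones n = replicate n True" for n by (simp add: pref_def map_replicate_const)
  moreover have "replicate n True \<noteq> replicate m True @ [False]" for n m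
    by (metis in_set_conv_decomp in_set_replicate)
  moreover have "replicate n True @ [False] = replicate m True @ [False] \<longleftrightarrow> n = m" for n m
    by (metis append_same_eq length_replicate)
  ultimately show ?thesis using True by (auto simp: has_germ_def activity_gen)
next
  case False
  then obtain m where m: "\<not> x m" by auto
  have "False \<in> set (butlast (pref x n @ w)) \<or> False \<in> set (pref x n) \<and> w = []"
    if "n > m" for n w
  proof -
    have "False \<in> set (pref x n)" using m that by (auto simp: pref_def)
    then show ?thesis by (cases "w = []") (auto simp: butlast_append)
  qed
  moreover have "False \<notin> set (butlast (replicate r True @ [False]))" for r by simp
  moreover have "False \<in> set (butlast (pref x n))" if "n > Suc m" for n
    using that m by (cases n) (auto simp: pref_def)
  ultimately have "\<not> activity (gen \<rho> k) (pref x n) \<and> \<not> activity (gen \<rho> k) (pref x n @ [False])"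
    if "n \<ge> Suc (Suc m)" for n
    using that unfolding activity_gen by (metis Suc_le_lessD Suc_lessD list.distinct(1))
  then show ?thesis
    using False unfolding has_germ_def by (intro exI[of _ "Suc (Suc m)"]) auto
qed

lemma has_germ_Grig:
  assumes "g \<in> Grig \<rho>"
  shows "\<exists>s. has_germ \<rho> g x s"
  using assms
proof (induction arbitrary: x rule: Grig_induct)
  case (mult g h)
  then show ?case using has_germ_mult[of g h \<rho> x] by (meson Grig_Aut)
qed (use has_germ_id has_germ_gen_a has_germ_gen in blast)+

lemma has_germ_odd_germ_Grig: "rich \<rho> \<Longrightarrow> g \<in> Grig \<rho> \<Longrightarrow> has_germ \<rho> g x (odd_germ \<rho> g x)"
  using has_germ_Grig has_germ_odd_germ by blast

lemma odd_germ_mult: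
  assumes "rich \<rho>" "g \<in> Grig \<rho>" "h \<in> Grig \<rho>"
  shows "odd_germ \<rho> (g \<cdot> h) x = (odd_germ \<rho> g x \<noteq> odd_germ \<rho> h (act x g))"
  by (rule has_germ_odd_germ[OF assms(1) has_germ_mult]) (use assms has_germ_odd_germ_Grig in auto)

lemma odd_germ_id [simp]: "rich \<rho> \<Longrightarrow> odd_germ \<rho> id x = False" "rich \<rho> \<Longrightarrow> odd_germ \<rho> (\<lambda>w. w) x = False"
  using has_germ_odd_germ[OF _ has_germ_id] by (simp_all add: id_def)

lemma odd_germ_gen_a [simp]: "rich \<rho> \<Longrightarrow> odd_germ \<rho> gen_a x = False"
  by (rule has_germ_odd_germ[OF _ has_germ_gen_a])

lemma odd_germ_gen: "rich \<rho> \<Longrightarrow> odd_germ \<rho> (gen \<rho> k) x = (x = ones \<and> k \<noteq> Kb)"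
  by (rule has_germ_odd_germ[OF _ has_germ_gen])

lemma odd_germ_inv:
  assumes "rich \<rho>" "g \<in> Grig \<rho>"
  shows "odd_germ \<rho> (inv_T g) x = odd_germ \<rho> g (act x (inv_T g))"
proof -
  have "odd_germ \<rho> (inv_T g \<cdot> g) x = False"
    using group.l_inv[OF group_Aut_T, of g] assms by simp
  then show ?thesis using odd_germ_mult[of \<rho> "inv_T g" g x] assms by auto
qed

section \<open>Words and substitutions\<close>

lemma eval_word_Nil [simp]: "eval_word \<omega> [] = id"
  by (simp add: eval_word_def)

lemma eval_word_Cons: "eval_word \<omega> (x # w) = gen_a \<cdot> gen \<omega> x \<cdot> eval_word \<omega> w"
  by (simp add: eval_word_def)

lemma eval_word_append: "eval_word \<omega> (v @ w) = eval_word \<omega> v \<cdot> eval_word \<omega> w"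
  by (induction v) (simp_all add: eval_word_Cons mult_T_assoc)

lemma eval_word_in_G [simp]: "eval_word \<omega> w \<in> Grig \<omega>"
  by (induction w) (simp_all add: eval_word_Cons)

lemma eval_word_Aut [simp]: "eval_word \<omega> w \<in> carrier Aut_T"
  using eval_word_in_G by (rule Grig_Aut)

lemma eval_word_replicate: "eval_word \<omega> (replicate n x) = (gen \<omega> x \<circ> gen_a) ^^ n"
proof (induction n)
  case (Suc n)
  then show ?case
    by (simp only: replicate_Suc eval_word_Cons mult_T_comp funpow_Suc_right)
qed simp

lemma conj_gen_a_funpow: "(gen_a \<circ> f \<circ> gen_a) ^^ n = gen_a \<circ> f ^^ n \<circ> gen_a"
  by (induction n) (auto simp: fun_eq_iff)

lemma funpow_Cons:
  "(\<And>i w. F (i # w) = i # H i w) \<Longrightarrow> (F ^^ m) (i # w) = i # (H i ^^ m) w"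
  by (induction m) auto

text \<open>The product $ax$ has finite order as soon as some letter of $\omega$ kills $x$: its square has sections
  conjugate to $ax$ one level down, until the letter that kills $x$ makes the order $4$.\<close>

lemma ax_torsion:
  assumes "\<not> moves (\<omega> n) x"
  shows "\<exists>N>0. (gen \<omega> x \<circ> gen_a) ^^ N = id"
  using assms
proof (induction n arbitrary: \<omega>)
  case 0
  have "((gen \<omega> x \<circ> gen_a) ^^ 4) w = w" for w
  proof (cases w)
    case (Cons i u)
    then show ?thesis using 0 by (cases i) (simp_all add: eval_nat_numeral letter_hom_moves)
  qed (simp add: eval_nat_numeral)
  then have "(gen \<omega> x \<circ> gen_a) ^^ 4 = id" by (metis ext id_apply)
  then show ?case by (metis zero_less_numeral)
next
  case (Suc n)
  show ?case
  proof (cases "moves (\<omega> 0) x")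
    case True
    let ?f = "gen (shift 1 \<omega>) x \<circ> gen_a" and ?g = "gen \<omega> x \<circ> gen_a"
    from Suc obtain N where N: "N > 0" "?f ^^ N = id"
      by (metis One_nat_def plus_1_eq_Suc shift_apply)
    define H where "H i = (if i then ?f else gen_a \<circ> ?f \<circ> gen_a)" for i
    have "(?g ^^ 2) (i # w) = i # H i w" for i w
      using True by (cases i) (simp_all add: eval_nat_numeral letter_hom_moves H_def)
    then have "((?g ^^ 2) ^^ N) (i # w) = i # (H i ^^ N) w" for i w
      by (rule funpow_Cons)
    moreover have "(H i ^^ N) w = w" for i w
    proof (cases i)
      case True
      then show ?thesis using N(2) by (simp add: H_def)
    next
      case False
      then have "H i ^^ N = gen_a \<circ> ?f ^^ N \<circ> gen_a"
        by (simp only: H_def if_False conj_gen_a_funpow)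
      then have "(H i ^^ N) w = gen_a ((?f ^^ N) (gen_a w))" by simp
      then show ?thesis unfolding N(2) by simp
    qed
    ultimately have "((?g ^^ 2) ^^ N) (i # w) = i # w" for i w
      by simp
    moreover have "((?g ^^ 2) ^^ N) [] = []"
      by (induction N) (auto simp: eval_nat_numeral)
    ultimately have "((?g ^^ 2) ^^ N) w = w" for w by (cases w) blast+
    then have "(?g ^^ 2) ^^ N = id" by (intro ext) (simp only: id_apply)
    then have "?g ^^ (2 * N) = id" by (simp only: funpow_mult)
    moreover have "0 < 2 * N" using N(1) by simp
    ultimately show ?thesis by (intro exI[of _ "2 * N"] conjI)
  next
    case False
    have "((gen \<omega> x \<circ> gen_a) ^^ 4) w = w" for w
    proof (cases w)
      case (Cons i u)
      then show ?thesis using False by (cases i) (simp_all add: eval_nat_numeral letter_hom_moves)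
    qed (simp add: eval_nat_numeral)
    then have "(gen \<omega> x \<circ> gen_a) ^^ 4 = id" by (metis ext id_apply)
    then show ?thesis by (metis zero_less_numeral)
  qed
qed

text \<open>As $ac$ has finite order, its inverse $ca$ is a positive word. Hence so are $d=(ca)(ab)$, then $a=(ad)d$, and
  finally all generators.\<close>

lemma represented_all:
  assumes r: "rich \<omega>" and "g \<in> Grig \<omega>"
  shows "represented \<omega> g"
  using assms(2)
proof (induction rule: Grig_induct)
  have mult: "represented \<omega> (g \<cdot> h)" if "represented \<omega> g" "represented \<omega> h" for g h
    using that unfolding represented_def by (metis eval_word_append)
  have ax: "represented \<omega> (gen_a \<cdot> gen \<omega> x)" for x
    unfolding represented_def by (rule exI[of _ "[x]"]) (simp add: eval_word_Cons)
  have ca: "represented \<omega> (gen \<omega> Kc \<cdot> gen_a)"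
  proof -
    obtain n where "\<not> moves (\<omega> n) Kc" using r by (metis moves.simps(2) rich_def)
    then obtain N where N: "N > 0" "(gen \<omega> Kc \<circ> gen_a) ^^ N = id" using ax_torsion by blast
    have "(gen \<omega> Kc \<circ> gen_a) ^^ (N - 1) = gen_a \<circ> gen \<omega> Kc"
    proof
      fix w
      have "((gen \<omega> Kc \<circ> gen_a) ^^ Suc (N - 1)) (gen_a (gen \<omega> Kc w)) = gen_a (gen \<omega> Kc w)"
        using N by simp
      then show "((gen \<omega> Kc \<circ> gen_a) ^^ (N - 1)) w = (gen_a \<circ> gen \<omega> Kc) w"
        unfolding funpow_Suc_right by simp
    qed
    then show ?thesis
      unfolding represented_def mult_T_comp by (metis eval_word_replicate)
  qed
  have "gen \<omega> Kc \<cdot> gen_a \<cdot> (gen_a \<cdot> gen \<omega> Kb) = gen \<omega> Kd"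
    by (auto simp: mult_T_apply gen_mult_klein)
  then have d: "represented \<omega> (gen \<omega> Kd)" using mult[OF ca ax[of Kb]] by simp
  have "gen_a \<cdot> gen \<omega> Kd \<cdot> gen \<omega> Kd = gen_a"
    by (auto simp: mult_T_apply)
  then show a: "represented \<omega> gen_a" using mult[OF ax[of Kd] d] by simp
  have "gen_a \<cdot> (gen_a \<cdot> gen \<omega> x) = gen \<omega> x" for x
    by (auto simp: mult_T_apply)
  then show "represented \<omega> (gen \<omega> x)" for x using mult[OF a ax[of x]] by simp
  show "represented \<omega> id"
    unfolding represented_def by (rule exI[of _ "[]"]) simp
  show "represented \<omega> (g \<cdot> h)" if "represented \<omega> g" "represented \<omega> h" for g h
    by (rule mult[OF that])
qed

fun special :: "letter \<Rightarrow> klein" where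
  "special L0 = Kd" | "special L1 = Kc" | "special L2 = Kb"

text \<open>Up to conjugation by $(a,id)$, the substitution duplicates $g$ on the two subtrees and swaps
  these subtrees once for each special letter.\<close>

lemma eval_subst_word:
  "eval_word \<omega> (subst_word (\<omega> 0) w) =
    (let g = eval_word (shift 1 \<omega>) w in
     if even (count_list w (special (\<omega> 0))) then wreath (gen_a \<circ> g \<circ> gen_a) g id
     else wreath (g \<circ> gen_a) (gen_a \<circ> g) Not)"
proof (induction w)
  case Nil
  have "wreath (gen_a \<circ> id \<circ> gen_a) id id u = u" for u
    by (cases u) auto
  then have "wreath (gen_a \<circ> id \<circ> gen_a) id id = id" by (metis ext id_apply)
  then show ?case by (simp only: subst_word_def Let_def list.map concat.simps eval_word_Nil count_list.simps even_zero if_True)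
next
  case (Cons x w)
  have IH: "eval_word \<omega> (subst_word (\<omega> 0) (x # w)) u =
     (let g = eval_word (shift 1 \<omega>) w in
     if even (count_list w (special (\<omega> 0))) then wreath (gen_a \<circ> g \<circ> gen_a) g id
     else wreath (g \<circ> gen_a) (gen_a \<circ> g) Not) (eval_word \<omega> (subst_letter (\<omega> 0) x) u)" for u
    using Cons by (simp add: subst_word_def eval_word_append mult_T_apply)
  show ?case
  proof
    fix u
    show "eval_word \<omega> (subst_word (\<omega> 0) (x # w)) u =
      (let g = eval_word (shift 1 \<omega>) (x # w) in
     if even (count_list (x # w) (special (\<omega> 0))) then wreath (gen_a \<circ> g \<circ> gen_a) g id
     else wreath (g \<circ> gen_a) (gen_a \<circ> g) Not) u"
    proof (cases u)
      case Nil
      then show ?thesis unfolding IH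
        by (cases "\<omega> 0"; cases x) (simp_all add: Let_def eval_word_Cons mult_T_apply)
    next
      case (Cons i v)
      then show ?thesis unfolding IH
        by (cases "\<omega> 0"; cases x; cases i)
          (simp_all add: Let_def eval_word_Cons mult_T_apply gen_mult_klein)
    qed
  qed
qed

lemma level_sign_eval_word_0: "level_sign 0 (eval_word \<omega> w) = (- 1) ^ length w"
  by (induction w) (auto simp: eval_word_Cons level_sign_mult level_sign_gen_a level_sign_gen_0)

lemma length_count_klein: "length w = count_list w Kb + count_list w Kc + count_list w Kd"
proof (induction w)
  case (Cons x w)
  then show ?case by (cases x) auto
qed simp

lemma level_sign_eval_word_L1:
  "\<omega> n = L1 \<Longrightarrow> level_sign (Suc n) (eval_word \<omega> w) = (- 1) ^ (count_list w Kb + count_list w Kd)"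
proof (induction w)
  case (Cons x w)
  then show ?case by (cases x) (auto simp: eval_word_Cons level_sign_mult level_sign_gen_a level_sign_gen_Suc)
qed simp

lemma level_sign_eval_word_L2:
  "\<omega> n = L2 \<Longrightarrow> level_sign (Suc n) (eval_word \<omega> w) = (- 1) ^ (count_list w Kc + count_list w Kd)"
proof (induction w)
  case (Cons x w)
  then show ?case by (cases x) (auto simp: eval_word_Cons level_sign_mult level_sign_gen_a level_sign_gen_Suc)
qed simp

text \<open>Three signs determine the three parities of letter counts: the sign of the root, and the signs of one level
  below a letter $\mathbf 1$ and of one below a letter $\mathbf 2$.\<close>

lemma count_parity_unique:
  assumes r: "rich \<omega>" and eq: "\<And>n. level_sign n (eval_word \<omega> v) = level_sign n (eval_word \<omega> w)"
  shows "even (count_list v k) = even (count_list w k)"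
proof -
  have factor_if: "((- 1 :: int) ^ m = (- 1) ^ n) = (even m = even n)" for m n
    by (auto simp: minus_one_power_iff)
  obtain m n where "\<omega> m = L1" "\<omega> n = L2" using r by (auto simp: rich_def)
  then have "even (count_list v Kb + count_list v Kd) = even (count_list w Kb + count_list w Kd)"
    "even (count_list v Kc + count_list v Kd) = even (count_list w Kc + count_list w Kd)"
    using eq[of "Suc m"] eq[of "Suc n"] by (simp_all only: level_sign_eval_word_L1 level_sign_eval_word_L2 factor_if)
  moreover have "even (length v) = even (length w)"
    using eq[of 0] by (simp only: level_sign_eval_word_0 factor_if)
  ultimately show ?thesis
    by (cases k) (auto simp: length_count_klein)
qed

text \<open>Each substitution doubles two letters and maps the special one to a word that contains all three letters once.\<close>

lemma count_subst_even:
  "even (count_list w (special l)) \<Longrightarrow> even (count_list (subst_word l w) k)"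
proof -
  have "even (count_list (subst_word l w) k) = even (count_list w (special l))"
  proof (induction w)
    case (Cons x w)
    then show ?case by (cases l; cases x; cases k) (auto simp: subst_word_def)
  qed (simp add: subst_word_def)
  then show "even (count_list w (special l)) \<Longrightarrow> even (count_list (subst_word l w) k)" by simp
qed

text \<open>\<open>zeta\<close> chooses an arbitrary representing word. The level signs show that its parity of special letters is
  that of any word \<open>v\<close> with the same level signs as $g$, so the value is known without knowing the word.\<close>

lemma zeta_even:
  assumes r: "rich \<rho>" and g: "g \<in> Grig (shift 1 \<rho>)"
    and al: "\<And>n. level_sign n g = level_sign n (eval_word (shift 1 \<rho>) v)"
    and ev: "even (count_list v (special (\<rho> 0)))"
  shows "zeta \<rho> g = wreath (gen_a \<circ> g \<circ> gen_a) g id"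
    and "\<exists>w. zeta \<rho> g = eval_word \<rho> w \<and> (\<forall>k. even (count_list w k))"
proof -
  have rep: "represented (shift 1 \<rho>) g" by (rule represented_all[OF rich_shift[OF r] g])
  define w where "w = (SOME w. eval_word (shift 1 \<rho>) w = g)"
  have w: "eval_word (shift 1 \<rho>) w = g"
    using rep unfolding represented_def w_def by (rule someI_ex)
  have ew: "even (count_list w (special (\<rho> 0)))"
    using count_parity_unique[OF rich_shift[OF r], of 1 w v] al ev w by simp
  have z: "zeta \<rho> g = eval_word \<rho> (subst_word (\<rho> 0) w)"
    using rep by (simp add: zeta_def zeta_word_def w_def)
  then show "zeta \<rho> g = wreath (gen_a \<circ> g \<circ> gen_a) g id"
    using ew w by (simp add: eval_subst_word Let_def)
  show "\<exists>w. zeta \<rho> g = eval_word \<rho> w \<and> (\<forall>k. even (count_list w k))"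
    using z count_subst_even[OF ew] by blast
qed

text \<open>In each step of the iterated substitution the left subtree carries a conjugation by $a$, which exchanges the
  roles of the subtrees in the next step. The conjugations accumulate to the parity of the number of zeros.\<close>

definition twist :: "vertex \<Rightarrow> tree_map" where
  "twist u = (if odd (count_list u False) then gen_a else id)"

lemma twist_twist [simp]: "twist u (twist u w) = w"
  by (simp add: twist_def)

lemma twist_Aut [simp]: "twist u \<in> carrier Aut_T" and Grig_twist [simp]: "twist u \<in> Grig \<rho>"
  by (auto simp: twist_def)

lemma inv_twist [simp]: "inv_T (twist u) = twist u"
  by (rule inv_T_involution) auto

text \<open>With all parities even the substitutions never swap subtrees, so \<open>zeta_iter \<omega> j g\<close> fixes level
  $j$, and its section at $u$ is $g$, conjugated by $a$ if $u$ has an odd number of zeros.\<close>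

lemma zeta_iter_sections:
  assumes r: "rich \<omega>" and "g \<in> Grig (shift j \<omega>)"
    and "j > 0 \<Longrightarrow> \<exists>v. (\<forall>n. level_sign n g = level_sign n (eval_word (shift j \<omega>) v)) \<and>
           even (count_list v (special (\<omega> (j - 1))))"
  shows "zeta_iter \<omega> j g \<in> Grig \<omega> \<and>
    (\<forall>u w. length u = j \<longrightarrow> zeta_iter \<omega> j g (u @ w) = u @ twist u (g (twist u w)))"
  using assms(2,3)
proof (induction j arbitrary: g)
  case 0
  then show ?case by (simp add: twist_def)
next
  case (Suc j)
  obtain v where v: "\<And>n. level_sign n g = level_sign n (eval_word (shift (Suc j) \<omega>) v)"
    "even (count_list v (special (\<omega> j)))"
    using Suc.prems by auto
  let ?\<rho> = "shift j \<omega>" and ?h = "zeta (shift j \<omega>) g"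
  have ze: "?h = wreath (gen_a \<circ> g \<circ> gen_a) g id" "\<exists>w. ?h = eval_word ?\<rho> w \<and> (\<forall>k. even (count_list w k))"
    using zeta_even[OF rich_shift[OF r], of g j v] Suc.prems(1) v by (simp_all add: shift_apply)
  from ze(2) have hG: "?h \<in> Grig ?\<rho>" by (metis eval_word_in_G)
  have IH: "zeta_iter \<omega> j ?h \<in> Grig \<omega> \<and>
    (\<forall>u w. length u = j \<longrightarrow> zeta_iter \<omega> j ?h (u @ w) = u @ twist u (?h (twist u w)))"
    by (rule Suc.IH[OF hG]) (use ze(2) in \<open>metis\<close>)
  show ?case
  proof (intro conjI allI impI)
    show "zeta_iter \<omega> (Suc j) g \<in> Grig \<omega>" using IH by simp
    fix u w :: vertex assume "length u = Suc j"
    then obtain u' i where u: "u = u' @ [i]" "length u' = j"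
      by (metis length_Suc_conv_rev)
    have "zeta_iter \<omega> (Suc j) g (u @ w) = u' @ twist u' (?h (twist u' (i # w)))"
      using IH u by simp
    also have "\<dots> = u @ twist u (g (twist u w))"
      unfolding ze(1) using u by (cases i) (auto simp: twist_def)
    finally show "zeta_iter \<omega> (Suc j) g (u @ w) = u @ twist u (g (twist u w))" .
  qed
qed

section \<open>Elements supported on one subtree\<close>

text \<open>Elements of the normal closure of $x_\omega$; the truth value is the parity of the number of conjugates in the
  product.\<close>

inductive conj_product :: "(nat \<Rightarrow> letter) \<Rightarrow> klein \<Rightarrow> tree_map \<Rightarrow> bool \<Rightarrow> bool" for \<omega> k where
  one: "conj_product \<omega> k id False"
| step: "conj_product \<omega> k y e \<Longrightarrow> g \<in> Grig \<omega> \<Longrightarrow> conj_product \<omega> k (y \<cdot> (inv_T g \<cdot> gen \<omega> k \<cdot> g)) (\<not> e)"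

lemma conj_product_in_G: "conj_product \<omega> k y e \<Longrightarrow> y \<in> Grig \<omega>"
  by (induction rule: conj_product.induct) auto

lemma conj_product_Aut: "conj_product \<omega> k y e \<Longrightarrow> y \<in> carrier Aut_T"
  using conj_product_in_G Grig_Aut by blast

lemma conj_product_gen_conj: "g \<in> Grig \<omega> \<Longrightarrow> conj_product \<omega> k (inv_T g \<cdot> gen \<omega> k \<cdot> g) True"
  using conj_product.step[OF conj_product.one] by fastforce

lemma inv_T_id [simp]: "inv_T id = id" "inv_T (\<lambda>w. w) = (\<lambda>w. w)"
  by (rule inv_T_involution; simp)+

lemma conj_product_gen: "conj_product \<omega> k (gen \<omega> k) True"
  using conj_product_gen_conj[of id \<omega> k] by simp

lemma conj_product_mult:
  assumes "conj_product \<omega> k y e" "conj_product \<omega> k z f"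
  shows "conj_product \<omega> k (y \<cdot> z) (e \<noteq> f)"
  using assms(2)
proof (induction rule: conj_product.induct)
  case one
  then show ?case using assms(1) by simp
next
  case (step z f g)
  have "conj_product \<omega> k (y \<cdot> z \<cdot> (inv_T g \<cdot> gen \<omega> k \<cdot> g)) (\<not> (e \<noteq> f))"
    using step by (intro conj_product.step) auto
  then show ?case by (simp add: mult_T_assoc)
qed

lemma conj_product_conj:
  assumes "conj_product \<omega> k y e" "g \<in> Grig \<omega>"
  shows "conj_product \<omega> k (inv_T g \<cdot> y \<cdot> g) e"
  using assms(1)
proof (induction rule: conj_product.induct)
  case one
  have "inv_T g \<cdot> id \<cdot> g = id" using assms(2) by (auto simp: mult_T_apply)
  then show ?case using conj_product.one[of \<omega> k] by (simp only:)
next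
  case (step y e h)
  have "inv_T g \<cdot> y \<cdot> g \<cdot> (inv_T (h \<cdot> g) \<cdot> gen \<omega> k \<cdot> (h \<cdot> g)) = inv_T g \<cdot> (y \<cdot> (inv_T h \<cdot> gen \<omega> k \<cdot> h)) \<cdot> g"
    using step.hyps(2) assms(2) by (auto simp: mult_T_apply inv_T_mult)
  then show ?case using conj_product.step[OF step.IH, of "h \<cdot> g"] step.hyps(2) assms(2) by simp
qed

lemma conj_product_inv:
  assumes "conj_product \<omega> k y e"
  shows "conj_product \<omega> k (inv_T y) e"
  using assms
proof (induction rule: conj_product.induct)
  case one
  show ?case using conj_product.one[of \<omega> k] by (simp only: inv_T_id)
next
  case (step y e g)
  have y: "y \<in> carrier Aut_T" using step.hyps(1) by (rule conj_product_Aut)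
  have "inv_T (y \<cdot> (inv_T g \<cdot> gen \<omega> k \<cdot> g)) = inv_T g \<cdot> gen \<omega> k \<cdot> g \<cdot> inv_T y"
    using step.hyps(2) y by (auto simp: mult_T_apply inv_T_mult)
  then show ?case using conj_product_mult[OF conj_product_gen_conj[OF step.hyps(2), of k] step.IH] by simp
qed

text \<open>Signs cannot distinguish conjugates, so a product of conjugates of $x$ has the sign of a power of $x$.\<close>

lemma conj_product_level_sign: "conj_product \<omega> k y e \<Longrightarrow> level_sign n y = (if e then level_sign n (gen \<omega> k) else 1)"
proof (induction rule: conj_product.induct)
  case (step y e g)
  have a: "y \<in> carrier Aut_T" "g \<in> carrier Aut_T" using step.hyps by (auto intro: conj_product_Aut)
  have "level_sign n (y \<cdot> (inv_T g \<cdot> gen \<omega> k \<cdot> g)) = level_sign n y * level_sign n (gen \<omega> k) * (level_sign n g * level_sign n g)"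
    using a by (simp add: level_sign_mult level_sign_inv mult_ac)
  then show ?case using step.IH by (auto simp: level_sign_sq)
qed simp

text \<open>Elements that are trivial in each of the quotients by the normal closures of $b$, $c$, $d$. The point of this
  definition is that the property is inherited when the element is moved to a subtree (\<open>iota_core\<close>).\<close>

definition core :: "(nat \<Rightarrow> letter) \<Rightarrow> tree_map set" where
  "core \<omega> = {y. \<forall>k. \<exists>e. conj_product \<omega> k y e}"

lemma core_in_G: "y \<in> core \<omega> \<Longrightarrow> y \<in> Grig \<omega>"
  unfolding core_def using conj_product_in_G by blast

lemma core_conj: "y \<in> core \<omega> \<Longrightarrow> g \<in> Grig \<omega> \<Longrightarrow> inv_T g \<cdot> y \<cdot> g \<in> core \<omega>"
  unfolding core_def using conj_product_conj by blast

lemma moves_special: "moves l x \<longleftrightarrow> x \<noteq> special l"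
  by (cases l) auto

lemma wreath_mult: "wreath g0 g1 id \<cdot> wreath h0 h1 id = wreath (g0 \<cdot> h0) (g1 \<cdot> h1) id"
proof
  fix w show "(wreath g0 g1 id \<cdot> wreath h0 h1 id) w = wreath (g0 \<cdot> h0) (g1 \<cdot> h1) id w"
    by (cases w) (auto simp: mult_T_apply)
qed

lemma klein_third:
  assumes "x \<noteq> z" "k \<noteq> x" "k \<noteq> z"
  shows "gen \<omega> k = gen \<omega> z \<cdot> gen \<omega> x"
  using assms by (cases x; cases z; cases k) (auto simp: mult_T_apply gen_mult_klein)

definition factor_if :: "bool \<Rightarrow> tree_map \<Rightarrow> tree_map" where
  "factor_if e x = (if e then x else id)"

lemma factor_if_simps [simp]: "factor_if True x = x" "factor_if False x = id"
  by (auto simp: factor_if_def)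

text \<open>Every section $g$ at the right subtree lifts to an element that is trivial modulo the normal closure
  of $z$, up to the generator $x$ that acts on the right subtree only: lift $a$ to $aza$.\<close>

lemma lift_right:
  assumes x: "x = special (\<omega> 0)" and z: "z \<noteq> x" and "g \<in> Grig (shift 1 \<omega>)"
  shows "\<exists>g0 n e f. conj_product \<omega> z n e \<and> wreath g0 g id = n \<cdot> factor_if f (gen \<omega> x)"
  using assms(3)
proof (induction rule: Grig_induct)
  case id
  have "wreath id id id w = w" for w by (cases w) auto
  then have "wreath id id id = id \<cdot> factor_if False (gen \<omega> x)" by auto
  then show ?case using conj_product.one[of \<omega> z] by metis
next
  case a
  have "wreath (gen (shift 1 \<omega>) z) gen_a id w = (inv_T gen_a \<cdot> gen \<omega> z \<cdot> gen_a) w" for w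
  proof (cases w)
    case (Cons i u)
    then show ?thesis
      using z x by (cases i) (auto simp: mult_T_apply letter_hom_moves moves_special)
  qed (simp add: mult_T_apply)
  then have "wreath (gen (shift 1 \<omega>) z) gen_a id = inv_T gen_a \<cdot> gen \<omega> z \<cdot> gen_a \<cdot> factor_if False (gen \<omega> x)"
    by auto
  then show ?case using conj_product_gen_conj[OF Grig_gen_a, of \<omega> z] by metis
next
  case (gen k)
  have w: "wreath (letter_hom (\<omega> 0) k) (gen (shift 1 \<omega>) k) id = gen \<omega> k"
    by (rule gen_wreath[symmetric])
  consider "k = x" | "k = z" | "k \<noteq> x" "k \<noteq> z" by blast
  then show ?case
  proof cases
    case 1
    then have "wreath (letter_hom (\<omega> 0) k) (gen (shift 1 \<omega>) k) id = id \<cdot> factor_if True (gen \<omega> x)"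
      using w by (simp only: factor_if_simps mult_T_id)
    then show ?thesis using conj_product.one[of \<omega> z] by metis
  next
    case 2
    then have "wreath (letter_hom (\<omega> 0) k) (gen (shift 1 \<omega>) k) id = gen \<omega> z \<cdot> factor_if False (gen \<omega> x)"
      using w by (simp only: factor_if_simps mult_T_id)
    then show ?thesis using conj_product_gen[of \<omega> z] by metis
  next
    case 3
    then have "wreath (letter_hom (\<omega> 0) k) (gen (shift 1 \<omega>) k) id = gen \<omega> z \<cdot> factor_if True (gen \<omega> x)"
      using klein_third[of x z k \<omega>] z by (simp only: w factor_if_simps) simp
    then show ?thesis using conj_product_gen[of \<omega> z] by metis
  qed
next
  case (mult g h)
  obtain g0 n e f where g: "conj_product \<omega> z n e" "wreath g0 g id = n \<cdot> factor_if f (gen \<omega> x)" using mult by blast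
  obtain h0 m e' f' where h: "conj_product \<omega> z m e'" "wreath h0 h id = m \<cdot> factor_if f' (gen \<omega> x)" using mult by blast
  have "conj_product \<omega> z (inv_T (factor_if f (gen \<omega> x)) \<cdot> m \<cdot> factor_if f (gen \<omega> x)) e'"
    using h(1) by (rule conj_product_conj) (simp add: factor_if_def)
  from conj_product_mult[OF g(1) this]
  have "conj_product \<omega> z (n \<cdot> (inv_T (factor_if f (gen \<omega> x)) \<cdot> m \<cdot> factor_if f (gen \<omega> x))) (e \<noteq> e')" .
  moreover have "wreath (g0 \<cdot> h0) (g \<cdot> h) id
      = n \<cdot> (inv_T (factor_if f (gen \<omega> x)) \<cdot> m \<cdot> factor_if f (gen \<omega> x)) \<cdot> factor_if (f \<noteq> f') (gen \<omega> x)"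
    unfolding wreath_mult[symmetric] g(2) h(2)
    by (cases f; cases f') (auto simp: mult_T_apply)
  ultimately show ?case by blast
qed

lemma conj_wreath_special:
  assumes w: "wreath g0 g id \<in> carrier Aut_T" and g: "g \<in> carrier Aut_T"
    and x: "x = special (\<omega> 0)"
  shows "inv_T (wreath g0 g id) \<cdot> gen \<omega> x \<cdot> wreath g0 g id
    = wreath id (inv_T g \<cdot> gen (shift 1 \<omega>) x \<cdot> g) id"
proof
  fix w'
  obtain v where v: "w' = wreath g0 g id v" using w by (metis inv_T_apply(2))
  have l: "(inv_T (wreath g0 g id) \<cdot> gen \<omega> x \<cdot> wreath g0 g id) w' = wreath g0 g id (gen \<omega> x v)"
    using w by (simp add: v mult_T_apply)
  show "(inv_T (wreath g0 g id) \<cdot> gen \<omega> x \<cdot> wreath g0 g id) w'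
     = wreath id (inv_T g \<cdot> gen (shift 1 \<omega>) x \<cdot> g) id w'"
  proof (cases v)
    case Nil
    then show ?thesis unfolding l using v by simp
  next
    case (Cons i u)
    then show ?thesis unfolding l using v x g
      by (cases i) (auto simp: mult_T_apply letter_hom_moves moves_special)
  qed
qed

text \<open>Write $y$ as a product of conjugates of the section of $x$ and lift each conjugating element by
  \<open>lift_right\<close>. Modulo the normal closure of $z$ each lifted conjugate becomes $x$, so that only the parity of
  their number remains.\<close>

lemma wreath_right_mod_other:
  assumes x: "x = special (\<omega> 0)" and z: "z \<noteq> x" and "conj_product (shift 1 \<omega>) x y e"
  shows "\<exists>n f. conj_product \<omega> z n f \<and> wreath id y id = n \<cdot> factor_if e (gen \<omega> x)"
  using assms(3)
proof (induction rule: conj_product.induct)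
  case one
  have "wreath id id id w = w" for w by (cases w) auto
  then have "wreath id id id = id \<cdot> factor_if False (gen \<omega> x)" by auto
  then show ?case using conj_product.one[of \<omega> z] by blast
next
  case (step y e g)
  let ?x = "gen \<omega> x"
  obtain n f where n: "conj_product \<omega> z n f" "wreath id y id = n \<cdot> factor_if e ?x" using step.IH by blast
  obtain g0 m e' f' where m: "conj_product \<omega> z m e'" "wreath g0 g id = m \<cdot> factor_if f' ?x"
    using lift_right[OF x z step.hyps(2)] by blast
  have mA: "m \<in> carrier Aut_T" "n \<in> carrier Aut_T" using m(1) n(1) by (auto intro: conj_product_Aut)
  define l where "l = inv_T (factor_if f' ?x) \<cdot> (inv_T m \<cdot> (inv_T ?x \<cdot> m \<cdot> ?x)) \<cdot> factor_if f' ?x"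
  have l: "conj_product \<omega> z l (e' \<noteq> e')"
    unfolding l_def by (intro conj_product_conj conj_product_mult conj_product_inv m(1)) (auto simp: factor_if_def)
  have lA: "l \<in> carrier Aut_T" using l by (rule conj_product_Aut)
  have "wreath id (y \<cdot> (inv_T g \<cdot> gen (shift 1 \<omega>) x \<cdot> g)) id
      = wreath id y id \<cdot> wreath id (inv_T g \<cdot> gen (shift 1 \<omega>) x \<cdot> g) id"
    by (simp add: wreath_mult)
  also have "wreath id (inv_T g \<cdot> gen (shift 1 \<omega>) x \<cdot> g) id
      = inv_T (wreath g0 g id) \<cdot> ?x \<cdot> wreath g0 g id"
    by (rule conj_wreath_special[where \<omega> = \<omega>, OF _ _ x, symmetric]) (use m(2) mA step.hyps(2) in \<open>auto simp: factor_if_def\<close>)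
  also have "\<dots> = l \<cdot> ?x"
    unfolding m(2) l_def using mA by (cases f') (auto simp: mult_T_apply inv_T_mult)
  also have "wreath id y id \<cdot> (l \<cdot> ?x) = n \<cdot> (inv_T (factor_if e ?x) \<cdot> l \<cdot> factor_if e ?x) \<cdot> factor_if (\<not> e) ?x"
    unfolding n(2) by (cases e) (auto simp: mult_T_apply)
  finally have "wreath id (y \<cdot> (inv_T g \<cdot> gen (shift 1 \<omega>) x \<cdot> g)) id = \<dots>" .
  moreover have "conj_product \<omega> z (n \<cdot> (inv_T (factor_if e ?x) \<cdot> l \<cdot> factor_if e ?x)) (f \<noteq> (e' \<noteq> e'))"
    by (intro conj_product_conj conj_product_mult n(1) l) (auto simp: factor_if_def)
  ultimately show ?case by blast
qed

lemma wreath_right_special: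
  assumes x: "x = special (\<omega> 0)" and "conj_product (shift 1 \<omega>) x y e"
  shows "conj_product \<omega> x (wreath id y id) e"
  using assms(2)
proof (induction rule: conj_product.induct)
  case one
  have "wreath id id id w = w" for w by (cases w) auto
  then have "wreath id id id = id" by auto
  then show ?case using conj_product.one[of \<omega> x] by (simp only:)
next
  case (step y e g)
  obtain z where z: "z \<noteq> x" by (metis klein.distinct(1))
  obtain g0 m e' f' where m: "conj_product \<omega> z m e'" "wreath g0 g id = m \<cdot> factor_if f' (gen \<omega> x)"
    using lift_right[OF x z step.hyps(2)] by blast
  then have G: "wreath g0 g id \<in> Grig \<omega>" by (auto simp: factor_if_def dest: conj_product_in_G)
  have "wreath id (inv_T g \<cdot> gen (shift 1 \<omega>) x \<cdot> g) id
      = inv_T (wreath g0 g id) \<cdot> gen \<omega> x \<cdot> wreath g0 g id"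
    by (rule conj_wreath_special[where \<omega> = \<omega>, OF _ _ x, symmetric]) (use G step.hyps(2) in auto)
  then have "wreath id (y \<cdot> (inv_T g \<cdot> gen (shift 1 \<omega>) x \<cdot> g)) id
      = wreath id y id \<cdot> (inv_T (wreath g0 g id) \<cdot> gen \<omega> x \<cdot> wreath g0 g id)"
    using wreath_mult[of id y id "inv_T g \<cdot> gen (shift 1 \<omega>) x \<cdot> g"] by (simp only: mult_T_id)
  then show ?case using conj_product.step[OF step.IH G] by (simp only:)
qed

text \<open>Let $x$ be the generator killed by $\omega_0$. For $z\ne x$ the parity left over by \<open>wreath_right_mod_other\<close>
  is even: choose a generator $q\ne x$ among $b,c$ and a level at which $q$ has sign $1$ and $x$ has sign $-1$. As $y$ is
  also a product of conjugates of $q$, its sign there is $1$.\<close>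

lemma core_wreath_right:
  assumes r: "rich \<omega>" and y: "y \<in> core (shift 1 \<omega>)"
  shows "wreath id y id \<in> core \<omega>"
  unfolding core_def
proof (intro CollectI allI)
  fix z
  define x where "x = special (\<omega> 0)"
  obtain e where e: "conj_product (shift 1 \<omega>) x y e" using y by (auto simp: core_def)
  show "\<exists>e. conj_product \<omega> z (wreath id y id) e"
  proof (cases "z = x")
    case True
    then show ?thesis using wreath_right_special[OF x_def e] by blast
  next
    case False
    define q where "q = (if x = Kb then Kc else Kb)"
    obtain m where m: "\<not> moves (shift 1 \<omega> m) q" "moves (shift 1 \<omega> m) x"
    proof (cases "x = Kb")
      case True
      obtain m where "shift 1 \<omega> m = L1" using rich_shift[OF r, of 1] unfolding rich_def by blast
      then show ?thesis using that[of m] True by (simp add: q_def)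
    next
      case False
      obtain m where "shift 1 \<omega> m = L2" using rich_shift[OF r, of 1] unfolding rich_def by blast
      then show ?thesis using that[of m] False by (simp add: q_def)
    qed
    obtain e' where e': "conj_product (shift 1 \<omega>) q y e'" using y by (auto simp: core_def)
    have "\<not> e"
      using conj_product_level_sign[OF e, of "Suc m"] conj_product_level_sign[OF e', of "Suc m"] m
      by (auto simp: level_sign_gen_Suc split: if_splits)
    then show ?thesis
      using wreath_right_mod_other[OF x_def False e] by auto
  qed
qed

lemma core_wreath_left:
  assumes r: "rich \<omega>" and y: "y \<in> core (shift 1 \<omega>)"
  shows "wreath y id id \<in> core \<omega>"
proof -
  have "inv_T gen_a \<cdot> wreath id y id \<cdot> gen_a = wreath y id id"
  proof
    fix w show "(inv_T gen_a \<cdot> wreath id y id \<cdot> gen_a) w = wreath y id id w"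
      by (cases w) (auto simp: mult_T_apply)
  qed
  then show ?thesis using core_conj[OF core_wreath_right[OF r y] Grig_gen_a] by simp
qed

lemma iota_Nil: "iota h [] = h"
  by (auto simp: iota_def)

lemma iota_Cons: "iota h (i # u) = (if i then wreath id (iota h u) id else wreath (iota h u) id id)"
proof
  fix w show "iota h (i # u) w = (if i then wreath id (iota h u) id else wreath (iota h u) id id) w"
    by (cases w) (auto simp: iota_def)
qed

lemma iota_append: "iota h (u @ v) = iota (iota h v) u"
  by (induction u) (auto simp: iota_Nil iota_Cons)

lemma iota_core:
  assumes "rich \<omega>" "y \<in> core (shift (length u) \<omega>)"
  shows "iota y u \<in> core \<omega>"
  using assms
proof (induction u arbitrary: \<omega>)
  case Nil
  then show ?case by (simp add: iota_Nil)
next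
  case (Cons i u)
  have "iota y u \<in> core (shift 1 \<omega>)"
    by (rule Cons.IH) (use Cons.prems in \<open>auto simp: rich_shift\<close>)
  then show ?case using core_wreath_left core_wreath_right Cons.prems by (auto simp: iota_Cons)
qed

text \<open>When $\omega_0 = \mathbf 2$, the element $[b,aca]$ is trivial modulo $b$ and modulo $c$, and modulo $d$ it
  becomes $[b,aba] = 1$, as $b$ and $aba$ act on different subtrees.\<close>

lemma core_base:
  assumes "\<omega> 0 = L2"
  shows "iota (comm_T (gen (shift 1 \<omega>) Kb) gen_a) [True] \<in> core \<omega>"
proof -
  let ?a = gen_a and ?b = "gen \<omega> Kb" and ?c = "gen \<omega> Kc" and ?d = "gen \<omega> Kd"
  define y where "y = iota (comm_T (gen (shift 1 \<omega>) Kb) gen_a) [True]"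
  have y: "y = wreath id (comm_T (gen (shift 1 \<omega>) Kb) gen_a) id"
    by (simp add: y_def iota_Cons iota_Nil)
  have yT: "y (True # w) = True # gen_a (gen (shift 1 \<omega>) Kb (gen_a (gen (shift 1 \<omega>) Kb w)))"
    and yF: "y (False # w) = False # w" and yN: "y [] = []" for w
    by (simp_all add: y comm_T_def mult_T_apply)
  have eqI: "f = y" if "f [] = []" "\<And>w. f (True # w) = y (True # w)" "\<And>w. f (False # w) = False # w" for f
  proof
    fix w show "f w = y w" using that yF yN by (cases w rule: list.exhaust[case_names Nil Cons])
        (auto, (metis (full_types))+)
  qed
  have 1: "?b \<cdot> (inv_T (?a \<cdot> ?c \<cdot> ?a) \<cdot> ?b \<cdot> (?a \<cdot> ?c \<cdot> ?a)) = y"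
    by (rule eqI) (simp_all add: yT inv_T_mult mult_T_apply letter_hom_moves assms)
  have 2: "inv_T (?a \<cdot> ?b) \<cdot> ?c \<cdot> (?a \<cdot> ?b) \<cdot> (inv_T ?a \<cdot> ?c \<cdot> ?a) = y"
    by (rule eqI) (simp_all add: yT inv_T_mult mult_T_apply letter_hom_moves assms)
  have 3: "inv_T (?a \<cdot> ?b \<cdot> ?a) \<cdot> (inv_T (?a \<cdot> ?b) \<cdot> ?d \<cdot> (?a \<cdot> ?b) \<cdot> (inv_T ?a \<cdot> ?d \<cdot> ?a)) \<cdot> (?a \<cdot> ?b \<cdot> ?a) = y"
    by (rule eqI) (simp_all add: yT inv_T_mult mult_T_apply letter_hom_moves assms gen_mult_klein)
  have "\<exists>e. conj_product \<omega> k y e" for k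
  proof (cases k)
    case Kb
    have "conj_product \<omega> Kb y (True \<noteq> True)"
      unfolding 1[symmetric] by (intro conj_product_mult conj_product_gen conj_product_gen_conj) simp
    then show ?thesis using Kb by blast
  next
    case Kc
    have "conj_product \<omega> Kc y (True \<noteq> True)"
      unfolding 2[symmetric] by (intro conj_product_mult conj_product_gen_conj) simp_all
    then show ?thesis using Kc by blast
  next
    case Kd
    have "conj_product \<omega> Kd y (True \<noteq> True)"
      unfolding 3[symmetric] by (intro conj_product_mult conj_product_gen_conj conj_product_conj) simp_all
    then show ?thesis using Kd by blast
  qed
  then show ?thesis unfolding y_def[symmetric] core_def by blast
qed

section \<open>The conjugated generators\<close>

definition drop_ray :: "nat \<Rightarrow> (nat \<Rightarrow> bool) \<Rightarrow> (nat \<Rightarrow> bool)" where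
  "drop_ray j x = (\<lambda>i. x (j + i))"

lemma pref_split: "j \<le> n \<Longrightarrow> pref x n = pref x j @ pref (drop_ray j x) (n - j)"
  by (rule nth_equalityI) (auto simp: nth_append nth_pref drop_ray_def)

lemma last_Aut_T_snoc: "g \<in> carrier Aut_T \<Longrightarrow> last (u @ g (w @ [i])) = last (g (w @ [i]))"
  by (simp add: Aut_T_snoc)

lemma activity_iota: "g \<in> carrier Aut_T \<Longrightarrow> activity (iota g u) (u @ w) = activity g w"
  by (simp add: activity_def iota_def last_Aut_T_snoc)

lemma activity_iota_outside:
  assumes "\<not> prefix u w" "length u \<le> length w"
  shows "activity (iota g u) w = False"
proof -
  have "\<not> prefix u (w @ [False])" using assms by (auto simp: prefix_snoc)
  then show ?thesis by (simp add: activity_def iota_def)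
qed

lemma has_germ_iota:
  assumes g: "g \<in> carrier Aut_T" and t: "\<And>x. has_germ (shift (length u) \<rho>) g x False"
  shows "has_germ \<rho> (iota g u) x False"
proof (cases "pref x (length u) = u")
  case True
  let ?l = "length u" and ?y = "drop_ray (length u) x"
  obtain N where N: "\<And>n. n \<ge> N \<Longrightarrow> \<not> activity g (pref ?y n) \<and>
      (shift ?l \<rho> n = L2 \<longrightarrow> activity g (pref ?y n @ [False]) = False)"
    using t[of ?y] by (auto simp: has_germ_def)
  show ?thesis unfolding has_germ_def
  proof (intro exI[of _ "N + ?l"] allI impI)
    fix n assume n: "N + ?l \<le> n"
    then have "pref x n = u @ pref ?y (n - ?l)" using pref_split[of ?l n x] True by simp
    then show "\<not> activity (iota g u) (pref x n) \<and> (\<rho> n = L2 \<longrightarrow> activity (iota g u) (pref x n @ [False]) = False)"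
      using N[of "n - ?l"] n by (auto simp: activity_iota[OF g] shift_apply)
  qed
next
  case False
  have "\<not> prefix u (pref x n @ w)" if "n \<ge> length u" for n w
  proof
    assume "prefix u (pref x n @ w)"
    then have "take (length u) (pref x n @ w) = u" unfolding prefix_def by (metis append_eq_conv_conj)
    then show False using False that by (simp add: take_pref)
  qed
  from this[of _ "[]"] this[of _ "[False]"] show ?thesis
    unfolding has_germ_def by (intro exI[of _ "length u"]) (auto simp: activity_iota_outside)
qed

lemma odd_germ_comm_b_a:
  "rich \<rho> \<Longrightarrow> odd_germ \<rho> (comm_T (gen \<rho> Kb) gen_a) x = False"
  by (simp add: comm_T_def odd_germ_mult odd_germ_gen)

text \<open>The letters of $v$ are numbered from $0$ here: a zero at position $i$ closes a marked triple of $\omega$ that starts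
  at $j+i-2$.\<close>

definition admissible :: "(nat \<Rightarrow> letter) \<Rightarrow> nat \<Rightarrow> vertex \<Rightarrow> bool" where
  "admissible \<omega> j v \<longleftrightarrow> (\<forall>i<length v. \<not> v ! i \<longrightarrow> 2 \<le> i \<and> marked \<omega> (j + i - 2))"

lemma markedD:
  assumes "marked \<omega> i"
  shows "\<omega> i = L2" "\<omega> (i + 1) \<noteq> L2" "\<omega> (i + 2) = L1"
  using assms by (auto simp: marked_def)

text \<open>Marked triples begin with $\mathbf 2$, end in $\mathbf 1$ and have no $\mathbf 2$ in the middle, so two of them cannot overlap.\<close>

lemma admissible_before:
  assumes a: "admissible \<omega> j v" and i: "i < length v" "\<not> v ! i"
  shows "v ! (i - 1)" "v ! (i - 2)"
proof -
  have 2: "2 \<le> i" and m: "marked \<omega> (j + i - 2)" using a i by (auto simp: admissible_def)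
  show "v ! (i - 1)"
  proof (rule ccontr)
    assume "\<not> v ! (i - 1)"
    then have "2 \<le> i - 1" "marked \<omega> (j + (i - 1) - 2)"
      using a i by (auto simp: admissible_def)
    have "j + (i - 1) - 2 + 1 = j + i - 2" using \<open>2 \<le> i - 1\<close> by simp
    with markedD(2)[OF \<open>marked \<omega> (j + (i - 1) - 2)\<close>] have "\<omega> (j + i - 2) \<noteq> L2" by metis
    then show False using markedD(1)[OF m] by simp
  qed
  show "v ! (i - 2)"
  proof (rule ccontr)
    assume "\<not> v ! (i - 2)"
    moreover have "i - 2 < length v" using i by simp
    ultimately have "2 \<le> i - 2 \<and> marked \<omega> (j + (i - 2) - 2)"
      using a unfolding admissible_def by blast
    then have "2 \<le> i - 2" "marked \<omega> (j + (i - 2) - 2)" by blast+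
    have "j + (i - 2) - 2 + 2 = j + i - 2" using \<open>2 \<le> i - 2\<close> by simp
    with markedD(3)[OF \<open>marked \<omega> (j + (i - 2) - 2)\<close>] have "\<omega> (j + i - 2) = L1" by (simp only:)
    then show False using markedD(1)[OF m] by simp
  qed
qed

definition pad :: "vertex \<Rightarrow> (nat \<Rightarrow> bool)" where
  "pad v = (\<lambda>i. i < length v \<longrightarrow> v ! i)"

lemma pad_Nil [simp]: "pad [] = ones"
  by (simp add: pad_def)

lemma pref_pad: "length v \<le> n \<Longrightarrow> pref (pad v) n = v @ replicate (n - length v) True"
  by (rule nth_equalityI) (auto simp: nth_pref pad_def nth_append)

lemma pad_inject: "length v = length w \<Longrightarrow> pad v = pad w \<longleftrightarrow> v = w"
  by (metis order_refl pref_pad append_same_eq)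

lemma gen_replicate_True: "gen \<omega> k (replicate n True) = replicate n True"
  by (induction n arbitrary: \<omega>) auto

lemma prod_T_snoc: "prod_T (gs @ [g]) = prod_T gs \<cdot> g"
  by (induction gs) (simp_all add: mult_T_assoc)

text \<open>One level above the vertex at which $h_i$ acts, the letter of $\omega$ is $\mathbf 2$. There \<open>core_base\<close> applies, and
  \<open>iota_core\<close> moves the element down to its vertex.\<close>

lemma h_elt_in_G:
  assumes r: "rich \<omega>" and a: "admissible \<omega> j v" and i: "i < length v"
  shows "h_elt \<omega> j v (Suc i) \<in> Grig (shift j \<omega>)"
proof (cases "v ! i")
  case True
  then show ?thesis by (simp add: h_elt_def)
next
  case False
  then have 2: "2 \<le> i" and m: "marked \<omega> (j + i - 2)" using a i by (auto simp: admissible_def)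
  have t: "take (i - 1) v = take (i - 2) v @ [True]"
  proof -
    obtain k where "i = Suc (Suc k)" using le_Suc_ex[OF 2] by auto
    then show ?thesis
      using admissible_before(2)[OF a i False] i by (simp add: take_Suc_conv_app_nth)
  qed
  let ?\<rho> = "shift j \<omega>"
  have "iota (comm_T (gen (shift (j + i - 1) \<omega>) Kb) gen_a) [True] \<in> core (shift (j + i - 2) \<omega>)"
  proof -
    have "j + i - 2 + 1 = j + i - 1" using 2 by simp
    then show ?thesis
      using core_base[of "shift (j + i - 2) \<omega>"] markedD(1)[OF m] by (simp add: shift_apply)
  qed
  moreover have "shift (length (take (i - 2) v)) ?\<rho> = shift (j + i - 2) \<omega>"
    using 2 i by simp
  ultimately have "iota (iota (comm_T (gen (shift (j + i - 1) \<omega>) Kb) gen_a) [True]) (take (i - 2) v) \<in> core ?\<rho>"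
    using iota_core[OF rich_shift[OF r]] by metis
  then show ?thesis
    using False core_in_G t by (simp add: h_elt_def iota_append)
qed

text \<open>The factors $a$ and $b$ of the commutator have trivial germs, in contrast to $c$ and $d$.\<close>

lemma odd_germ_h_elt:
  assumes r: "rich \<omega>" and a: "admissible \<omega> j v" and i: "i < length v"
  shows "odd_germ (shift j \<omega>) (h_elt \<omega> j v (Suc i)) x = False"
proof (cases "v ! i")
  case True
  then show ?thesis using rich_shift[OF r] by (simp add: h_elt_def)
next
  case False
  then have 2: "2 \<le> i" using a i by (auto simp: admissible_def)
  let ?g = "comm_T (gen (shift (j + i - 1) \<omega>) Kb) gen_a"
  have G: "?g \<in> Grig (shift (j + i - 1) \<omega>)" by (simp add: comm_T_def)
  have s: "shift (length (take (i - 1) v)) (shift j \<omega>) = shift (j + i - 1) \<omega>"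
    using 2 i by simp
  have "has_germ (shift j \<omega>) (iota ?g (take (i - 1) v)) x False"
  proof (rule has_germ_iota)
    show "?g \<in> carrier Aut_T" using G by (rule Grig_Aut)
    show "has_germ (shift (length (take (i - 1) v)) (shift j \<omega>)) ?g y False" for y
      unfolding s using has_germ_odd_germ_Grig[OF rich_shift[OF r] G, of y] odd_germ_comm_b_a[OF rich_shift[OF r]]
      by simp
  qed
  then show ?thesis
    using False has_germ_odd_germ[OF rich_shift[OF r]] by (simp add: h_elt_def)
qed

text \<open>Each factor $h_i$ with $v_i = 0$ replaces the $i$-th letter of the ray by $0$.\<close>

lemma act_h_elt:
  assumes r: "rich \<omega>" and a: "admissible \<omega> j v" and i: "i < length v"
  shows "act (pad (take i v)) (h_elt \<omega> j v (Suc i)) = pad (take (Suc i) v)"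
proof (cases "v ! i")
  case True
  have "pad (take (Suc i) v) = pad (take i v)"
    using True i by (auto simp: pad_def fun_eq_iff less_Suc_eq)
  then show ?thesis using True by (simp add: h_elt_def)
next
  case False
  then have 2: "2 \<le> i" and m: "marked \<omega> (j + i - 2)" using a i by (auto simp: admissible_def)
  have "j + i - 1 = j + i - 2 + 1" using 2 by simp
  then have m2: "\<omega> (j + i - 1) \<noteq> L2" using markedD(2)[OF m] by simp
  let ?\<rho> = "shift (j + i - 1) \<omega>"
  let ?u = "take (i - 1) v" and ?h = "h_elt \<omega> j v (Suc i)"
  have hA: "?h \<in> carrier Aut_T" using h_elt_in_G[OF r a i] by (rule Grig_Aut)
  have t: "take i v = ?u @ [True]"
  proof -
    obtain k where "i = Suc k" using 2 by (cases i) auto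
    then show ?thesis
      using admissible_before(1)[OF a i False] i by (simp add: take_Suc_conv_app_nth)
  qed
  have t2: "take (Suc i) v = ?u @ [True, False]"
    using t False i by (simp add: take_Suc_conv_app_nth)
  have comm: "comm_T (gen ?\<rho> Kb) gen_a (True # True # replicate k True) = True # False # replicate k True" for k
    using m2 by (simp add: comm_T_def mult_T_apply gen_replicate_True letter_hom_moves moves_special shift_apply)
      (cases "\<omega> (j + i - 1)"; simp add: gen_replicate_True)
  have eq: "pref (act (pad (take i v)) ?h) n = pref (pad (take (Suc i) v)) n" if n: "n \<ge> Suc i" for n
  proof -
    have "pref (pad (take i v)) n = ?u @ [True] @ replicate (n - i) True"
    proof -
      have "pref (pad (take i v)) n = take i v @ replicate (n - i) True"
        using pref_pad[of "take i v" n] n i by simp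
      then show ?thesis unfolding t by simp
    qed
    also have "replicate (n - i) True = True # replicate (n - Suc i) True"
      using n by (metis Suc_diff_Suc Suc_le_lessD replicate_Suc)
    finally have "pref (act (pad (take i v)) ?h) n = ?u @ True # False # replicate (n - Suc i) True"
    proof -
      assume p: "pref (pad (take i v)) n = ?u @ [True] @ True # replicate (n - Suc i) True"
      have "?h = iota (comm_T (gen ?\<rho> Kb) gen_a) ?u" using False by (simp add: h_elt_def)
      then show ?thesis using comm[of "n - Suc i"] unfolding pref_act[OF hA] p by (simp add: iota_def)
    qed
    also have "\<dots> = pref (pad (take (Suc i) v)) n"
    proof -
      have "pref (pad (take (Suc i) v)) n = take (Suc i) v @ replicate (n - Suc i) True"
        using pref_pad[of "take (Suc i) v" n] n i by simp
      then show ?thesis unfolding t2 by simp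
    qed
    finally show ?thesis .
  qed
  show ?thesis
  proof (rule pref_inject)
    fix n
    show "pref (act (pad (take i v)) ?h) n = pref (pad (take (Suc i) v)) n"
      using eq[of "max n (Suc i)"] by (metis max.cobounded1 max.cobounded2 take_pref)
  qed
qed

lemma h_prod:
  assumes r: "rich \<omega>" and a: "admissible \<omega> j v" and "m \<le> length v"
  shows "prod_T (map (h_elt \<omega> j v) [1..<Suc m]) \<in> Grig (shift j \<omega>)
    \<and> (\<forall>x. odd_germ (shift j \<omega>) (prod_T (map (h_elt \<omega> j v) [1..<Suc m])) x = False)
    \<and> act ones (prod_T (map (h_elt \<omega> j v) [1..<Suc m])) = pad (take m v)"
  using assms(3)
proof (induction m)
  case 0
  then show ?case using rich_shift[OF r] by simp
next
  case (Suc m)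
  let ?P = "prod_T (map (h_elt \<omega> j v) [1..<Suc m])" and ?h = "h_elt \<omega> j v (Suc m)"
  have "m \<le> length v" using Suc.prems by simp
  from Suc.IH[OF this] have IH: "?P \<in> Grig (shift j \<omega>)" "\<And>x. odd_germ (shift j \<omega>) ?P x = False"
    "act ones ?P = pad (take m v)"
    by blast+
  have m: "m < length v" using Suc.prems by simp
  note h = h_elt_in_G[OF r a m] odd_germ_h_elt[OF r a m] act_h_elt[OF r a m]
  have "prod_T (map (h_elt \<omega> j v) [1..<Suc (Suc m)]) = ?P \<cdot> ?h"
    using prod_T_snoc[of "map (h_elt \<omega> j v) [1..<Suc m]" ?h] by (simp only: upt_Suc_append map_append list.map le_add1 plus_1_eq_Suc)
  moreover have "?P \<cdot> ?h \<in> Grig (shift j \<omega>)" using IH(1) h(1) by simp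
  moreover have "odd_germ (shift j \<omega>) (?P \<cdot> ?h) x = False" for x
    using odd_germ_mult[OF rich_shift[OF r] IH(1) h(1)] IH(2) h(2) by simp
  moreover have "act ones (?P \<cdot> ?h) = pad (take (Suc m) v)"
    using act_mult[OF Grig_Aut[OF IH(1)] Grig_Aut[OF h(1)]] IH(3) h(3) by simp
  ultimately show ?case by simp
qed

text \<open>As the conjugating product has trivial germs and maps $1^\infty$ to $v1^\infty$, conjugation moves the only
  nontrivial germ of $c$ to $v1^\infty$.\<close>

lemma c_elt_props:
  assumes r: "rich \<omega>" and a: "admissible \<omega> j v"
  shows c_elt_in_G: "c_elt \<omega> j v \<in> Grig (shift j \<omega>)"
    and odd_germ_c_elt: "odd_germ (shift j \<omega>) (c_elt \<omega> j v) x \<longleftrightarrow> x = pad v"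
    and odd_germ_inv_c_elt: "odd_germ (shift j \<omega>) (inv_T (c_elt \<omega> j v)) x \<longleftrightarrow> x = pad v"
    and activity_c_elt: "activity (c_elt \<omega> j v) [] = False"
    and level_sign_c_elt: "level_sign n (c_elt \<omega> j v) = level_sign n (gen (shift j \<omega>) Kc)"
proof -
  let ?\<rho> = "shift j \<omega>" and ?c = "gen (shift j \<omega>) Kc"
  define h where "h = prod_T (map (h_elt \<omega> j v) [1..<Suc (length v)])"
  have h: "h \<in> Grig ?\<rho>" "\<And>x. odd_germ ?\<rho> h x = False" "act ones h = pad v"
    using h_prod[OF r a order_refl] by (auto simp: h_def)
  have hA: "h \<in> carrier Aut_T" using h(1) by (rule Grig_Aut)
  have c: "c_elt \<omega> j v = inv_T h \<cdot> ?c \<cdot> h" by (simp add: c_elt_def h_def Let_def)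
  show "c_elt \<omega> j v \<in> Grig ?\<rho>" using h(1) by (simp add: c)
  have "odd_germ ?\<rho> (c_elt \<omega> j v) x \<longleftrightarrow> act x (inv_T h) = ones"
    using h by (simp add: c odd_germ_mult rich_shift[OF r] odd_germ_inv odd_germ_gen)
  also have "\<dots> \<longleftrightarrow> x = pad v" using h(3) hA by (metis act_inv)
  finally show "odd_germ ?\<rho> (c_elt \<omega> j v) x \<longleftrightarrow> x = pad v" .
  have "activity (inv_T h \<cdot> h) [] = False" using group.l_inv[OF group_Aut_T hA] by simp
  then have "activity (inv_T h) [] = activity h []" using hA by (auto simp: activity_mult)
  then show "activity (c_elt \<omega> j v) [] = False"
    using hA by (simp add: c activity_mult activity_gen)
  have "inv_T (c_elt \<omega> j v) = c_elt \<omega> j v"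
    using hA by (intro inv_T_involution) (simp_all add: c mult_T_apply)
  then show "odd_germ ?\<rho> (inv_T (c_elt \<omega> j v)) x \<longleftrightarrow> x = pad v"
    using \<open>odd_germ ?\<rho> (c_elt \<omega> j v) x \<longleftrightarrow> x = pad v\<close> by simp
  show "level_sign n (c_elt \<omega> j v) = level_sign n ?c"
    using hA level_sign_sq[of n h] by (simp add: c level_sign_mult level_sign_inv mult_ac)
qed

section \<open>The factors of the random product\<close>

text \<open>The factors of the random product have this property, with a different $j$ for each factor. It is what makes
  their exponents visible in the image of a ray.\<close>

definition swaps :: "nat \<Rightarrow> tree_map \<Rightarrow> bool" where
  "swaps j g \<longleftrightarrow> (\<forall>x. (\<forall>i<j. act x g i = x i) \<and> act x g j = (\<not> x j))"

text \<open>The factor with index $j$ acts below a vertex of level $j$ as a twisted copy of an element of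
  $G_{\mathfrak s^j\omega}$. The source of a ray is the ray at which this copy is evaluated; the parameter $t$ is
  $a$ for the element itself and $id$ for its inverse.\<close>

definition source :: "tree_map \<Rightarrow> nat \<Rightarrow> (nat \<Rightarrow> bool) \<Rightarrow> (nat \<Rightarrow> bool)" where
  "source t j x = act (drop_ray j x) (twist (pref x j) \<cdot> t)"

lemma odd_germ_sections:
  assumes r: "rich \<omega>" and g: "g \<in> Grig (shift j \<omega>)"
    and Zu: "\<And>u w. length u = j \<Longrightarrow> Z (u @ w) = u @ twist u (g (twist u w))"
  shows "odd_germ \<omega> Z x = odd_germ (shift j \<omega>) g (source id j x)"
proof -
  let ?\<rho> = "shift j \<omega>" and ?u = "pref x j" and ?y = "drop_ray j x"
  let ?t = "twist ?u \<cdot> g \<cdot> twist ?u"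
  have t: "?t \<in> Grig ?\<rho>" using g by simp
  have flpZ: "activity Z (?u @ w) = activity ?t w" for w
    using Zu[of ?u "w @ [False]"] last_Aut_T_snoc[OF Grig_Aut[OF t], of ?u w False]
    by (simp add: activity_def mult_T_apply)
  have "has_germ \<omega> Z x (odd_germ ?\<rho> ?t ?y)"
  proof -
    obtain N where N: "\<And>n. n \<ge> N \<Longrightarrow> \<not> activity ?t (pref ?y n) \<and>
        (?\<rho> n = L2 \<longrightarrow> activity ?t (pref ?y n @ [False]) = odd_germ ?\<rho> ?t ?y)"
      using has_germ_odd_germ_Grig[OF rich_shift[OF r] t, of ?y] by (auto simp: has_germ_def)
    show ?thesis unfolding has_germ_def
    proof (intro exI[of _ "N + j"] allI impI)
      fix n assume n: "N + j \<le> n"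
      then have "pref x n = ?u @ pref ?y (n - j)" by (intro pref_split) simp
      then show "\<not> activity Z (pref x n) \<and> (\<omega> n = L2 \<longrightarrow> activity Z (pref x n @ [False]) = odd_germ ?\<rho> ?t ?y)"
        using N[of "n - j"] n by (auto simp: flpZ shift_apply)
    qed
  qed
  then have "odd_germ \<omega> Z x = odd_germ ?\<rho> ?t ?y" by (rule has_germ_odd_germ[OF r])
  also have "\<dots> = odd_germ ?\<rho> g (source id j x)"
  proof -
    have "odd_germ ?\<rho> (twist u) z = False" for u z using rich_shift[OF r] by (simp add: twist_def)
    then show ?thesis
      using g by (simp add: odd_germ_mult rich_shift[OF r] source_def)
  qed
  finally show ?thesis .
qed

lemma zeta_iter_props:
  assumes r: "rich \<omega>" and c: "c \<in> Grig (shift j \<omega>)" "activity c [] = False"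
    and v: "\<And>n. level_sign n (gen_a \<cdot> c) = level_sign n (eval_word (shift j \<omega>) v)"
      "even (count_list v (special (\<omega> (j - 1))))"
  defines "Z \<equiv> zeta_iter \<omega> j (gen_a \<cdot> c)"
  shows "Z \<in> Grig \<omega>" "swaps j Z"
    "odd_germ \<omega> Z x = odd_germ (shift j \<omega>) c (source gen_a j x)"
    "odd_germ \<omega> (inv_T Z) x = odd_germ (shift j \<omega>) (inv_T c) (source id j x)"
proof -
  let ?g = "gen_a \<cdot> c" and ?\<rho> = "shift j \<omega>"
  have cA: "c \<in> carrier Aut_T" using c(1) by (rule Grig_Aut)
  have g: "?g \<in> Grig ?\<rho>" using c by simp
  have Z: "Z \<in> Grig \<omega>" and Zu: "\<And>u w. length u = j \<Longrightarrow> Z (u @ w) = u @ twist u (?g (twist u w))"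
    using zeta_iter_sections[OF r g] v unfolding Z_def by blast+
  show "Z \<in> Grig \<omega>" by (rule Z)
  have ZA: "Z \<in> carrier Aut_T" using Z by (rule Grig_Aut)
  have tA: "twist u \<cdot> ?g \<cdot> twist u \<in> carrier Aut_T" for u using cA by simp
  show "swaps j Z" unfolding swaps_def
  proof (intro allI conjI impI)
    fix x i assume "i < j"
    have "pref (act x Z) j = Z (pref x j)" by (rule pref_act[OF ZA])
    also have "\<dots> = pref x j"
      using Zu[of "pref x j" "[]"] Aut_T_Nil[OF tA[of "pref x j"]] by (simp add: mult_T_apply)
    finally show "act x Z i = x i" using \<open>i < j\<close> by (simp add: pref_eq_iff)
  next
    fix x
    have "activity (twist u \<cdot> ?g \<cdot> twist u) []" for u
      using c cA by (simp add: activity_mult activity_gen_a)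
    then have "activity Z (pref x j)"
      using Zu[of "pref x j" "[False]"] last_Aut_T_snoc[OF tA, of "pref x j" "pref x j" "[]" False]
      by (simp add: activity_def mult_T_apply)
    then show "act x Z j = (\<not> x j)" by (simp add: act_nth[OF ZA])
  qed
  have "odd_germ \<omega> Z x = odd_germ ?\<rho> ?g (source id j x)"
    by (rule odd_germ_sections[OF r g Zu])
  also have "\<dots> = odd_germ ?\<rho> c (source gen_a j x)"
    using c by (simp add: odd_germ_mult rich_shift[OF r] source_def act_mult)
  finally show "odd_germ \<omega> Z x = odd_germ ?\<rho> c (source gen_a j x)" .
  have "odd_germ \<omega> (inv_T Z) x = odd_germ ?\<rho> (inv_T ?g) (source id j x)"
  proof (rule odd_germ_sections[OF r])
    show "inv_T ?g \<in> Grig ?\<rho>" using g by simp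
    fix u w :: vertex assume u: "length u = j"
    have gA: "?g \<in> carrier Aut_T" using cA by simp
    have "Z (u @ twist u (inv_T ?g (twist u w))) = u @ w"
      using Zu[OF u, of "twist u (inv_T ?g (twist u w))"] gA by (simp only: twist_twist inv_T_apply)
    then show "inv_T Z (u @ w) = u @ twist u (inv_T ?g (twist u w))"
      using ZA by (metis inv_T_apply(1))
  qed
  also have "\<dots> = odd_germ ?\<rho> (inv_T c) (source id j x)"
    using c cA by (simp add: inv_T_mult odd_germ_mult rich_shift[OF r])
  finally show "odd_germ \<omega> (inv_T Z) x = odd_germ ?\<rho> (inv_T c) (source id j x)" .
qed

lemma g_tilde_props:
  assumes r: "rich \<omega>" and j: "\<omega> (j - 1) = L2" and a: "admissible \<omega> j v"
  shows "g_tilde \<omega> j v \<in> Grig \<omega>" "swaps j (g_tilde \<omega> j v)"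
    "odd_germ \<omega> (g_tilde \<omega> j v) x \<longleftrightarrow> source gen_a j x = pad v"
    "odd_germ \<omega> (inv_T (g_tilde \<omega> j v)) x \<longleftrightarrow> source id j x = pad v"
proof -
  have al: "level_sign n (gen_a \<cdot> c_elt \<omega> j v) = level_sign n (eval_word (shift j \<omega>) [Kc])" for n
    using Grig_Aut[OF c_elt_in_G[OF r a]] by (simp add: eval_word_Cons level_sign_mult level_sign_c_elt[OF r a])
  have ev: "even (count_list [Kc] (special (\<omega> (j - 1))))" using j by simp
  note Z = zeta_iter_props[OF r c_elt_in_G[OF r a] activity_c_elt[OF r a] al ev]
  show "g_tilde \<omega> j v \<in> Grig \<omega>" "swaps j (g_tilde \<omega> j v)"
    "odd_germ \<omega> (g_tilde \<omega> j v) x \<longleftrightarrow> source gen_a j x = pad v"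
    "odd_germ \<omega> (inv_T (g_tilde \<omega> j v)) x \<longleftrightarrow> source id j x = pad v"
    unfolding g_tilde_def Z(3,4) odd_germ_c_elt[OF r a] odd_germ_inv_c_elt[OF r a]
    by (fact Z(1), fact Z(2), rule refl, rule refl)
qed

lemma g_elt_props:
  assumes r: "rich \<omega>"
  shows "g_elt \<omega> j \<in> Grig \<omega>" "swaps j (g_elt \<omega> j)"
    "odd_germ \<omega> (g_elt \<omega> j) x \<longleftrightarrow> \<omega> (j - 1) = L2 \<and> source gen_a j x = ones"
    "odd_germ \<omega> (inv_T (g_elt \<omega> j)) x \<longleftrightarrow> \<omega> (j - 1) = L2 \<and> source id j x = ones"
proof -
  define k where "k = (if \<omega> (j - 1) = L2 then Kc else Kb)"
  have al: "level_sign n (gen_a \<cdot> gen (shift j \<omega>) k) = level_sign n (eval_word (shift j \<omega>) [k])" for n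
    by (simp add: eval_word_Cons)
  have ev: "even (count_list [k] (special (\<omega> (j - 1))))"
    by (cases "\<omega> (j - 1)") (auto simp: k_def)
  have fl: "activity (gen (shift j \<omega>) k) [] = False" by (simp add: activity_gen)
  note Z = zeta_iter_props[OF r Grig_gen fl al ev]
  have e: "g_elt \<omega> j = zeta_iter \<omega> j (gen_a \<cdot> gen (shift j \<omega>) k)"
    by (simp only: g_elt_def k_def)
  show "g_elt \<omega> j \<in> Grig \<omega>" "swaps j (g_elt \<omega> j)" unfolding e by (fact Z(1), fact Z(2))
  have "k \<noteq> Kb \<longleftrightarrow> \<omega> (j - 1) = L2" by (auto simp: k_def)
  then show "odd_germ \<omega> (g_elt \<omega> j) x \<longleftrightarrow> \<omega> (j - 1) = L2 \<and> source gen_a j x = ones"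
    "odd_germ \<omega> (inv_T (g_elt \<omega> j)) x \<longleftrightarrow> \<omega> (j - 1) = L2 \<and> source id j x = ones"
    unfolding e Z(3,4) inv_gen odd_germ_gen[OF rich_shift[OF r]] by blast+
qed

text \<open>A ray is determined by its first $j$ letters and its source, so each fibre has at most $2^j$ elements.\<close>

lemma source_fibre:
  assumes "t \<in> carrier Aut_T"
  shows "finite {x. source t j x = p}" "card {x. source t j x = p} \<le> 2 ^ j"
proof -
  have inj: "inj_on (\<lambda>x. pref x j) {x. source t j x = p}"
  proof (rule inj_onI)
    fix x y assume xy: "x \<in> {x. source t j x = p}" "y \<in> {x. source t j x = p}" "pref x j = pref y j"
    let ?t = "twist (pref x j) \<cdot> t"
    have tA: "?t \<in> carrier Aut_T" using assms by simp
    have "act (drop_ray j x) ?t = act (drop_ray j y) ?t"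
      using xy by (simp add: source_def)
    then have "drop_ray j x = drop_ray j y" using tA by (metis act_inv(1))
    then have "pref x n = pref y n" if "n \<ge> j" for n
      using xy(3) that by (simp add: pref_split)
    then have "pref x n = pref y n" for n
      by (metis max.cobounded1 max.cobounded2 take_pref)
    then show "x = y" by (rule pref_inject)
  qed
  have sub: "(\<lambda>x. pref x j) ` {x. source t j x = p} \<subseteq> {u. length u = j}" by auto
  show "finite {x. source t j x = p}"
    using inj sub finite_level by (metis finite_imageD finite_subset)
  have "card {x. source t j x = p} \<le> card {u :: vertex. length u = j}"
    by (rule card_inj_on_le[OF inj sub finite_level])
  also have "\<dots> = 2 ^ j"
    using card_lists_length_eq[of "UNIV :: bool set" j] by simp
  finally show "card {x. source t j x = p} \<le> 2 ^ j" .
qed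

section \<open>Collision probabilities\<close>

abbreviation mass :: "('a \<Rightarrow> ennreal) \<Rightarrow> ennreal" where
  "mass w \<equiv> \<integral>\<^sup>+y. w y \<partial>count_space UNIV"

abbreviation rate :: "(tree_map \<Rightarrow> (nat \<Rightarrow> bool) \<Rightarrow> bool) \<Rightarrow> tree_map pmf \<Rightarrow> (nat \<Rightarrow> bool) \<Rightarrow> ennreal" where
  "rate P M y \<equiv> emeasure (measure_pmf M) {g. P g y}"

lemma nn_integral_pmf_swap:
  fixes f :: "'a \<Rightarrow> 'b \<Rightarrow> ennreal"
  shows "(\<integral>\<^sup>+x. \<integral>\<^sup>+y. f x y \<partial>measure_pmf q \<partial>measure_pmf p) = (\<integral>\<^sup>+y. \<integral>\<^sup>+x. f x y \<partial>measure_pmf p \<partial>measure_pmf q)"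
proof -
  have "(\<integral>\<^sup>+z. case_prod f z \<partial>bind_pmf p (\<lambda>x. bind_pmf q (\<lambda>y. return_pmf (x, y))))
      = (\<integral>\<^sup>+z. case_prod f z \<partial>bind_pmf q (\<lambda>y. bind_pmf p (\<lambda>x. return_pmf (x, y))))"
    by (subst bind_commute_pmf) simp
  then show ?thesis by (simp add: nn_integral_return_pmf)
qed

lemma nn_integral_pmf_count_space_swap:
  fixes f :: "'a \<Rightarrow> 'b \<Rightarrow> ennreal"
  shows "mass (\<lambda>y. \<integral>\<^sup>+x. f x y \<partial>measure_pmf p) = (\<integral>\<^sup>+x. mass (f x) \<partial>measure_pmf p)"
  unfolding nn_integral_measure_pmf
  by (simp add: nn_integral_cmult[symmetric]
      nn_integral_fst_count_space[of "\<lambda>(y, x). ennreal (pmf p x) * f x y", simplified]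
      nn_integral_snd_count_space[of "\<lambda>(y, x). ennreal (pmf p x) * f x y", simplified])

text \<open>The probability that independent samples agree. For $p=q$ it is the squared $\ell^2$ norm of the law.\<close>

definition collision :: "'a pmf \<Rightarrow> 'a pmf \<Rightarrow> ennreal" where
  "collision p q = (\<integral>\<^sup>+x. pmf q x \<partial>measure_pmf p)"

lemma collision_count_space: "collision p q = (\<integral>\<^sup>+x. ennreal (pmf p x * pmf q x) \<partial>count_space UNIV)"
  by (simp add: collision_def nn_integral_measure_pmf ennreal_mult)

lemma collision_commute: "collision p q = collision q p"
  by (simp add: collision_count_space mult.commute)

lemma collision_le_1: "collision p q \<le> 1"
proof -
  have "collision p q \<le> (\<integral>\<^sup>+x. 1 \<partial>measure_pmf p)"
    unfolding collision_def by (intro nn_integral_mono) (simp add: pmf_le_1)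
  then show ?thesis by simp
qed

lemma collision_le_mean: "2 * collision p q \<le> collision p p + collision q q"
proof -
  have "2 * collision p q = (\<integral>\<^sup>+x. ennreal (2 * (pmf p x * pmf q x)) \<partial>count_space UNIV)"
    unfolding collision_count_space by (subst nn_integral_cmult[symmetric]) (auto simp: ennreal_mult')
  also have "\<dots> \<le> (\<integral>\<^sup>+x. ennreal (pmf p x * pmf p x + pmf q x * pmf q x) \<partial>count_space UNIV)"
  proof (intro nn_integral_mono ennreal_leI)
    fix x
    have "0 \<le> (pmf p x - pmf q x)\<^sup>2" by simp
    then show "2 * (pmf p x * pmf q x) \<le> pmf p x * pmf p x + pmf q x * pmf q x"
      by (simp add: power2_eq_square algebra_simps)
  qed
  also have "\<dots> = collision p p + collision q q"
    unfolding collision_count_space by (subst nn_integral_add[symmetric]) auto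
  finally show ?thesis .
qed

lemma collision_bind: "collision (bind_pmf A f) q = (\<integral>\<^sup>+a. collision (f a) q \<partial>measure_pmf A)"
  by (simp add: collision_def)

lemma collision_map_inj:
  assumes "inj f"
  shows "collision (map_pmf f p) (map_pmf f q) = collision p q"
  using assms by (simp add: collision_def pmf_map_inj')

lemma collision_pos: "0 < collision p p"
proof -
  obtain x where x: "x \<in> set_pmf p" using set_pmf_not_empty by fast
  have "ennreal (pmf p x * pmf p x) = (\<integral>\<^sup>+y. ennreal (pmf p x * pmf p x) * indicator {x} y \<partial>count_space UNIV)"
    by simp
  also have "\<dots> \<le> collision p p"
    unfolding collision_count_space by (intro nn_integral_mono) (auto split: split_indicator)
  finally show ?thesis using x
    by (metis ennreal_less_zero_iff mult_pos_pos order_less_le_trans pmf_positive)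
qed

section \<open>Heat kernel decay\<close>

definition ray_step :: "tree_map pmf \<Rightarrow> (nat \<Rightarrow> bool) \<Rightarrow> (nat \<Rightarrow> bool) pmf" where
  "ray_step M x = map_pmf (act x) M"

text \<open>The walk on rays is peeled off at its first step, as in the definition of harmonic functions, while the decay of
  collision probabilities uses its last step (\<open>ray_walk_Suc_end\<close>).\<close>

primrec ray_walk :: "tree_map pmf \<Rightarrow> nat \<Rightarrow> (nat \<Rightarrow> bool) \<Rightarrow> (nat \<Rightarrow> bool) pmf" where
  "ray_walk M 0 x = return_pmf x"
| "ray_walk M (Suc t) x = bind_pmf (ray_step M x) (ray_walk M t)"

lemma ray_walk_add: "ray_walk M (s + t) x = bind_pmf (ray_walk M s x) (ray_walk M t)"
proof (induction s arbitrary: x)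
  case (Suc s)
  then have "ray_walk M (s + t) = (\<lambda>x. bind_pmf (ray_walk M s x) (ray_walk M t))" by (intro ext)
  then show ?case by (simp add: bind_assoc_pmf)
qed (simp add: bind_return_pmf)

lemma ray_walk_Suc_end: "ray_walk M (Suc t) x = bind_pmf (ray_walk M t x) (ray_step M)"
proof -
  have "ray_walk M 0 = return_pmf" by (rule ext) simp
  then have "ray_walk M (Suc 0) = ray_step M" by (intro ext) (simp add: bind_return_pmf')
  then show ?thesis using ray_walk_add[of M t "Suc 0" x] by simp
qed

lemma ray_step_symmetric:
  assumes "set_pmf M \<subseteq> carrier Aut_T" and "map_pmf inv_T M = M"
  shows "pmf (ray_step M x) y = pmf (ray_step M y) x"
proof -
  have "pmf (ray_step M x) y = measure (measure_pmf (map_pmf inv_T M)) (act x -` {y})"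
    unfolding assms(2) ray_step_def pmf_map ..
  also have "\<dots> = measure (measure_pmf M) {g. act x (inv_T g) = y}"
    by (simp add: measure_map_pmf vimage_def)
  also have "\<dots> = measure (measure_pmf M) (act y -` {x})"
  proof (rule measure_pmf.finite_measure_eq_AE)
    show "AE g in measure_pmf M. g \<in> {g. act x (inv_T g) = y} \<longleftrightarrow> g \<in> act y -` {x}"
      unfolding AE_measure_pmf_iff using assms(1) by auto
  qed auto
  also have "\<dots> = pmf (ray_step M y) x" by (simp add: ray_step_def pmf_map)
  finally show ?thesis .
qed

lemma ray_walk_symmetric:
  assumes "set_pmf M \<subseteq> carrier Aut_T" "map_pmf inv_T M = M"
  shows "pmf (ray_walk M t x) y = pmf (ray_walk M t y) x"
proof (induction t arbitrary: x y)
  case 0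
  then show ?case by (simp add: indicator_def)
next
  case (Suc t)
  have "ennreal (pmf (ray_walk M (Suc t) x) y) = (\<integral>\<^sup>+z. pmf (ray_walk M t z) y \<partial>measure_pmf (ray_step M x))"
    by (simp add: ennreal_pmf_bind)
  also have "\<dots> = collision (ray_step M x) (ray_walk M t y)"
    unfolding collision_def by (simp add: Suc)
  also have "\<dots> = collision (ray_walk M t y) (ray_step M x)" by (rule collision_commute)
  also have "\<dots> = (\<integral>\<^sup>+z. pmf (ray_step M z) x \<partial>measure_pmf (ray_walk M t y))"
    unfolding collision_def by (simp add: ray_step_symmetric[OF assms, of x])
  also have "\<dots> = ennreal (pmf (ray_walk M (Suc t) y) x)"
    by (simp only: ray_walk_Suc_end ennreal_pmf_bind)
  finally show ?case by simp
qed

text \<open>By symmetry an arrival probability is a collision probability of two walks, started at the two ends.\<close>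

lemma ray_walk_le_collision:
  assumes "set_pmf M \<subseteq> carrier Aut_T" "map_pmf inv_T M = M"
  shows "2 * ennreal (pmf (ray_walk M (s + t) x) y) \<le> collision (ray_walk M s x) (ray_walk M s x) + collision (ray_walk M t y) (ray_walk M t y)"
proof -
  have "ennreal (pmf (ray_walk M (s + t) x) y) = (\<integral>\<^sup>+z. pmf (ray_walk M t z) y \<partial>measure_pmf (ray_walk M s x))"
    by (simp only: ray_walk_add ennreal_pmf_bind)
  also have "\<dots> = collision (ray_walk M s x) (ray_walk M t y)"
    unfolding collision_def by (simp add: ray_walk_symmetric[OF assms, of t _ y])
  finally show ?thesis using collision_le_mean by simp
qed

text \<open>The collision probability after one step is an average of the collision probabilities of two translates
  of $p$. None of these exceeds that of $p$, and a portion $c$ of them averages to at most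
  $\delta$ because $U$ spreads each point.\<close>

lemma collision_step:
  assumes A: "set_pmf M \<subseteq> carrier Aut_T"
    and c: "0 \<le> c" "\<And>g. c * pmf U g \<le> pmf M g"
    and U: "set_pmf U \<subseteq> carrier Aut_T" "\<And>y z. emeasure (measure_pmf U) {h. act y h = z} \<le> ennreal \<delta>"
    and u: "collision p p = ennreal u" "0 \<le> u" and \<delta>: "0 \<le> \<delta>"
  shows "collision (bind_pmf p (ray_step M)) (bind_pmf p (ray_step M)) \<le> ennreal ((1 - c) * u + c * \<delta>)"
proof -
  define T where "T g = map_pmf (\<lambda>y. act y g) p" for g
  let ?q = "bind_pmf p (ray_step M)"
  have q: "bind_pmf p (ray_step N) = bind_pmf N T" for N
    unfolding ray_step_def T_def map_pmf_def by (subst bind_commute_pmf) simp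
  have inj: "inj (\<lambda>y. act y g)" if "g \<in> carrier Aut_T" for g
    using bij_act[OF that] by (rule bij_is_inj)
  have TT: "collision (T g) (T g) = ennreal u" if "g \<in> carrier Aut_T" for g
    unfolding T_def using collision_map_inj[OF inj[OF that]] u by simp
  have S: "collision (T h) (T g) \<le> ennreal u" if "g \<in> carrier Aut_T" "h \<in> carrier Aut_T" for g h
  proof -
    have "2 * collision (T h) (T g) \<le> 2 * ennreal u"
      using collision_le_mean[of "T h" "T g"] TT that by (simp add: mult_2)
    then show ?thesis by (subst (asm) ennreal_mult_le_mult_iff) auto
  qed
  have U\<delta>: "(\<integral>\<^sup>+h. collision (T h) r \<partial>measure_pmf U) \<le> ennreal \<delta>" for r
  proof -
    have "(\<integral>\<^sup>+h. collision (T h) r \<partial>measure_pmf U) = collision r (bind_pmf p (ray_step U))"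
      by (simp add: q collision_bind collision_commute[of r])
    also have "\<dots> \<le> (\<integral>\<^sup>+z. ennreal \<delta> \<partial>measure_pmf r)"
      unfolding collision_def
    proof (rule nn_integral_mono)
      fix z
      have "ennreal (pmf (bind_pmf p (ray_step U)) z) = (\<integral>\<^sup>+y. emeasure (measure_pmf U) {h. act y h = z} \<partial>measure_pmf p)"
        by (simp add: ennreal_pmf_bind ray_step_def pmf_map measure_pmf.emeasure_eq_measure vimage_def)
      also have "\<dots> \<le> (\<integral>\<^sup>+y. ennreal \<delta> \<partial>measure_pmf p)" by (intro nn_integral_mono U)
      finally show "ennreal (pmf (bind_pmf p (ray_step U)) z) \<le> ennreal \<delta>" by simp
    qed
    finally show ?thesis by simp
  qed
  have c1: "c \<le> 1"
  proof -
    have "ennreal c = (\<integral>\<^sup>+h. ennreal c * ennreal (pmf U h) \<partial>count_space UNIV)"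
      by (simp add: nn_integral_cmult nn_integral_pmf)
    also have "\<dots> \<le> (\<integral>\<^sup>+h. ennreal (pmf M h) \<partial>count_space UNIV)"
      by (intro nn_integral_mono) (use c in \<open>auto simp: ennreal_mult[symmetric]\<close>)
    also have "\<dots> = 1" by (simp add: nn_integral_pmf)
    finally show ?thesis by simp
  qed
  have rest: "(\<integral>\<^sup>+h. ennreal (pmf M h - c * pmf U h) \<partial>count_space UNIV) = ennreal (1 - c)"
  proof -
    have "(\<integral>\<^sup>+h. ennreal (pmf M h - c * pmf U h) \<partial>count_space UNIV) + ennreal c
       = (\<integral>\<^sup>+h. ennreal (pmf M h - c * pmf U h) \<partial>count_space UNIV) + (\<integral>\<^sup>+h. ennreal c * ennreal (pmf U h) \<partial>count_space UNIV)"
      by (simp add: nn_integral_cmult nn_integral_pmf)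
    also have "\<dots> = (\<integral>\<^sup>+h. ennreal (pmf M h - c * pmf U h) + ennreal c * ennreal (pmf U h) \<partial>count_space UNIV)"
      by (rule nn_integral_add[symmetric]) auto
    also have "\<dots> = (\<integral>\<^sup>+h. ennreal (pmf M h) \<partial>count_space UNIV)"
      by (rule nn_integral_cong) (use c in \<open>simp add: ennreal_mult[symmetric] ennreal_plus[symmetric] del: ennreal_plus\<close>)
    also have "\<dots> = 1" by (simp add: nn_integral_pmf)
    finally have "(\<integral>\<^sup>+h. ennreal (pmf M h - c * pmf U h) \<partial>count_space UNIV) = 1 - ennreal c"
      by (metis ennreal_add_diff_cancel_right ennreal_neq_top)
    then show ?thesis using c by (simp add: ennreal_minus[symmetric] ennreal_1[symmetric] del: ennreal_1)
  qed
  have M1: "(\<integral>\<^sup>+h. collision (T h) (T g) \<partial>measure_pmf M) \<le> ennreal ((1 - c) * u + c * \<delta>)"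
    if g: "g \<in> carrier Aut_T" for g
  proof -
    let ?S = "\<lambda>h. collision (T h) (T g)"
    have "(\<integral>\<^sup>+h. ?S h \<partial>measure_pmf M) = (\<integral>\<^sup>+h. ennreal (pmf M h) * ?S h \<partial>count_space UNIV)"
      by (rule nn_integral_measure_pmf)
    also have "\<dots> = (\<integral>\<^sup>+h. ennreal (pmf M h - c * pmf U h) * ?S h + ennreal c * (ennreal (pmf U h) * ?S h) \<partial>count_space UNIV)"
    proof (rule nn_integral_cong)
      fix h
      have "ennreal (pmf M h) = ennreal (pmf M h - c * pmf U h) + ennreal c * ennreal (pmf U h)"
        using c by (simp add: ennreal_mult[symmetric] ennreal_plus[symmetric] del: ennreal_plus)
      then show "ennreal (pmf M h) * ?S h = ennreal (pmf M h - c * pmf U h) * ?S h + ennreal c * (ennreal (pmf U h) * ?S h)"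
        by (simp add: distrib_right mult.assoc)
    qed
    also have "\<dots> = (\<integral>\<^sup>+h. ennreal (pmf M h - c * pmf U h) * ?S h \<partial>count_space UNIV)
        + ennreal c * (\<integral>\<^sup>+h. ?S h \<partial>measure_pmf U)"
      by (simp add: nn_integral_add nn_integral_cmult nn_integral_measure_pmf)
    also have "\<dots> \<le> (\<integral>\<^sup>+h. ennreal (pmf M h - c * pmf U h) * ennreal u \<partial>count_space UNIV) + ennreal c * ennreal \<delta>"
    proof (rule add_mono)
      show "ennreal c * (\<integral>\<^sup>+h. ?S h \<partial>measure_pmf U) \<le> ennreal c * ennreal \<delta>"
        by (intro mult_left_mono U\<delta>) auto
      show "(\<integral>\<^sup>+h. ennreal (pmf M h - c * pmf U h) * ?S h \<partial>count_space UNIV)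
        \<le> (\<integral>\<^sup>+h. ennreal (pmf M h - c * pmf U h) * ennreal u \<partial>count_space UNIV)"
      proof (rule nn_integral_mono)
      fix h
      show "ennreal (pmf M h - c * pmf U h) * ?S h \<le> ennreal (pmf M h - c * pmf U h) * ennreal u"
      proof (cases "h \<in> set_pmf M")
        case True
        then show ?thesis using S[OF g] A by (intro mult_left_mono) auto
      next
        case False
        then have "pmf M h = 0" by (simp add: set_pmf_iff)
        moreover have "0 \<le> c * pmf U h" using c by simp
        ultimately have "ennreal (pmf M h - c * pmf U h) = 0" by (simp add: ennreal_neg)
        then show ?thesis by simp
      qed
      qed
    qed
    also have "\<dots> = ennreal (1 - c) * ennreal u + ennreal c * ennreal \<delta>"
      by (subst nn_integral_multc) (simp_all only: rest borel_measurable_count_space)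
    also have "\<dots> = ennreal ((1 - c) * u + c * \<delta>)"
      using c c1 u \<delta> by (simp add: ennreal_mult[symmetric] ennreal_plus[symmetric] del: ennreal_plus)
    finally show ?thesis .
  qed
  have "collision ?q ?q = (\<integral>\<^sup>+g. \<integral>\<^sup>+h. collision (T h) (T g) \<partial>measure_pmf M \<partial>measure_pmf M)"
    unfolding q collision_bind by (subst collision_commute) (simp only: collision_bind)
  also have "\<dots> \<le> (\<integral>\<^sup>+g. ennreal ((1 - c) * u + c * \<delta>) \<partial>measure_pmf M)"
    by (rule nn_integral_mono_AE) (use M1 A in \<open>auto simp: AE_measure_pmf_iff\<close>)
  finally show ?thesis by simp
qed

lemma one_minus_powr_ge:
  assumes "0 \<le> z" "z < 1" "0 < \<beta>"
  shows "1 + \<beta> * z \<le> (1 - z) powr - (\<beta>::real)"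
proof -
  have "ln (1 - z) \<le> - z" using assms ln_le_minus_one[of "1 - z"] by simp
  then have "\<beta> * z \<le> - \<beta> * ln (1 - z)" using assms mult_left_mono[of z "- ln (1 - z)" \<beta>] by simp
  moreover have "1 + \<beta> * z \<le> exp (\<beta> * z)" by (simp add: exp_ge_add_one_self_aux)
  ultimately have "1 + \<beta> * z \<le> exp (- \<beta> * ln (1 - z))" by (meson exp_le_cancel_iff order_trans)
  then show ?thesis using assms by (simp add: powr_def mult.commute)
qed

text \<open>The recursion \<open>u' \<le> u - c u\<^sup>1\<^sup>+\<^sup>\<beta>\<close> makes \<open>u\<^sup>-\<^sup>\<beta>\<close> grow at least linearly.\<close>

lemma recursion_decay:
  fixes u :: "nat \<Rightarrow> real"
  assumes pos: "\<And>t. 0 < u t" and u0: "u 0 \<le> 1" and \<beta>: "0 < \<beta>" and c: "0 < c"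
    and step: "\<And>t. u (Suc t) \<le> u t - c * u t powr \<beta> * u t"
  shows "u t \<le> (min 1 (\<beta> * c) * (real t + 1)) powr (- 1 / \<beta>)"
proof -
  let ?d = "min 1 (\<beta> * c)"
  have d: "?d > 0" using \<beta> c by simp
  have lin: "?d * (real t + 1) \<le> u t powr - \<beta>"
  proof (induction t)
    case 0
    have "1 powr - \<beta> \<le> u 0 powr - \<beta>" using pos u0 \<beta> by (intro powr_mono2') auto
    then show ?case by simp
  next
    case (Suc t)
    let ?z = "c * u t powr \<beta>"
    have up: "u (Suc t) \<le> u t * (1 - ?z)" using step[of t] by (simp add: algebra_simps)
    have z: "?z < 1"
    proof (rule ccontr)
      assume "\<not> ?z < 1"
      then have "u t * (1 - ?z) \<le> 0" using pos[of t] by (simp add: mult_le_0_iff)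
      then show False using up pos[of "Suc t"] by linarith
    qed
    have z0: "0 \<le> ?z" using c by simp
    have "u t powr - \<beta> + ?d \<le> u t powr - \<beta> + \<beta> * c" by simp
    also have "\<dots> = u t powr - \<beta> * (1 + \<beta> * ?z)"
      using pos[of t] by (simp add: algebra_simps powr_minus)
    also have "\<dots> \<le> u t powr - \<beta> * (1 - ?z) powr - \<beta>"
      using one_minus_powr_ge[OF z0 z \<beta>] by (simp add: mult_left_mono)
    also have "\<dots> = (u t * (1 - ?z)) powr - \<beta>"
      using pos[of t] z by (simp add: powr_mult)
    also have "\<dots> \<le> u (Suc t) powr - \<beta>"
      using up pos[of "Suc t"] \<beta> by (intro powr_mono2') auto
    finally have "u t powr - \<beta> + ?d \<le> u (Suc t) powr - \<beta>" .
    then show ?case using Suc by (simp add: algebra_simps)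
  qed
  have "u t = (u t powr - \<beta>) powr (- 1 / \<beta>)"
    using \<beta> pos[of t] by (simp add: powr_powr)
  also have "\<dots> \<le> (?d * (real t + 1)) powr (- 1 / \<beta>)"
    using lin d \<beta> by (intro powr_mono2') (auto simp: divide_nonpos_pos)
  finally show ?thesis .
qed

text \<open>In \<open>collision_step\<close> with $\delta=2^{-n}$ choose the first admitted $n$ with $2^{-n}\le u/2$. Then $2^{-n}$ is at least
  $2^{-D-1}u$, so the loss $2^{-n\beta}u/2$ is at least a constant times $u^{1+\beta}$.\<close>

lemma heat_kernel:
  assumes M: "set_pmf M \<subseteq> carrier Aut_T" "map_pmf inv_T M = M"
    and \<beta>: "0 < \<beta>" and D: "0 < D" and \<kappa>: "0 < \<kappa>"
    and U: "\<And>n. n \<in> levels D \<Longrightarrow> set_pmf (U n) \<subseteq> carrier Aut_T"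
      "\<And>n g. n \<in> levels D \<Longrightarrow> \<kappa> * 2 powr (- real n * \<beta>) * pmf (U n) g \<le> pmf M g"
      "\<And>n y z. n \<in> levels D \<Longrightarrow> emeasure (measure_pmf (U n)) {h. act y h = z} \<le> ennreal ((1 / 2) ^ n)"
  obtains C where "C > 0" "\<And>t x y. pmf (ray_walk M t x) y \<le> C * (real t + 1) powr (- 1 / \<beta>)"
proof -
  define c where "c = \<kappa> / 2 * 2 powr (- real (D + 1) * \<beta>)"
  have c: "c > 0" using \<kappa> by (simp add: c_def)
  define u where "u x t = enn2real (collision (ray_walk M t x) (ray_walk M t x))" for x t
  have u: "collision (ray_walk M t x) (ray_walk M t x) = ennreal (u x t)" for x t
    unfolding u_def using collision_le_1[of "ray_walk M t x" "ray_walk M t x"]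
    by (metis ennreal_enn2real ennreal_one_less_top order_le_less_trans)
  have u_pos: "0 < u x t" for x t using collision_pos[of "ray_walk M t x"] unfolding u by simp
  have u_le: "u x t \<le> 1" for x t using collision_le_1[of "ray_walk M t x" "ray_walk M t x"] unfolding u by simp
  have step: "u x (Suc t) \<le> u x t - c * u x t powr \<beta> * u x t" for x t
  proof -
    let ?u = "u x t"
    define P where "P q \<longleftrightarrow> 1 \<le> q \<and> (1 / 2) ^ (D * q) \<le> ?u / 2" for q :: nat
    have "\<exists>q. P q"
    proof -
      obtain m where m: "(1 / 2 :: real) ^ m < ?u / 2"
        using real_arch_pow_inv[of "?u / 2" "1 / 2"] u_pos[of x t] by auto
      have "(1 / 2 :: real) ^ (D * Suc m) \<le> (1 / 2) ^ m"
      proof (rule power_decreasing)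
        have "1 * m \<le> D * Suc m" using D by (intro mult_mono) auto
        then show "m \<le> D * Suc m" by simp
      qed auto
      then have "(1 / 2 :: real) ^ (D * Suc m) \<le> ?u / 2" using m by linarith
      then have "P (Suc m)" unfolding P_def by simp
      then show ?thesis by blast
    qed
    then have Pq: "P (LEAST q. P q)" by (rule LeastI_ex)
    define q where "q = (LEAST q. P q)"
    have q: "1 \<le> q" "(1 / 2) ^ (D * q) \<le> ?u / 2" using Pq by (auto simp: P_def q_def)
    have low: "?u / 2 * (1 / 2) ^ D \<le> (1 / 2) ^ (D * q)"
    proof (cases "q = 1")
      case True
      then show ?thesis using u_le[of x t] by simp
    next
      case False
      then have "\<not> P (q - 1)" unfolding q_def using Pq
        by (metis P_def diff_less less_one not_less_Least order_less_le_trans zero_less_one)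
      then have "?u / 2 < (1 / 2) ^ (D * (q - 1))" using False q(1) by (auto simp: P_def)
      then have "?u / 2 * (1 / 2) ^ D \<le> (1 / 2) ^ (D * (q - 1)) * (1 / 2) ^ D"
        by (simp add: mult_right_mono)
      also have "\<dots> = (1 / 2) ^ (D * q)"
      proof -
        obtain r where "q = Suc r" using q(1) by (cases q) auto
        then show ?thesis by (simp add: power_add mult.commute)
      qed
      finally show ?thesis .
    qed
    let ?n = "D * q"
    have n: "?n \<in> levels D" using D q(1) by (simp add: levels_def)
    define e where "e = \<kappa> * 2 powr (- real ?n * \<beta>)"
    have e0: "0 \<le> e" using \<kappa> by (simp add: e_def)
    have "collision (ray_walk M (Suc t) x) (ray_walk M (Suc t) x) \<le> ennreal ((1 - e) * ?u + e * (1 / 2) ^ ?n)"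
      unfolding ray_walk_Suc_end
      by (rule collision_step[OF M(1) e0 _ U(1)[OF n] U(3)[OF n] u])
        (use U(2)[OF n] u_pos[of x t] in \<open>auto simp: e_def\<close>)
    moreover have "0 \<le> (1 - e) * ?u + e * (1 / 2) ^ ?n"
      using calculation u[of "Suc t" x] u_pos[of x "Suc t"]
      by (metis ennreal_less_zero_iff linorder_not_less ennreal_neg less_le_not_le order_le_less_trans)
    ultimately have "u x (Suc t) \<le> (1 - e) * ?u + e * (1 / 2) ^ ?n"
      unfolding u by (simp add: ennreal_le_iff)
    also have "\<dots> \<le> (1 - e) * ?u + e * (?u / 2)"
      using mult_left_mono[OF q(2) e0] by simp
    also have "\<dots> = ?u - e / 2 * ?u" by (simp add: algebra_simps)
    also have "\<dots> \<le> ?u - c * ?u powr \<beta> * ?u"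
    proof -
      have "c * ?u powr \<beta> = \<kappa> / 2 * (?u / 2 * (1 / 2) ^ D) powr \<beta>"
      proof -
        have "(?u / 2 * (1 / 2) ^ D) = ?u * 2 powr (- real (D + 1))"
        proof -
          have "(2::real) powr (- real (D + 1)) = 1 / 2 ^ (D + 1)"
            by (simp only: powr_minus powr_realpow zero_less_numeral divide_inverse mult_1)
          then show ?thesis by (simp add: power_one_over)
        qed
        then have "(?u / 2 * (1 / 2) ^ D) powr \<beta> = ?u powr \<beta> * 2 powr (- real (D + 1) * \<beta>)"
          using u_pos[of x t] by (simp add: powr_mult powr_powr)
        then show ?thesis by (simp add: c_def)
      qed
      also have "\<dots> \<le> \<kappa> / 2 * ((1 / 2) ^ ?n) powr \<beta>"
        using low \<kappa> \<beta> u_pos[of x t] by (intro mult_left_mono powr_mono2) auto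
      also have "((1 / 2) ^ ?n :: real) = 2 powr (- real ?n)"
        by (simp only: powr_minus powr_realpow zero_less_numeral power_inverse divide_inverse mult_1)
      also have "(2 powr (- real ?n)) powr \<beta> = 2 powr (- real ?n * \<beta>)" by (rule powr_powr)
      finally have "c * ?u powr \<beta> \<le> e / 2" by (simp add: e_def)
      then show ?thesis using u_pos[of x t] by (simp add: mult_right_mono)
    qed
    finally show ?thesis .
  qed
  define d where "d = min 1 (\<beta> * c)"
  have d: "d > 0" using \<beta> c by (simp add: d_def)
  have decay: "u x t \<le> (d * (real t + 1)) powr (- 1 / \<beta>)" for x t
    unfolding d_def by (rule recursion_decay[where u = "u x"]) (fact u_pos u_le \<beta> c step)+
  show ?thesis
  proof (rule that)
    show "(d / 2) powr (- 1 / \<beta>) > 0" using d by simp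
    fix t :: nat and x y :: "nat \<Rightarrow> bool"
    define s where "s = t div 2"
    let ?B = "(d / 2) powr (- 1 / \<beta>) * (real t + 1) powr (- 1 / \<beta>)"
    have bound: "u x r \<le> ?B" if "s \<le> r" for x r
    proof -
      have "t \<le> 2 * r + 1" using that unfolding s_def by presburger
      then have "real t \<le> real (2 * r + 1)" by (simp only: of_nat_le_iff)
      then have "real t + 1 \<le> 2 * (real r + 1)" by simp
      then have "d / 2 * (real t + 1) \<le> d * (real r + 1)"
        using mult_left_mono[of "real t + 1" "2 * (real r + 1)" "d / 2"] d by simp
      then have "(d * (real r + 1)) powr (- 1 / \<beta>) \<le> (d / 2 * (real t + 1)) powr (- 1 / \<beta>)"
        using d \<beta> by (intro powr_mono2') (auto simp: divide_nonpos_pos)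
      also have "\<dots> = ?B" using d by (simp only: powr_mult)
      finally show ?thesis using decay[of x r] by linarith
    qed
    have t: "t = s + (t - s)" "s \<le> t - s" by (auto simp: s_def)
    have "2 * ennreal (pmf (ray_walk M t x) y) \<le> ennreal (u x s) + ennreal (u y (t - s))"
      using ray_walk_le_collision[OF M, of s "t - s" x y] t(1) unfolding u by simp
    then have "ennreal (2 * pmf (ray_walk M t x) y) \<le> ennreal (u x s + u y (t - s))"
      using u_pos[of x s] u_pos[of y "t - s"]
      by (simp add: ennreal_mult' less_imp_le)
    then have "2 * pmf (ray_walk M t x) y \<le> u x s + u y (t - s)"
      using u_pos[of x s] u_pos[of y "t - s"] by (subst (asm) ennreal_le_iff) auto
    then show "pmf (ray_walk M t x) y \<le> ?B"
      using bound[of s x] bound[OF t(2), of y] by simp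
  qed
qed

section \<open>Occupation sums\<close>

text \<open>Compare with the telescoping sum of $t^{-p}$, whose increments are bounded below by \<open>one_minus_powr_ge\<close>.\<close>

lemma powr_telescope:
  assumes p: "0 < (p::real)" and m: "m \<ge> 1"
  shows "(\<Sum>t\<in>{m..<N}. (real t + 1) powr (- (p + 1))) \<le> (real m) powr (- p) / p"
proof -
  have one: "(real t + 1) powr (- (p + 1)) \<le> ((real t) powr (- p) - (real t + 1) powr (- p)) / p" if "t \<ge> 1" for t
  proof -
    let ?r = "real t + 1"
    have "1 + p * (1 / ?r) \<le> (1 - 1 / ?r) powr - p"
      by (rule one_minus_powr_ge) (use that p in auto)
    also have "1 - 1 / ?r = real t / ?r" by (simp add: field_simps)
    finally have "(1 + p * (1 / ?r)) * ?r powr (- p) \<le> (real t / ?r) powr - p * ?r powr (- p)"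
      by (intro mult_right_mono) auto
    also have "\<dots> = real t powr (- p)"
      using that by (simp add: powr_mult[symmetric])
    finally have "?r powr (- p) + p * (?r powr (- p) / ?r) \<le> real t powr (- p)"
      by (simp add: distrib_right)
    moreover have "?r powr (- p) / ?r = ?r powr (- (p + 1))"
      by (simp add: powr_diff powr_minus field_simps powr_add)
    ultimately have "p * ?r powr (- (p + 1)) \<le> real t powr (- p) - ?r powr (- p)" by simp
    then show ?thesis using p by (simp add: pos_le_divide_eq mult.commute)
  qed
  have "(\<Sum>t\<in>{m..<N}. (real t + 1) powr (- (p + 1))) \<le> (real m powr (- p) - real N powr (- p)) / p" if "m \<le> N" for N
    using that
  proof (induction N rule: dec_induct)
    case (step n)
    then show ?case using one[of n] m by (simp add: diff_divide_distrib add.commute)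
  qed (use p in simp)
  moreover have "(real m powr (- p) - real N powr (- p)) / p \<le> real m powr (- p) / p"
    using p by (simp add: divide_right_mono)
  ultimately show ?thesis
    by (cases "m \<le> N") (use p in \<open>auto intro: order_trans\<close>)
qed

text \<open>Up to time $(b/a)^{\beta}$ the first bound is used, afterwards the second; since $1/\beta > 1$ both
  parts have the order $a^{1-\beta}b^{\beta}$.\<close>

lemma occupation_sum:
  assumes \<beta>: "0 < \<beta>" "\<beta> < 1" and a: "0 < a" and b: "0 < (b::real)"
  shows "(\<Sum>t<N. min a (b * (real t + 1) powr (- 1 / \<beta>))) \<le> (2 + 1 / (1 / \<beta> - 1)) * (a powr (1 - \<beta>) * b powr \<beta>)"
proof -
  define p where "p = 1 / \<beta> - 1"
  have p: "p > 0" using \<beta> by (simp add: p_def)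
  define f where "f t = min a (b * (real t + 1) powr (- 1 / \<beta>))" for t
  define T where "T = (b / a) powr \<beta>"
  have T: "T > 0" using a b by (simp add: T_def)
  define m where "m = nat \<lfloor>T\<rfloor>"
  have m: "real m \<le> T" "T < real m + 1" using T by (auto simp: m_def)
  let ?Q = "a powr (1 - \<beta>) * b powr \<beta>"
  have aT: "a * T = ?Q"
    using a b by (simp add: T_def powr_divide powr_diff)
  have bT: "b * T powr (- p) = ?Q"
  proof -
    have "T powr (- p) = (b / a) powr (\<beta> - 1)"
      using \<beta> by (simp add: T_def powr_powr p_def algebra_simps)
    then show ?thesis using a b by (simp add: powr_divide powr_diff)
  qed
  have f0: "0 \<le> f t" for t using a b by (simp add: f_def)
  have fa: "f t \<le> a" for t by (simp add: f_def)
  have fb: "f t \<le> b * (real t + 1) powr (- (p + 1))" for t by (simp add: f_def p_def)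
  have fm: "f m \<le> ?Q"
  proof -
    have "(real m + 1) powr (- 1 / \<beta>) \<le> 1"
      using powr_mono[of "- 1 / \<beta>" 0 "real m + 1"] \<beta> by (simp add: divide_nonpos_pos)
    then have "f m \<le> b" unfolding f_def using b by (simp add: min_le_iff_disj mult_left_le)
    then have "f m powr (1 - \<beta>) * f m powr \<beta> \<le> ?Q"
      using fa[of m] f0[of m] \<beta> by (intro mult_mono powr_mono2) auto
    then show ?thesis using f0[of m] by (cases "f m = 0") (simp_all add: powr_add[symmetric])
  qed
  have "(\<Sum>t<N. f t) \<le> (\<Sum>t\<in>{..<m} \<union> ({m} \<union> {Suc m..<N}). f t)"
    by (rule sum_mono2) (use f0 in auto)
  also have "\<dots> = (\<Sum>t<m. f t) + (f m + (\<Sum>t\<in>{Suc m..<N}. f t))"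
    by (subst sum.union_disjoint) auto
  also have "\<dots> \<le> ?Q + (?Q + ?Q / p)"
  proof (intro add_mono fm)
    have "(\<Sum>t<m. f t) \<le> real m * a" using sum_bounded_above[of "{..<m}" f a] fa by simp
    also have "\<dots> \<le> a * T" using m a by (simp add: mult.commute)
    finally show "(\<Sum>t<m. f t) \<le> ?Q" using aT by simp
    have "(\<Sum>t\<in>{Suc m..<N}. f t) \<le> (\<Sum>t\<in>{Suc m..<N}. b * (real t + 1) powr (- (p + 1)))"
      by (intro sum_mono fb)
    also have "\<dots> = b * (\<Sum>t\<in>{Suc m..<N}. (real t + 1) powr (- (p + 1)))"
      by (simp add: sum_distrib_left)
    also have "\<dots> \<le> b * (real (Suc m) powr (- p) / p)"
      using b by (intro mult_left_mono powr_telescope p) auto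
    also have "\<dots> \<le> b * (T powr (- p) / p)"
      using b p m T by (intro mult_left_mono divide_right_mono powr_mono2') auto
    finally show "(\<Sum>t\<in>{Suc m..<N}. f t) \<le> ?Q / p" using bT by simp
  qed
  also have "\<dots> = (2 + 1 / p) * ?Q" by (simp add: algebra_simps)
  finally show ?thesis by (simp add: f_def p_def)
qed

text \<open>The Green function of the walk on rays, applied to $w$.\<close>

definition green :: "tree_map pmf \<Rightarrow> (nat \<Rightarrow> bool) \<Rightarrow> ((nat \<Rightarrow> bool) \<Rightarrow> ennreal) \<Rightarrow> ennreal" where
  "green M x w = (\<Sum>t. \<integral>\<^sup>+y. w y \<partial>measure_pmf (ray_walk M t x))"

lemma green_mono: "(\<And>y. w y \<le> w' y) \<Longrightarrow> green M x w \<le> green M x w'"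
  unfolding green_def by (intro suminf_le nn_integral_mono summableI)

lemma green_sum: "green M x (\<lambda>y. \<Sum>i\<in>I. w i y) = (\<Sum>i\<in>I. green M x (w i))"
  unfolding green_def by (simp add: nn_integral_sum suminf_sum)

lemma green_add: "green M x (\<lambda>y. w y + w' y) = green M x w + green M x w'"
  unfolding green_def by (simp add: nn_integral_add suminf_add[symmetric] summableI)

lemma green_nn_integral:
  "green M x (\<lambda>y. \<integral>\<^sup>+n. w n y \<partial>measure_pmf N) = (\<integral>\<^sup>+n. green M x (w n) \<partial>measure_pmf N)"
  unfolding green_def by (simp add: nn_integral_pmf_swap[where q = N] nn_integral_suminf)

lemma green_bound:
  assumes \<beta>: "0 < \<beta>" "\<beta> < 1" and C: "0 < C" "\<And>t y. pmf (ray_walk M t x) y \<le> C * (real t + 1) powr (- 1 / \<beta>)"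
    and w: "\<And>y. w y \<le> ennreal a" "mass w \<le> ennreal b" and ab: "0 < a" "0 < b"
  shows "green M x w \<le> ennreal ((2 + 1 / (1 / \<beta> - 1)) * C powr \<beta> * (a powr (1 - \<beta>) * b powr \<beta>))"
  unfolding green_def
proof (rule suminf_le_const[OF summableI])
  fix N
  have "(\<integral>\<^sup>+y. w y \<partial>measure_pmf (ray_walk M t x)) \<le> ennreal (min a (b * C * (real t + 1) powr (- 1 / \<beta>)))" for t
  proof -
    have "(\<integral>\<^sup>+y. w y \<partial>measure_pmf (ray_walk M t x)) \<le> (\<integral>\<^sup>+y. ennreal a \<partial>measure_pmf (ray_walk M t x))"
      by (intro nn_integral_mono w)
    then have 1: "(\<integral>\<^sup>+y. w y \<partial>measure_pmf (ray_walk M t x)) \<le> ennreal a" by simp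
    have "(\<integral>\<^sup>+y. w y \<partial>measure_pmf (ray_walk M t x)) = (\<integral>\<^sup>+y. ennreal (pmf (ray_walk M t x) y) * w y \<partial>count_space UNIV)"
      by (rule nn_integral_measure_pmf)
    also have "\<dots> \<le> (\<integral>\<^sup>+y. ennreal (C * (real t + 1) powr (- 1 / \<beta>)) * w y \<partial>count_space UNIV)"
      by (intro nn_integral_mono mult_right_mono ennreal_leI C) auto
    also have "\<dots> = ennreal (C * (real t + 1) powr (- 1 / \<beta>)) * mass w"
      by (rule nn_integral_cmult) auto
    also have "\<dots> \<le> ennreal (C * (real t + 1) powr (- 1 / \<beta>)) * ennreal b"
      by (intro mult_left_mono w) auto
    also have "\<dots> = ennreal (b * C * (real t + 1) powr (- 1 / \<beta>))"
      using C ab by (simp add: ennreal_mult[symmetric] mult_ac)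
    finally show ?thesis using 1 by (simp add: min_def)
  qed
  then have "(\<Sum>t<N. \<integral>\<^sup>+y. w y \<partial>measure_pmf (ray_walk M t x)) \<le> (\<Sum>t<N. ennreal (min a (b * C * (real t + 1) powr (- 1 / \<beta>))))"
    by (rule sum_mono)
  also have "\<dots> = ennreal (\<Sum>t<N. min a (b * C * (real t + 1) powr (- 1 / \<beta>)))"
    using ab C by (intro sum_ennreal) auto
  also have "\<dots> \<le> ennreal ((2 + 1 / (1 / \<beta> - 1)) * (a powr (1 - \<beta>) * (b * C) powr \<beta>))"
    by (intro ennreal_leI occupation_sum) (use \<beta> ab C in auto)
  also have "\<dots> = ennreal ((2 + 1 / (1 / \<beta> - 1)) * C powr \<beta> * (a powr (1 - \<beta>) * b powr \<beta>))"
    using ab C by (simp add: powr_mult mult_ac)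
  finally show "(\<Sum>t<N. \<integral>\<^sup>+y. w y \<partial>measure_pmf (ray_walk M t x)) \<le> \<dots>" .
qed

section \<open>Products of independent factors\<close>

text \<open>The law of $g_n\cdots g_1$ with independent factors. The factor with the largest index acts first on rays.\<close>

primrec product_law :: "(nat \<Rightarrow> tree_map pmf) \<Rightarrow> nat \<Rightarrow> tree_map pmf" where
  "product_law Q 0 = return_pmf id"
| "product_law Q (Suc n) = bind_pmf (Q (Suc n)) (\<lambda>g. map_pmf (\<lambda>h. g \<cdot> h) (product_law Q n))"

lemma product_law_Pi_pmf:
  "map_pmf (\<lambda>x. prod_T (map (\<lambda>i. F (x i)) (rev [1..<Suc n]))) (Pi_pmf {1..n} dflt P)
    = product_law (\<lambda>i. map_pmf F (P i)) n"
proof (induction n)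
  case 0
  then show ?case by (simp add: id_def)
next
  case (Suc n)
  define R where "R f = prod_T (map (\<lambda>i. F (f i)) (rev [1..<Suc n]))" for f
  have R: "prod_T (map (\<lambda>i. F ((f(Suc n := y)) i)) (rev [1..<Suc (Suc n)])) = F y \<cdot> R f" for f y
  proof -
    have "map (\<lambda>i. F ((f(Suc n := y)) i)) (rev [1..<Suc n]) = map (\<lambda>i. F (f i)) (rev [1..<Suc n])"
      by (rule map_cong) auto
    moreover have "rev [1..<Suc (Suc n)] = Suc n # rev [1..<Suc n]" by simp
    ultimately show ?thesis by (simp only: R_def list.map foldr.simps comp_apply fun_upd_same)
  qed
  have ins: "{1..Suc n} = insert (Suc n) {1..n}" by auto
  have "map_pmf (\<lambda>x. prod_T (map (\<lambda>i. F (x i)) (rev [1..<Suc (Suc n)]))) (Pi_pmf {1..Suc n} dflt P)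
      = map_pmf (\<lambda>(y, f). F y \<cdot> R f) (pair_pmf (P (Suc n)) (Pi_pmf {1..n} dflt P))"
    unfolding ins by (subst Pi_pmf_insert) (simp_all only: finite_atLeastAtMost map_pmf_comp case_prod_unfold R, simp)
  also have "\<dots> = bind_pmf (map_pmf F (P (Suc n))) (\<lambda>g. map_pmf (\<lambda>h. g \<cdot> h) (map_pmf R (Pi_pmf {1..n} dflt P)))"
    by (simp add: map_pmf_def pair_pmf_def bind_assoc_pmf bind_return_pmf)
  also have "map_pmf R (Pi_pmf {1..n} dflt P) = product_law (\<lambda>i. map_pmf F (P i)) n"
    unfolding R_def by (rule Suc.IH)
  finally show ?case by simp
qed

lemma product_law_in:
  assumes "id \<in> G" "\<And>g h. g \<in> G \<Longrightarrow> h \<in> G \<Longrightarrow> g \<cdot> h \<in> G"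
    and "\<And>i. i \<in> {1..n} \<Longrightarrow> set_pmf (Q i) \<subseteq> G"
  shows "set_pmf (product_law Q n) \<subseteq> G"
  using assms(3)
proof (induction n)
  case (Suc n)
  then have "set_pmf (Q (Suc n)) \<subseteq> G" "set_pmf (product_law Q n) \<subseteq> G" by auto
  then show ?case using assms(2) by auto
qed (use assms in simp)

lemma product_law_Grig:
  "(\<And>i. i \<in> {1..n} \<Longrightarrow> set_pmf (Q i) \<subseteq> Grig \<omega>) \<Longrightarrow> set_pmf (product_law Q n) \<subseteq> Grig \<omega>"
  by (rule product_law_in) auto

lemma nn_integral_act: "g \<in> carrier Aut_T \<Longrightarrow> mass (\<lambda>y. w (act y g)) = mass w"
  using nn_integral_bij_count_space[OF bij_act] by simp

text \<open>The germ of a product is nontrivial only if that of some factor is. The bound is stated for a property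
  \<open>P\<close> of a group element and a ray which a product inherits from a factor at a translated ray; both the
  germ of $g$ and the germ of $g^{-1}$ have this form. Averages over translates keep the pointwise bound
  and the total mass of the contribution of each factor.\<close>

lemma product_bound:
  assumes st: "\<And>g. g \<in> Grig \<omega> \<Longrightarrow> s g \<in> carrier Aut_T" "\<And>g. g \<in> Grig \<omega> \<Longrightarrow> t g \<in> carrier Aut_T"
    and triv: "\<And>y. \<not> P id y"
    and inherit: "\<And>g h y. g \<in> Grig \<omega> \<Longrightarrow> h \<in> Grig \<omega> \<Longrightarrow> P (g \<cdot> h) y \<Longrightarrow> P g (act y (s h)) \<or> P h (act y (t g))"
    and "\<And>i. i \<in> {1..n} \<Longrightarrow> set_pmf (Q i) \<subseteq> Grig \<omega>"
    and "\<And>i y. i \<in> {1..n} \<Longrightarrow> rate P (Q i) y \<le> a i"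
    and "\<And>i. i \<in> {1..n} \<Longrightarrow> mass (rate P (Q i)) \<le> b i"
  shows "\<exists>w. (\<forall>i\<in>{1..n}. (\<forall>y. w i y \<le> a i) \<and> mass (w i) \<le> b i) \<and>
    (\<forall>y. rate P (product_law Q n) y \<le> (\<Sum>i\<in>{1..n}. w i y))"
  using assms(5-)
proof (induction n)
  case 0
  then show ?case using triv by simp
next
  case (Suc n)
  let ?Q = "Q (Suc n)" and ?P = "product_law Q n"
  have "\<exists>w. (\<forall>i\<in>{1..n}. (\<forall>y. w i y \<le> a i) \<and> mass (w i) \<le> b i) \<and>
      (\<forall>y. rate P ?P y \<le> (\<Sum>i\<in>{1..n}. w i y))"
    by (rule Suc.IH) (use Suc.prems in auto)
  then obtain w where w: "\<And>i y. i \<in> {1..n} \<Longrightarrow> w i y \<le> a i" "\<And>i. i \<in> {1..n} \<Longrightarrow> mass (w i) \<le> b i"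
    "\<And>y. rate P ?P y \<le> (\<Sum>i\<in>{1..n}. w i y)"
    by blast
  have Q: "set_pmf ?Q \<subseteq> Grig \<omega>" using Suc.prems(1) by simp
  have P: "set_pmf ?P \<subseteq> Grig \<omega>" by (rule product_law_Grig) (use Suc.prems(1) in auto)
  define w' where "w' i y = (if i = Suc n then (\<integral>\<^sup>+h. rate P ?Q (act y (s h)) \<partial>measure_pmf ?P)
      else (\<integral>\<^sup>+g. w i (act y (t g)) \<partial>measure_pmf ?Q))" for i y
  have 1: "w' i y \<le> a i" if "i \<in> {1..Suc n}" for i y
  proof (cases "i = Suc n")
    case True
    have "(\<integral>\<^sup>+h. rate P ?Q (act y (s h)) \<partial>measure_pmf ?P) \<le> (\<integral>\<^sup>+h. a i \<partial>measure_pmf ?P)"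
      using True Suc.prems(2) by (intro nn_integral_mono) auto
    then show ?thesis using True by (simp add: w'_def)
  next
    case False
    then have "(\<integral>\<^sup>+g. w i (act y (t g)) \<partial>measure_pmf ?Q) \<le> (\<integral>\<^sup>+g. a i \<partial>measure_pmf ?Q)"
      using that by (intro nn_integral_mono w) auto
    then show ?thesis using False by (simp add: w'_def)
  qed
  have 2: "mass (w' i) \<le> b i" if "i \<in> {1..Suc n}" for i
  proof (cases "i = Suc n")
    case True
    then have "mass (w' i) = (\<integral>\<^sup>+h. mass (\<lambda>y. rate P ?Q (act y (s h))) \<partial>measure_pmf ?P)"
      by (simp add: w'_def nn_integral_pmf_count_space_swap)
    also have "\<dots> = (\<integral>\<^sup>+h. mass (rate P ?Q) \<partial>measure_pmf ?P)"
      by (rule nn_integral_cong_AE) (use P in \<open>auto simp: AE_measure_pmf_iff intro!: nn_integral_act st\<close>)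
    also have "\<dots> \<le> b i" using True Suc.prems(3) by simp
    finally show ?thesis .
  next
    case False
    then have "mass (w' i) = (\<integral>\<^sup>+g. mass (\<lambda>y. w i (act y (t g))) \<partial>measure_pmf ?Q)"
      by (simp add: w'_def nn_integral_pmf_count_space_swap)
    also have "\<dots> = (\<integral>\<^sup>+g. mass (w i) \<partial>measure_pmf ?Q)"
      by (rule nn_integral_cong_AE) (use Q in \<open>auto simp: AE_measure_pmf_iff intro!: nn_integral_act st\<close>)
    also have "\<dots> \<le> b i" using w(2)[of i] that False by simp
    finally show ?thesis .
  qed
  have 3: "rate P (product_law Q (Suc n)) y \<le> (\<Sum>i\<in>{1..Suc n}. w' i y)" for y
  proof -
    let ?A = "\<lambda>g h. indicator {g. P g (act y (s h))} g :: ennreal"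
      and ?B = "\<lambda>g h. indicator {h. P h (act y (t g))} h :: ennreal"
    have "rate P (product_law Q (Suc n)) y
        = (\<integral>\<^sup>+g. \<integral>\<^sup>+h. indicator {k. P k y} (g \<cdot> h) \<partial>measure_pmf ?P \<partial>measure_pmf ?Q)"
      by (simp add: vimage_def nn_integral_indicator[symmetric] indicator_def del: nn_integral_indicator)
    also have "\<dots> \<le> (\<integral>\<^sup>+g. \<integral>\<^sup>+h. ?A g h + ?B g h \<partial>measure_pmf ?P \<partial>measure_pmf ?Q)"
    proof (rule nn_integral_mono_AE, unfold AE_measure_pmf_iff, intro ballI)
      fix g assume "g \<in> set_pmf ?Q"
      then have g: "g \<in> Grig \<omega>" using Q by auto
      show "(\<integral>\<^sup>+h. indicator {k. P k y} (g \<cdot> h) \<partial>measure_pmf ?P) \<le> (\<integral>\<^sup>+h. ?A g h + ?B g h \<partial>measure_pmf ?P)"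
      proof (rule nn_integral_mono_AE, unfold AE_measure_pmf_iff, intro ballI)
        fix h assume "h \<in> set_pmf ?P"
        then have "h \<in> Grig \<omega>" using P by auto
        from inherit[OF g this, of y]
        show "(indicator {k. P k y} (g \<cdot> h) :: ennreal) \<le> ?A g h + ?B g h"
          by (auto simp: indicator_def)
      qed
    qed
    also have "\<dots> = (\<integral>\<^sup>+g. \<integral>\<^sup>+h. ?A g h \<partial>measure_pmf ?P \<partial>measure_pmf ?Q)
        + (\<integral>\<^sup>+g. rate P ?P (act y (t g)) \<partial>measure_pmf ?Q)"
      by (simp add: nn_integral_add)
    also have "(\<integral>\<^sup>+g. \<integral>\<^sup>+h. ?A g h \<partial>measure_pmf ?P \<partial>measure_pmf ?Q) = w' (Suc n) y"
      by (subst nn_integral_pmf_swap) (simp add: w'_def)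
    also have "(\<integral>\<^sup>+g. rate P ?P (act y (t g)) \<partial>measure_pmf ?Q)
        \<le> (\<integral>\<^sup>+g. (\<Sum>i\<in>{1..n}. w i (act y (t g))) \<partial>measure_pmf ?Q)"
      by (intro nn_integral_mono w(3))
    also have "\<dots> = (\<Sum>i\<in>{1..n}. w' i y)"
      by (simp add: nn_integral_sum w'_def)
    also have "w' (Suc n) y + \<dots> = (\<Sum>i\<in>{1..Suc n}. w' i y)" by (simp add: add.commute)
    finally show ?thesis by (simp add: add_left_mono)
  qed
  show ?case using 1 2 3 by blast
qed

definition coin :: "tree_map pmf \<Rightarrow> tree_map pmf" where
  "coin F = map_pmf (\<lambda>(\<epsilon>, \<gamma>). \<gamma> [^]\<^bsub>Aut_T\<^esub> \<epsilon>) (pair_pmf (pmf_of_set {0, 1 :: nat}) F)"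

lemma pow_T: "g [^]\<^bsub>Aut_T\<^esub> (0::nat) = id" "g [^]\<^bsub>Aut_T\<^esub> (1::nat) = g"
proof -
  interpret T: group Aut_T by (rule group_Aut_T)
  show "g [^]\<^bsub>Aut_T\<^esub> (0::nat) = id" by (simp add: T.nat_pow_0 id_def)
  show "g [^]\<^bsub>Aut_T\<^esub> (1::nat) = g"
    using monoid.nat_pow_Suc[OF T.is_monoid, of g 0] by (simp add: T.nat_pow_0)
qed

lemma nn_integral_coin: "(\<integral>\<^sup>+g. f g \<partial>measure_pmf (coin F)) = (f id + (\<integral>\<^sup>+g. f g \<partial>measure_pmf F)) / 2"
proof -
  have "(\<integral>\<^sup>+g. f g \<partial>measure_pmf (coin F))
     = (\<integral>\<^sup>+\<epsilon>. \<integral>\<^sup>+g. f (g [^]\<^bsub>Aut_T\<^esub> \<epsilon>) \<partial>measure_pmf F \<partial>measure_pmf (pmf_of_set {0, 1 :: nat}))"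
    by (simp add: coin_def nn_integral_pair_pmf' case_prod_beta)
  also have "\<dots> = ((\<integral>\<^sup>+g. f (g [^]\<^bsub>Aut_T\<^esub> (0::nat)) \<partial>measure_pmf F) + (\<integral>\<^sup>+g. f (g [^]\<^bsub>Aut_T\<^esub> (1::nat)) \<partial>measure_pmf F)) / 2"
    by (subst nn_integral_pmf_of_set) auto
  finally show ?thesis by (simp only: pow_T) simp
qed

lemma set_coin: "set_pmf (coin F) \<subseteq> insert id (set_pmf F)"
proof
  fix g assume "g \<in> set_pmf (coin F)"
  then obtain \<epsilon> :: nat and h where g: "g = h [^]\<^bsub>Aut_T\<^esub> \<epsilon>" "\<epsilon> \<in> set_pmf (pmf_of_set {0, 1})" "h \<in> set_pmf F"
    by (auto simp: coin_def)
  then have "\<epsilon> = 0 \<or> \<epsilon> = 1" by simp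
  then show "g \<in> insert id (set_pmf F)"
    using g pow_T[of h] by (elim disjE) (simp_all only: insert_iff simp_thms)
qed

lemma emeasure_coin_le:
  assumes "\<not> P id"
  shows "emeasure (measure_pmf (coin F)) {g. P g} \<le> emeasure (measure_pmf F) {g. P g}"
proof -
  have "emeasure (measure_pmf (coin F)) {g. P g} = (\<integral>\<^sup>+g. indicator {g. P g} g \<partial>measure_pmf (coin F))"
    by simp
  also have "\<dots> = (0 + emeasure (measure_pmf F) {g. P g}) / 2"
    using assms by (simp only: nn_integral_coin) (simp add: id_def)
  also have "\<dots> \<le> emeasure (measure_pmf F) {g. P g}"
    by (simp add: divide_le_posI_ennreal mult_2)
  finally show ?thesis .
qed

lemma half_power_ennreal: "(1 / 2 ^ n :: ennreal) = ennreal ((1 / 2) ^ n)"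
  by (simp add: power_one_over divide_ennreal[symmetric] ennreal_power[symmetric])

text \<open>The factor with index $n$ doubles any set of points that agree up to position $n$, and the doubled
  points still agree up to position $n - 1$. Averaging over the exponent gives half of the sum over the doubled set, so
  every factor contributes $1/2$.\<close>

lemma cube_independence_aux:
  assumes "\<And>i. i \<in> {1..n} \<Longrightarrow> set_pmf (F i) \<subseteq> {g \<in> carrier Aut_T. swaps i g}"
    and "finite Y" "\<And>x y i. x \<in> Y \<Longrightarrow> y \<in> Y \<Longrightarrow> i \<le> n \<Longrightarrow> x i = y i"
  shows "(\<Sum>y\<in>Y. emeasure (measure_pmf (product_law (\<lambda>i. coin (F i)) n)) {h. act y h = z}) \<le> 1 / 2 ^ n"
  using assms
proof (induction n arbitrary: Y)
  case 0
  have "(\<Sum>y\<in>Y. emeasure (measure_pmf (product_law (\<lambda>i. coin (F i)) 0)) {h. act y h = z}) = (\<Sum>y\<in>Y. if y = z then 1 else 0)"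
    by (intro sum.cong) (auto simp: indicator_def)
  also have "\<dots> \<le> 1" using 0(2) by simp
  finally show ?case by simp
next
  case (Suc n)
  let ?P = "product_law (\<lambda>i. coin (F i)) n" and ?F = "F (Suc n)"
  define B where "B y = emeasure (measure_pmf ?P) {h. act y h = z}" for y
  have F: "set_pmf ?F \<subseteq> {g \<in> carrier Aut_T. swaps (Suc n) g}" using Suc.prems(1) by simp
  have P: "set_pmf ?P \<subseteq> carrier Aut_T"
  proof (rule product_law_in)
    fix i assume "i \<in> {1..n}"
    then have "set_pmf (F i) \<subseteq> carrier Aut_T" using Suc.prems(1)[of i] by auto
    then show "set_pmf (coin (F i)) \<subseteq> carrier Aut_T" using set_coin[of "F i"] id_in_Aut_T(1) by blast
  qed simp_all
  have e: "emeasure (measure_pmf (product_law (\<lambda>i. coin (F i)) (Suc n))) {h. act y h = z}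
      = (B y + (\<integral>\<^sup>+g. B (act y g) \<partial>measure_pmf ?F)) / 2" for y
  proof -
    have "emeasure (measure_pmf (product_law (\<lambda>i. coin (F i)) (Suc n))) {h. act y h = z}
      = (\<integral>\<^sup>+g. emeasure (measure_pmf ?P) {h. act y (g \<cdot> h) = z} \<partial>measure_pmf (coin ?F))"
      by (simp add: vimage_def)
    also have "\<dots> = (\<integral>\<^sup>+g. B (act y g) \<partial>measure_pmf (coin ?F))"
    proof (rule nn_integral_cong_AE, unfold AE_measure_pmf_iff, intro ballI)
      fix g assume "g \<in> set_pmf (coin ?F)"
      then have g: "g \<in> carrier Aut_T" using F subsetD[OF set_coin] by fastforce
      show "emeasure (measure_pmf ?P) {h. act y (g \<cdot> h) = z} = B (act y g)"
        unfolding B_def using P act_mult[OF g]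
        by (intro emeasure_eq_AE) (auto simp: AE_measure_pmf_iff subset_eq)
    qed
    also have "\<dots> = (B y + (\<integral>\<^sup>+g. B (act y g) \<partial>measure_pmf ?F)) / 2"
      by (simp only: nn_integral_coin act_id)
    finally show ?thesis .
  qed
  have "(\<Sum>y\<in>Y. emeasure (measure_pmf (product_law (\<lambda>i. coin (F i)) (Suc n))) {h. act y h = z})
     = (\<Sum>y\<in>Y. B y + (\<integral>\<^sup>+g. B (act y g) \<partial>measure_pmf ?F)) / 2"
    unfolding e divide_ennreal_def by (rule sum_distrib_right[symmetric])
  also have "(\<Sum>y\<in>Y. B y + (\<integral>\<^sup>+g. B (act y g) \<partial>measure_pmf ?F))
     = (\<integral>\<^sup>+g. (\<Sum>y\<in>Y. B y) + (\<Sum>y\<in>Y. B (act y g)) \<partial>measure_pmf ?F)"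
    by (simp add: sum.distrib nn_integral_add nn_integral_sum)
  also have "\<dots> \<le> (\<integral>\<^sup>+g. 1 / 2 ^ n \<partial>measure_pmf ?F)"
  proof (rule nn_integral_mono_AE, unfold AE_measure_pmf_iff, intro ballI)
    fix g assume "g \<in> set_pmf ?F"
    then have g: "g \<in> carrier Aut_T" "swaps (Suc n) g" using F by auto
    have fix_low: "act y g i = y i" if "i \<le> n" for y i using g(2) that by (auto simp: swaps_def)
    have flip_top: "act y g (Suc n) = (\<not> y (Suc n))" for y using g(2) by (auto simp: swaps_def)
    have inj: "inj_on (\<lambda>y. act y g) Y"
      using bij_act[OF g(1)] by (meson bij_is_inj inj_on_subset subset_UNIV)
    have disj: "Y \<inter> (\<lambda>y. act y g) ` Y = {}"
    proof -
      have "x \<noteq> act y g" if "x \<in> Y" "y \<in> Y" for x y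
        using Suc.prems(3)[OF that, of "Suc n"] flip_top[of y] by auto
      then show ?thesis by blast
    qed
    have "(\<Sum>y\<in>Y. B y) + (\<Sum>y\<in>Y. B (act y g)) = (\<Sum>y\<in>Y \<union> (\<lambda>y. act y g) ` Y. B y)"
      using Suc.prems(2) disj inj by (simp add: sum.union_disjoint sum.reindex)
    also have "\<dots> \<le> 1 / 2 ^ n" unfolding B_def
    proof (rule Suc.IH)
      fix x y i assume "x \<in> Y \<union> (\<lambda>y. act y g) ` Y" "y \<in> Y \<union> (\<lambda>y. act y g) ` Y" "i \<le> n"
      then show "x i = y i" using Suc.prems(3)[of _ _ i] fix_low by auto
    qed (use Suc.prems in auto)
    finally show "(\<Sum>y\<in>Y. B y) + (\<Sum>y\<in>Y. B (act y g)) \<le> 1 / 2 ^ n" .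
  qed
  also have "\<dots> = 1 / 2 ^ n" by simp
  finally have "(\<Sum>y\<in>Y. emeasure (measure_pmf (product_law (\<lambda>i. coin (F i)) (Suc n))) {h. act y h = z}) \<le> 1 / 2 ^ n / 2"
    by (simp add: divide_right_mono_ennreal)
  also have "(1 / 2 ^ n / 2 :: ennreal) = 1 / 2 ^ Suc n"
    using divide_ennreal[of "(1 / 2) ^ n" 2] unfolding half_power_ennreal by simp
  finally show ?case .
qed

lemma cube_independence:
  assumes "\<And>i. i \<in> {1..n} \<Longrightarrow> set_pmf (F i) \<subseteq> {g \<in> carrier Aut_T. swaps i g}"
  shows "emeasure (measure_pmf (product_law (\<lambda>i. coin (F i)) n)) {h. act y h = z} \<le> ennreal ((1 / 2) ^ n)"
proof -
  have "emeasure (measure_pmf (product_law (\<lambda>i. coin (F i)) n)) {h. act y h = z} \<le> 1 / 2 ^ n"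
    using cube_independence_aux[of n F "{y}" z, OF assms] by simp
  also note half_power_ennreal
  finally show ?thesis .
qed

lemma upsilon_product_law: "upsilon D \<omega> k n = product_law (\<lambda>i. coin (F_pmf D \<omega> k i n)) n"
  unfolding upsilon_def coin_def by (rule product_law_Pi_pmf)

section \<open>The index sets\<close>

definition V_far :: "nat \<Rightarrow> (nat \<Rightarrow> letter) \<Rightarrow> nat \<Rightarrow> nat \<Rightarrow> nat \<Rightarrow> vertex set" where
  "V_far D \<omega> k j n = {v \<in> V_set D \<omega> (2 * k) j. length (takeWhile id v) \<ge> n - j + D}"

lemma mk_props:
  assumes "Fr D \<omega>"
  shows "mk D \<omega> q + 3 \<le> D" "marked \<omega> (q * D + mk D \<omega> q)"
proof -
  have "\<exists>m. m + 3 \<le> D \<and> marked \<omega> (q * D + m)" using assms by (auto simp: Fr_def)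
  from LeastI_ex[OF this] show "mk D \<omega> q + 3 \<le> D" "marked \<omega> (q * D + mk D \<omega> q)"
    by (auto simp: mk_def)
qed

lemma V_set_length:
  "v \<in> V_set D \<omega> k j \<Longrightarrow> length v = D - j mod D + k + mk D \<omega> ((j + D - j mod D + k) div D) + 3"
  by (auto simp: V_set_def W_set_def)

text \<open>All zeros of $v$ are at positions of \<open>I_set\<close>: those in the middle part by definition of \<open>W_set\<close>, and the last
  one because the final run of ones has length $m_\ell+2$.\<close>

lemma V_set_admissible:
  assumes Fr: "Fr D \<omega>" and k: "D dvd k" and v: "v \<in> V_set D \<omega> k j"
  shows "admissible \<omega> j v"
proof -
  have D: "0 < D" using Fr_D[OF Fr] by simp
  define s where "s = D - j mod D"
  define L where "L = (j + D - j mod D + k) div D"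
  have sJ: "j + D - j mod D = j + s" using D by (simp add: s_def)
  have s1: "1 \<le> s" using D by (simp add: s_def Suc_le_eq)
  have "D dvd j + s"
  proof -
    have "j mod D < D" using D by simp
    then have "j + s = j div D * D + D" using div_mult_mod_eq[of j D] unfolding s_def by linarith
    then show ?thesis by simp
  qed
  then obtain J where J: "j + s = J * D" by (metis dvd_div_mult_self)
  have "D dvd j + s + k" using k \<open>D dvd j + s\<close> by simp
  then have LD: "L * D = j + s + k" unfolding L_def sJ by (rule dvd_div_mult_self)
  obtain u where u: "v = replicate s True @ u @ replicate (mk D \<omega> L + 2) True @ [False]"
    "u \<in> W_set D \<omega> k (j + s)"
    using v by (auto simp: V_set_def s_def L_def sJ[unfolded s_def])
  have lu: "length u = k" using u(2) by (simp add: W_set_def)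
  show ?thesis unfolding admissible_def
  proof (intro allI impI)
    fix i assume i: "i < length v" "\<not> v ! i"
    have le: "s \<le> i" using i(2) unfolding u(1) by (metis in_set_replicate length_replicate linorder_not_less nth_append nth_mem)
    have vi: "v ! i = (u @ replicate (mk D \<omega> L + 2) True @ [False]) ! (i - s)"
      using le unfolding u(1) by (simp add: nth_append)
    show "2 \<le> i \<and> marked \<omega> (j + i - 2)"
    proof (cases "i - s < k")
      case True
      define p where "p = i - s + 1"
      have p: "p \<in> {1..k}" using True by (auto simp: p_def)
      have "\<not> u ! (p - 1)" using i(2) vi True lu by (simp add: nth_append p_def)
      then have "j + s + p \<in> I_set D \<omega>" using u(2) p by (auto simp: W_set_def)
      then obtain q where q: "j + s + p = q * D + mk D \<omega> q + 3" by (auto simp: I_set_def)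
      have "J \<le> q"
      proof (rule ccontr)
        assume "\<not> J \<le> q"
        then have "Suc q * D \<le> J * D" by (intro mult_le_mono1) simp
        then have "q * D + D \<le> j + s" using J by simp
        then show False using q mk_props(1)[OF Fr, of q] p by simp
      qed
      then have "J * D \<le> q * D" by (rule mult_le_mono1)
      then have "3 \<le> p" using q J by linarith
      moreover have "j + i - 2 = q * D + mk D \<omega> q" using q le by (simp add: p_def)
      ultimately show ?thesis using mk_props(2)[OF Fr, of q] s1 by (simp add: p_def)
    next
      case False
      have "i - s - k = mk D \<omega> L + 2"
      proof (rule ccontr)
        assume ne: "i - s - k \<noteq> mk D \<omega> L + 2"
        have "i - s - k < mk D \<omega> L + 3" using i(1) lu le False unfolding u(1) by simp
        then have lt: "i - s - k < mk D \<omega> L + 2" using ne by simp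
        have "v ! i = (replicate (mk D \<omega> L + 2) True @ [False]) ! (i - s - k)"
          using vi False lu by (simp add: nth_append)
        also have "\<dots> = True" using lt nth_replicate[OF lt, of True] by (simp only: nth_append length_replicate if_True)
        finally show False using i(2) by simp
      qed
      then have "j + i - 2 = L * D + mk D \<omega> L" "2 \<le> i" using LD le False by simp_all
      then show ?thesis using mk_props(2)[OF Fr, of L] by simp
    qed
  qed
qed

lemma finite_V_far: "finite (V_far D \<omega> k j n)"
proof (rule finite_subset)
  show "V_far D \<omega> k j n \<subseteq> {v. length v = D - j mod D + 2 * k + mk D \<omega> ((j + D - j mod D + 2 * k) div D) + 3}"
    using V_set_length by (auto simp: V_far_def)
qed (rule finite_level)

lemma length_takeWhile_ge:
  assumes "\<And>i. i < N \<Longrightarrow> v ! i" "N \<le> length v"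
  shows "N \<le> length (takeWhile id v)"
proof (rule ccontr)
  assume "\<not> N \<le> length (takeWhile id v)"
  then have l: "length (takeWhile id v) < N" by simp
  then have "length (takeWhile id v) < length v" using assms(2) by linarith
  then have "\<not> id (v ! length (takeWhile id v))" by (rule nth_length_takeWhile)
  then show False using assms(1)[OF l] by simp
qed

text \<open>Each of the $2k/D$ blocks offers one position for a zero; the requirement of a long prefix of
  ones blocks the first $(n - j + \bar j)/D$ of them.\<close>

lemma card_V_far:
  assumes Fr: "Fr D \<omega>" and k: "D dvd k" and n: "D dvd n" and j: "j \<le> n" "n < j + k"
  shows "2 ^ (2 * k div D - (n - j + j mod D) div D) \<le> card (V_far D \<omega> k j n)"
proof -
  have D: "3 \<le> D" by (rule Fr_D[OF Fr])
  define s where "s = D - j mod D"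
  define L where "L = (j + D - j mod D + 2 * k) div D"
  define q0 where "q0 = (n - j + j mod D) div D"
  define J where "J = j div D + 1"
  have jm: "j mod D < D" using D by simp
  have sJ: "j + D - j mod D = j + s" using jm by (simp add: s_def)
  have J: "j + s = J * D"
  proof -
    have "j + s = j div D * D + D" using jm div_mult_mod_eq[of j D] unfolding s_def by linarith
    then show ?thesis by (simp add: J_def)
  qed
  have kD: "k = k div D * D" using k by simp
  have q0D: "q0 * D = n - j + j mod D"
  proof -
    have "D dvd n - (j - j mod D)" by (rule dvd_diff_nat[OF n]) (simp add: minus_mod_eq_mult_div)
    moreover have "n - (j - j mod D) = n - j + j mod D" using j by simp
    ultimately show ?thesis by (simp add: q0_def)
  qed
  define z where "z l = l * D + mk D \<omega> (J + l) + 2" for l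
  have zl: "l * D < z l" "z l < Suc l * D" for l
    using mk_props(1)[OF Fr, of "J + l"] by (auto simp: z_def)
  have z_inj: "z l = z l' \<Longrightarrow> l = l'" for l l'
  proof -
    have "z l div D = l" for l
      using zl[of l] D by (intro div_nat_eqI) (auto simp: mult.commute)
    then show "z l = z l' \<Longrightarrow> l = l'" by metis
  qed
  define vT where "vT T = replicate s True @ map (\<lambda>p. \<not> (\<exists>l\<in>T. p = z l)) [0..<2 * k]
      @ replicate (mk D \<omega> L + 2) True @ [False]" for T :: "nat set"
  have vT_nth: "vT T ! (s + p) = (\<not> (\<exists>l\<in>T. p = z l))" if "p < 2 * k" for T p
    using that by (simp add: vT_def nth_append)
  have mem: "vT T \<in> V_far D \<omega> k j n" if T: "T \<subseteq> {q0..<2 * k div D}" for T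
  proof -
    have "map (\<lambda>p. \<not> (\<exists>l\<in>T. p = z l)) [0..<2 * k] \<in> W_set D \<omega> (2 * k) (j + s)"
      unfolding W_set_def
    proof (intro CollectI conjI ballI impI)
      fix i assume i: "i \<in> {1..2 * k}" "j + s + i \<notin> I_set D \<omega>"
      have "i - 1 \<noteq> z l" for l
      proof
        assume "i - 1 = z l"
        then have "j + s + i = (J + l) * D + mk D \<omega> (J + l) + 3"
          using J i(1) by (simp add: z_def algebra_simps)
        then show False using i(2) by (auto simp: I_set_def)
      qed
      then show "map (\<lambda>p. \<not> (\<exists>l\<in>T. p = z l)) [0..<2 * k] ! (i - 1) = True" using i(1) by auto
    qed simp
    then have "vT T \<in> V_set D \<omega> (2 * k) j"
      unfolding V_set_def vT_def s_def L_def using sJ by (auto simp: s_def)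
    moreover have "n - j + D \<le> length (takeWhile id (vT T))"
    proof (rule length_takeWhile_ge)
      have nD: "n - j + D = s + q0 * D" using q0D jm by (simp add: s_def)
      fix i assume i: "i < n - j + D"
      show "vT T ! i"
      proof (cases "i < s")
        case True
        then show ?thesis by (simp add: vT_def nth_append)
      next
        case False
        define p where "p = i - s"
        have p: "i = s + p" "p < q0 * D" using False i nD by (auto simp: p_def)
        have "p < 2 * k"
        proof -
          have "D \<le> k" using k j by (intro dvd_imp_le) auto
          then show ?thesis using p(2) q0D j jm by linarith
        qed
        moreover have "p \<noteq> z l" if "l \<in> T" for l
        proof -
          have "q0 * D \<le> l * D" using T that by (intro mult_le_mono1) auto
          then show ?thesis using zl(1)[of l] p(2) by linarith
        qed
        ultimately show ?thesis using vT_nth p(1) by auto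
      qed
    next
      have "D \<le> k" using k j by (intro dvd_imp_le) auto
      then show "n - j + D \<le> length (vT T)" using j by (simp add: vT_def)
    qed
    ultimately show ?thesis by (simp add: V_far_def)
  qed
  have inj: "inj_on vT (Pow {q0..<2 * k div D})"
  proof (rule inj_onI)
    fix T T' assume T: "T \<in> Pow {q0..<2 * k div D}" "T' \<in> Pow {q0..<2 * k div D}" "vT T = vT T'"
    have "l \<in> T \<longleftrightarrow> \<not> vT T ! (s + z l)" if "l < 2 * k div D" "T \<subseteq> {q0..<2 * k div D}" for l T
    proof -
      have "Suc l * D \<le> 2 * k div D * D" using that by (intro mult_le_mono1) simp
      also have "\<dots> = 2 * k" using k by simp
      finally have "z l < 2 * k" using zl(2)[of l] by linarith
      then show ?thesis using vT_nth z_inj by auto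
    qed
    note * = this
    show "T = T'"
    proof (rule Set.set_eqI)
      fix l show "l \<in> T \<longleftrightarrow> l \<in> T'"
        using *[of l T] *[of l T'] T by (cases "l < 2 * k div D") auto
    qed
  qed
  have "card (Pow {q0..<2 * k div D}) \<le> card (V_far D \<omega> k j n)"
    by (rule card_inj_on_le[OF inj _ finite_V_far]) (use mem in auto)
  then show ?thesis by (simp add: card_Pow q0_def)
qed

section \<open>From stabilizing germs to harmonic functions\<close>

lemma grig_mult [simp]: "x \<otimes>\<^bsub>grig \<omega>\<^esub> y = x \<cdot> y"
  by (simp add: grig_def subgroup_generated_def)

lemma expectation_has_sum:
  fixes f :: "'a \<Rightarrow> real"
  assumes "\<And>x. \<bar>f x\<bar> \<le> B"
  shows "((\<lambda>x. pmf p x * f x) has_sum measure_pmf.expectation p f) UNIV"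
proof -
  have "integrable (measure_pmf p) f"
    by (rule measure_pmf.integrable_const_bound[where B = B]) (use assms in auto)
  then have "integrable (count_space UNIV) (\<lambda>x. pmf p x * f x)"
    unfolding measure_pmf_eq_density by (subst (asm) integrable_density) auto
  then have abs: "Infinite_Set_Sum.abs_summable_on (\<lambda>x. pmf p x * f x) UNIV"
    by (simp add: abs_summable_on_def)
  then have "(\<lambda>x. pmf p x * f x) summable_on UNIV"
    by (metis abs_summable_equivalent abs_summable_summable)
  moreover have "measure_pmf.expectation p f = infsum (\<lambda>x. pmf p x * f x) UNIV"
    unfolding pmf_expectation_eq_infsetsum by (rule infsetsum_infsum[OF abs])
  ultimately show ?thesis by (metis has_sum_infsum)
qed

text \<open>The probability that $gw_t$ has nontrivial germ at $1^\infty$, computed by averaging over the first step.\<close>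

primrec germ_prob :: "(nat \<Rightarrow> letter) \<Rightarrow> tree_map pmf \<Rightarrow> nat \<Rightarrow> tree_map \<Rightarrow> real" where
  "germ_prob \<omega> M 0 g = of_bool (odd_germ \<omega> g ones)"
| "germ_prob \<omega> M (Suc t) g = (\<integral>y. germ_prob \<omega> M t (g \<cdot> y) \<partial>measure_pmf M)"

lemma germ_prob_bounds: "0 \<le> germ_prob \<omega> M t g \<and> germ_prob \<omega> M t g \<le> 1"
proof (induction t arbitrary: g)
  case (Suc t)
  have "integrable (measure_pmf M) (\<lambda>y. germ_prob \<omega> M t (g \<cdot> y))"
    by (rule measure_pmf.integrable_const_bound[where B = 1]) (use Suc in auto)
  then have "germ_prob \<omega> M (Suc t) g \<le> (\<integral>y. 1 \<partial>measure_pmf M)"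
    unfolding germ_prob.simps by (rule integral_mono) (use Suc in auto)
  then show ?case using Suc by (simp add: integral_nonneg)
qed simp

lemma integrable_germ_prob: "integrable (measure_pmf M) (\<lambda>y. germ_prob \<omega> N t (g \<cdot> y))"
  by (rule measure_pmf.integrable_const_bound[where B = 1]) (use germ_prob_bounds[of \<omega> N t] in auto)

definition germ_rate :: "(nat \<Rightarrow> letter) \<Rightarrow> tree_map pmf \<Rightarrow> (nat \<Rightarrow> bool) \<Rightarrow> ennreal" where
  "germ_rate \<omega> M y = rate (odd_germ \<omega>) M y"

definition germ_change :: "(nat \<Rightarrow> letter) \<Rightarrow> tree_map pmf \<Rightarrow> nat \<Rightarrow> (nat \<Rightarrow> bool) \<Rightarrow> ennreal" where
  "germ_change \<omega> M t x = (\<integral>\<^sup>+y. germ_rate \<omega> M y \<partial>measure_pmf (ray_walk M t x))"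

text \<open>The value changes only if the next step has nontrivial germ at the current position of the walk on rays.\<close>

lemma germ_prob_increment:
  assumes r: "rich \<omega>" and M: "set_pmf M \<subseteq> Grig \<omega>" and g: "g \<in> Grig \<omega>"
  shows "ennreal \<bar>germ_prob \<omega> M (Suc t) g - germ_prob \<omega> M t g\<bar> \<le> germ_change \<omega> M t (act ones g)"
  using g
proof (induction t arbitrary: g)
  case 0
  have i: "integrable (measure_pmf M) (\<lambda>y. germ_prob \<omega> M 0 (g \<cdot> y) - germ_prob \<omega> M 0 g)"
    by (intro Bochner_Integration.integrable_diff integrable_germ_prob) simp
  have "germ_prob \<omega> M (Suc 0) g - germ_prob \<omega> M 0 g = (\<integral>y. germ_prob \<omega> M 0 (g \<cdot> y) - germ_prob \<omega> M 0 g \<partial>measure_pmf M)"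
    by (subst Bochner_Integration.integral_diff[OF integrable_germ_prob]) (simp_all add: measure_pmf.prob_space)
  then have "ennreal \<bar>germ_prob \<omega> M (Suc 0) g - germ_prob \<omega> M 0 g\<bar>
      \<le> (\<integral>\<^sup>+y. ennreal \<bar>germ_prob \<omega> M 0 (g \<cdot> y) - germ_prob \<omega> M 0 g\<bar> \<partial>measure_pmf M)"
    using integral_norm_bound_ennreal[OF i] by simp
  also have "\<dots> \<le> (\<integral>\<^sup>+y. indicator {y. odd_germ \<omega> y (act ones g)} y \<partial>measure_pmf M)"
  proof (rule nn_integral_mono_AE, unfold AE_measure_pmf_iff, intro ballI)
    fix y assume "y \<in> set_pmf M"
    then have "y \<in> Grig \<omega>" using M by auto
    then show "ennreal \<bar>germ_prob \<omega> M 0 (g \<cdot> y) - germ_prob \<omega> M 0 g\<bar> \<le> indicator {y. odd_germ \<omega> y (act ones g)} y"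
      using odd_germ_mult[OF r 0] by (auto simp: indicator_def)
  qed
  also have "\<dots> = germ_change \<omega> M 0 (act ones g)"
    by (simp add: germ_change_def germ_rate_def)
  finally show ?case .
next
  case (Suc t)
  have i: "integrable (measure_pmf M) (\<lambda>y. germ_prob \<omega> M (Suc t) (g \<cdot> y) - germ_prob \<omega> M t (g \<cdot> y))"
    by (intro Bochner_Integration.integrable_diff integrable_germ_prob)
  have "germ_prob \<omega> M (Suc (Suc t)) g - germ_prob \<omega> M (Suc t) g
      = (\<integral>y. germ_prob \<omega> M (Suc t) (g \<cdot> y) - germ_prob \<omega> M t (g \<cdot> y) \<partial>measure_pmf M)"
    by (subst Bochner_Integration.integral_diff[OF integrable_germ_prob integrable_germ_prob]) (simp only: germ_prob.simps)
  then have "ennreal \<bar>germ_prob \<omega> M (Suc (Suc t)) g - germ_prob \<omega> M (Suc t) g\<bar>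
      \<le> (\<integral>\<^sup>+y. ennreal \<bar>germ_prob \<omega> M (Suc t) (g \<cdot> y) - germ_prob \<omega> M t (g \<cdot> y)\<bar> \<partial>measure_pmf M)"
    using integral_norm_bound_ennreal[OF i] by simp
  also have "\<dots> \<le> (\<integral>\<^sup>+y. germ_change \<omega> M t (act (act ones g) y) \<partial>measure_pmf M)"
  proof (rule nn_integral_mono_AE, unfold AE_measure_pmf_iff, intro ballI)
    fix y assume "y \<in> set_pmf M"
    then have y: "y \<in> Grig \<omega>" using M by auto
    then have "g \<cdot> y \<in> Grig \<omega>" using Suc.prems by simp
    from Suc.IH[OF this]
    show "ennreal \<bar>germ_prob \<omega> M (Suc t) (g \<cdot> y) - germ_prob \<omega> M t (g \<cdot> y)\<bar> \<le> germ_change \<omega> M t (act (act ones g) y)"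
      by (simp only: act_mult[OF Grig_Aut[OF Suc.prems] Grig_Aut[OF y]])
  qed
  also have "\<dots> = germ_change \<omega> M (Suc t) (act ones g)"
    by (simp add: germ_change_def ray_step_def)
  finally show ?case .
qed

text \<open>Since $c$ fixes $1^\infty$ and has nontrivial germ there, all later germs are exchanged.\<close>

lemma germ_prob_flip:
  assumes r: "rich \<omega>" and M: "set_pmf M \<subseteq> Grig \<omega>" and g: "g \<in> Grig \<omega>"
  shows "germ_prob \<omega> M t (gen \<omega> Kc \<cdot> g) = 1 - germ_prob \<omega> M t g"
  using g
proof (induction t arbitrary: g)
  case 0
  have "pref (act ones (gen \<omega> Kc)) n = pref ones n" for n
    by (simp add: pref_act) (simp add: pref_def map_replicate_const gen_replicate_True)
  then have "act ones (gen \<omega> Kc) = ones" by (rule pref_inject)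
  then show ?case using odd_germ_mult[OF r Grig_gen 0, of Kc ones] odd_germ_gen[OF r, of Kc ones] by simp
next
  case (Suc t)
  have "germ_prob \<omega> M (Suc t) (gen \<omega> Kc \<cdot> g) = (\<integral>y. 1 - germ_prob \<omega> M t (g \<cdot> y) \<partial>measure_pmf M)"
    unfolding germ_prob.simps using M Suc
    by (intro integral_cong_AE) (auto simp: AE_measure_pmf_iff mult_T_assoc subset_eq)
  also have "\<dots> = 1 - germ_prob \<omega> M (Suc t) g"
    by (subst Bochner_Integration.integral_diff[OF _ integrable_germ_prob]) (simp_all add: measure_pmf.prob_space)
  finally show ?case .
qed

lemma ray_walk_in_orbit:
  assumes M: "set_pmf M \<subseteq> Grig \<omega>" and "x \<in> set_pmf (ray_walk M t (act ones g))" and "g \<in> Grig \<omega>"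
  shows "\<exists>h\<in>Grig \<omega>. x = act ones h"
  using assms(2,3)
proof (induction t arbitrary: g)
  case 0
  then show ?case by auto
next
  case (Suc t)
  then obtain y where y: "y \<in> set_pmf M" "x \<in> set_pmf (ray_walk M t (act (act ones g) y))"
    by (auto simp: ray_step_def)
  then have yG: "y \<in> Grig \<omega>" using M by auto
  have "act (act ones g) y = act ones (g \<cdot> y)"
    by (rule act_mult[symmetric]) (use Suc.prems(2) yG Grig_Aut in blast)+
  then show ?case using Suc.IH[of "g \<cdot> y"] y(2) Suc.prems(2) yG by simp
qed

text \<open>If the expected number of germ changes is finite, the germ of $w_t$ at $1^{\infty}$ stabilizes. The
  probability that its limit is nontrivial is harmonic in the starting point. Multiplying the starting point
  by $c$ exchanges the two limits, so a constant value would be $1/2$, but after a long time the limit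
  is known with probability above $1/2$.\<close>

theorem stabilization:
  assumes r: "rich \<omega>" and M: "set_pmf M \<subseteq> Grig \<omega>"
    and fin: "\<And>x. green M x (germ_rate \<omega> M) < \<infinity>"
  shows "nontrivial_poisson_boundary (grig \<omega>) (pmf M)"
proof -
  define q where "q t x = enn2real (germ_change \<omega> M t x)" for t x
  have sum_top: "(\<Sum>t. germ_change \<omega> M t x) < \<top>" for x
    using fin[of x] by (simp add: green_def germ_change_def)
  have change_top: "germ_change \<omega> M t x < \<top>" for t x
    using ennreal_suminf_lessD[OF sum_top] .
  have change: "germ_change \<omega> M t x = ennreal (q t x)" for t x
    unfolding q_def using change_top by (simp add: less_top)
  have q0: "0 \<le> q t x" for t x by (simp add: q_def)
  have summ: "summable (\<lambda>t. q t x)" for x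
    by (rule summable_suminf_not_top) (use sum_top[of x] q0 in \<open>auto simp: change less_top[symmetric]\<close>)
  have total: "(\<Sum>t. germ_change \<omega> M t x) = ennreal (\<Sum>t. q t x)" for x
    unfolding change using summ[of x] q0 by (intro suminf_ennreal2) auto
  define d where "d t g = germ_prob \<omega> M (Suc t) g - germ_prob \<omega> M t g" for t g
  define f where "f g = germ_prob \<omega> M 0 g + (\<Sum>t. d t g)" for g
  have dr: "\<bar>d t g\<bar> \<le> q t (act ones g)" if "g \<in> Grig \<omega>" for t g
    using germ_prob_increment[OF r M that, of t] unfolding change d_def by (simp add: ennreal_le_iff q0)
  have sd: "summable (\<lambda>t. \<bar>d t g\<bar>)" if "g \<in> Grig \<omega>" for g
    by (rule summable_comparison_test'[OF summ[of "act ones g"], where N = 0]) (use dr[OF that] in simp)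
  have lim: "(\<lambda>t. germ_prob \<omega> M t g) \<longlonglongrightarrow> f g" if "g \<in> Grig \<omega>" for g
  proof -
    have "(\<lambda>n. \<Sum>t<n. d t g) \<longlonglongrightarrow> (\<Sum>t. d t g)"
      using summable_LIMSEQ[OF summable_rabs_cancel[OF sd[OF that]]] .
    then have "(\<lambda>n. germ_prob \<omega> M n g - germ_prob \<omega> M 0 g) \<longlonglongrightarrow> (\<Sum>t. d t g)"
      unfolding d_def sum_lessThan_telescope[of "\<lambda>t. germ_prob \<omega> M t g"] .
    from tendsto_add[OF tendsto_const this, of "germ_prob \<omega> M 0 g"] show ?thesis by (simp add: f_def)
  qed
  have dist: "\<bar>f g - germ_prob \<omega> M 0 g\<bar> \<le> (\<Sum>t. q t (act ones g))" if "g \<in> Grig \<omega>" for g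
  proof -
    have "\<bar>f g - germ_prob \<omega> M 0 g\<bar> = \<bar>\<Sum>t. d t g\<bar>" by (simp add: f_def)
    also have "\<dots> \<le> (\<Sum>t. \<bar>d t g\<bar>)" by (rule summable_rabs[OF sd[OF that]])
    also have "\<dots> \<le> (\<Sum>t. q t (act ones g))" by (rule suminf_le[OF dr[OF that] sd[OF that] summ])
    finally show ?thesis .
  qed
  have bound: "\<bar>f g\<bar> \<le> 1" if "g \<in> Grig \<omega>" for g
    using LIMSEQ_le_const[OF lim[OF that], of 0] LIMSEQ_le_const2[OF lim[OF that], of 1] germ_prob_bounds[of \<omega> M _ g]
    by auto
  have harm: "harmonic (grig \<omega>) (pmf M) f"
    unfolding harmonic_def
  proof
    fix g assume g: "g \<in> Grig \<omega>"
    define f' where "f' h = (if h \<in> Grig \<omega> then f h else 0)" for h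
    have f': "\<bar>f' h\<bar> \<le> 1" for h using bound by (simp add: f'_def)
    have "(\<lambda>t. germ_prob \<omega> M (Suc t) g) \<longlonglongrightarrow> (\<integral>y. f' (g \<cdot> y) \<partial>measure_pmf M)"
      unfolding germ_prob.simps
    proof (rule integral_dominated_convergence[where w = "\<lambda>_. 1"])
      show "AE y in measure_pmf M. (\<lambda>t. germ_prob \<omega> M t (g \<cdot> y)) \<longlonglongrightarrow> f' (g \<cdot> y)"
        unfolding AE_measure_pmf_iff using lim M g by (auto simp: f'_def subset_eq)
      show "AE y in measure_pmf M. norm (germ_prob \<omega> M t (g \<cdot> y)) \<le> 1" for t
        using germ_prob_bounds[of \<omega> M t] by simp
    qed auto
    moreover have "(\<lambda>t. germ_prob \<omega> M (Suc t) g) \<longlonglongrightarrow> f g"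
      by (rule LIMSEQ_Suc[OF lim[OF g]])
    ultimately have eq: "f g = (\<integral>y. f' (g \<cdot> y) \<partial>measure_pmf M)"
      using LIMSEQ_unique by blast
    have "((\<lambda>y. pmf M y * f' (g \<cdot> y)) has_sum f g) UNIV"
      unfolding eq by (rule expectation_has_sum) (rule f')
    then have "((\<lambda>y. f (g \<cdot> y) * pmf M y) has_sum f g) (Grig \<omega>)"
    proof (subst has_sum_cong_neutral[where T = UNIV])
      show "f (g \<cdot> y) * pmf M y = pmf M y * f' (g \<cdot> y)" if "y \<in> Grig \<omega> \<inter> UNIV" for y
        using that g by (simp add: f'_def)
      show "pmf M y * f' (g \<cdot> y) = 0" if "y \<in> UNIV - Grig \<omega>" for y
        using that M by (auto simp: set_pmf_iff)
    qed auto
    then show "((\<lambda>y. f (g \<otimes>\<^bsub>grig \<omega>\<^esub> y) * pmf M y) has_sum f g) (Grig \<omega>)" by simp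
  qed
  have "\<exists>g\<in>Grig \<omega>. f (gen \<omega> Kc \<cdot> g) \<noteq> f g"
  proof -
    obtain T where "norm (\<Sum>t. q (t + T) ones) < 1 / 2"
      using suminf_exist_split[OF _ summ[of ones], of "1 / 2"] by auto
    then have T: "(\<Sum>t. q (t + T) ones) < 1 / 2" by simp
    have "(\<integral>\<^sup>+x. (\<Sum>t. germ_change \<omega> M t x) \<partial>measure_pmf (ray_walk M T ones))
        = (\<Sum>t. \<integral>\<^sup>+x. germ_change \<omega> M t x \<partial>measure_pmf (ray_walk M T ones))"
      by (rule nn_integral_suminf) simp
    also have "\<dots> = (\<Sum>t. germ_change \<omega> M (t + T) ones)"
      by (simp add: germ_change_def ray_walk_add add.commute[of _ T])
    also have "\<dots> = ennreal (\<Sum>t. q (t + T) ones)"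
      unfolding change using summ[of ones] q0 by (intro suminf_ennreal2) (auto intro: summable_ignore_initial_segment)
    also have "\<dots> < ennreal (1 / 2)" by (rule ennreal_lessI[OF _ T]) simp
    finally have I: "(\<integral>\<^sup>+x. (\<Sum>t. germ_change \<omega> M t x) \<partial>measure_pmf (ray_walk M T ones)) < ennreal (1 / 2)" .
    have "\<exists>x\<in>set_pmf (ray_walk M T ones). (\<Sum>t. germ_change \<omega> M t x) < ennreal (1 / 2)"
    proof (rule ccontr)
      assume "\<not> ?thesis"
      then have "(\<integral>\<^sup>+x. ennreal (1 / 2) \<partial>measure_pmf (ray_walk M T ones))
          \<le> (\<integral>\<^sup>+x. (\<Sum>t. germ_change \<omega> M t x) \<partial>measure_pmf (ray_walk M T ones))"
        by (intro nn_integral_mono_AE) (auto simp: AE_measure_pmf_iff not_less)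
      then show False using I by simp
    qed
    then obtain x where xs: "x \<in> set_pmf (ray_walk M T ones)" and "ennreal (\<Sum>t. q t x) < ennreal (1 / 2)"
      unfolding total by blast
    then have x: "x \<in> set_pmf (ray_walk M T ones)" "(\<Sum>t. q t x) < 1 / 2"
      using ennreal_less_iff[OF suminf_nonneg[OF summ q0]] by blast+
    then obtain g where g: "g \<in> Grig \<omega>" "x = act ones g"
      using ray_walk_in_orbit[OF M, of x T id] by auto
    have "f (gen \<omega> Kc \<cdot> g) = 1 - f g"
    proof -
      have "(\<lambda>t. germ_prob \<omega> M t (gen \<omega> Kc \<cdot> g)) \<longlonglongrightarrow> f (gen \<omega> Kc \<cdot> g)" by (rule lim) (use g in simp)
      moreover have "(\<lambda>t. 1 - germ_prob \<omega> M t g) \<longlonglongrightarrow> 1 - f g" by (intro tendsto_intros lim g)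
      ultimately show ?thesis unfolding germ_prob_flip[OF r M g(1)] by (rule LIMSEQ_unique)
    qed
    moreover have "f g \<noteq> 1 / 2"
      using dist[OF g(1)] x(2) unfolding g(2) by (auto split: if_splits simp: of_bool_def)
    ultimately show ?thesis using g(1) by (intro bexI[of _ g]) auto
  qed
  then show ?thesis
    unfolding nontrivial_poisson_boundary_def using harm bound by (metis Grig_gen Grig_mult)
qed

section \<open>The step law\<close>

text \<open>The measure $\mu_\beta$ is the law of a sampling in stages: first a fair coin decides between $\mathbf u_S$ and the sum,
  then a level is drawn, then a second fair coin decides between $\upsilon_n$ and $\check\upsilon_n$. As a law of this kind it
  can be integrated stage by stage.\<close>

definition level_pmf :: "nat \<Rightarrow> real \<Rightarrow> nat pmf" where
  "level_pmf D \<beta> = embed_pmf (\<lambda>n. if n \<in> levels D then 2 * (C_const D \<beta> * 2 powr (- real n * \<beta>)) else 0)"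

lemma pmf_level_pmf:
  assumes "0 < D" "0 < \<beta>"
  shows "pmf (level_pmf D \<beta>) n = (if n \<in> levels D then 2 * (C_const D \<beta> * 2 powr (- real n * \<beta>)) else 0)"
proof -
  let ?w = "\<lambda>n. 2 * 2 powr (- real n * \<beta>)"
  let ?f = "\<lambda>n. if n \<in> levels D then 2 * (C_const D \<beta> * 2 powr (- real n * \<beta>)) else 0"
  have C: "C_const D \<beta> > 0" by (rule mu_has_sum_1(1)[OF assms])
  have ne: "infsum ?w (levels D) \<noteq> 0" using C by (auto simp: C_const_def)
  then have "?w summable_on levels D" using infsum_not_exists by blast
  then have "(?w has_sum infsum ?w (levels D)) (levels D)" by (rule has_sum_infsum)
  from has_sum_cmult_right[OF this, of "C_const D \<beta>"]
  have "((\<lambda>n. C_const D \<beta> * ?w n) has_sum 1) (levels D)"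
    using ne by (simp add: C_const_def)
  then have "(?f has_sum 1) UNIV"
    by (subst has_sum_cong_neutral[where T = "levels D" and g = "\<lambda>n. C_const D \<beta> * ?w n"]) auto
  then have "?f sums 1" by (rule has_sum_imp_sums)
  then have "(\<Sum>n. ennreal (?f n)) = 1"
    using C sums_ennreal[of ?f 1] by (intro sums_unique[symmetric]) auto
  then have "(\<integral>\<^sup>+n. ennreal (?f n) \<partial>count_space UNIV) = 1"
    by (simp only: nn_integral_count_space_nat)
  then show ?thesis
    unfolding level_pmf_def using C by (intro pmf_embed_pmf) auto
qed

definition mu_pmf :: "nat \<Rightarrow> (nat \<Rightarrow> letter) \<Rightarrow> (nat \<Rightarrow> nat) \<Rightarrow> real \<Rightarrow> tree_map pmf" where
  "mu_pmf D \<omega> k \<beta> = bind_pmf (bernoulli_pmf (1 / 2)) (\<lambda>s. if s then pmf_of_set (gen_set \<omega>)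
     else bind_pmf (level_pmf D \<beta>) (\<lambda>n. bind_pmf (bernoulli_pmf (1 / 2)) (\<lambda>t.
       if t then upsilon D \<omega> k n else upsilon_check D \<omega> k n)))"

lemma pmf_mu_pmf:
  assumes "0 < D" "0 < \<beta>"
  shows "pmf (mu_pmf D \<omega> k \<beta>) g = mu D \<omega> k \<beta> g"
proof -
  let ?q = "\<lambda>n. (pmf (upsilon D \<omega> k n) g + pmf (upsilon_check D \<omega> k n) g) / 2"
  have q: "\<bar>?q n\<bar> \<le> 1" for n
    using pmf_le_1[of "upsilon D \<omega> k n" g] pmf_le_1[of "upsilon_check D \<omega> k n" g] by simp
  have "((\<lambda>n. pmf (level_pmf D \<beta>) n * ?q n) has_sum measure_pmf.expectation (level_pmf D \<beta>) ?q) UNIV"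
    by (rule expectation_has_sum[OF q])
  then have "((\<lambda>n. C_const D \<beta> * 2 powr (- real n * \<beta>) * (pmf (upsilon D \<omega> k n) g + pmf (upsilon_check D \<omega> k n) g))
     has_sum measure_pmf.expectation (level_pmf D \<beta>) ?q) (levels D)"
    by (subst has_sum_cong_neutral[where T = UNIV and g = "\<lambda>n. pmf (level_pmf D \<beta>) n * ?q n"])
      (auto simp: pmf_level_pmf[OF assms])
  then have "measure_pmf.expectation (level_pmf D \<beta>) ?q
      = (\<Sum>\<^sub>\<infinity>n\<in>levels D. C_const D \<beta> * 2 powr (- real n * \<beta>) * (pmf (upsilon D \<omega> k n) g + pmf (upsilon_check D \<omega> k n) g))"
    by (rule infsumI[symmetric])
  then show ?thesis
    by (simp add: mu_pmf_def pmf_bind mu_def add_divide_distrib)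
qed

lemma nn_integral_mu_pmf:
  "(\<integral>\<^sup>+g. f g \<partial>measure_pmf (mu_pmf D \<omega> k \<beta>)) \<le> (\<integral>\<^sup>+g. f g \<partial>measure_pmf (pmf_of_set (gen_set \<omega>)))
    + (\<integral>\<^sup>+n. (\<integral>\<^sup>+g. f g \<partial>measure_pmf (upsilon D \<omega> k n)) + (\<integral>\<^sup>+g. f g \<partial>measure_pmf (upsilon_check D \<omega> k n)) \<partial>measure_pmf (level_pmf D \<beta>))"
proof -
  have half: "x * ennreal (1 / 2) \<le> x" for x
  proof -
    have "ennreal (1 / 2) \<le> 1" by (rule ennreal_le_1[THEN iffD2]) simp
    then have "x * ennreal (1 / 2) \<le> x * 1" by (rule mult_left_mono) simp
    then show ?thesis by (simp only: mult_1_right)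
  qed
  then have half': "x * inverse 2 \<le> x" for x :: ennreal by simp
  show ?thesis
    unfolding mu_pmf_def
    by (simp add: if_distrib[of "\<lambda>p. nn_integral (measure_pmf p) f"])
       (intro add_mono order_trans[OF half'] nn_integral_mono order_refl half')
qed

section \<open>The random factors\<close>

text \<open>A pointwise bound for the germ rate of the factor with index $j$: zero if its germs are in
  $\langle b\rangle$, and otherwise an upper bound for one over the number of admitted vertices (\<open>card_V_far\<close>).\<close>

definition weight :: "nat \<Rightarrow> (nat \<Rightarrow> letter) \<Rightarrow> (nat \<Rightarrow> nat) \<Rightarrow> nat \<Rightarrow> nat \<Rightarrow> real" where
  "weight D \<omega> k n j = (if \<omega> (j - 1) \<noteq> L2 then 0
     else if n < j + k n then 1 / 2 ^ (2 * k n div D - (n - j + j mod D) div D) else 1)"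

lemma F_pmf_cases:
  assumes "j \<le> n"
  shows "F_pmf D \<omega> k j n = (if \<omega> (j - 1) = L2 \<and> n < j + k n
      then map_pmf (g_tilde \<omega> j) (pmf_of_set (V_far D \<omega> (k n) j n)) else return_pmf (g_elt \<omega> j))"
  using assms by (simp add: F_pmf_def V_far_def)

context
  fixes D :: nat and \<omega> :: "nat \<Rightarrow> letter" and k :: "nat \<Rightarrow> nat" and n j :: nat
  assumes Fr: "Fr D \<omega>" and kD: "D dvd k n" and nD: "D dvd n" and j: "j \<le> n"
begin

lemma V_far_nonempty: "n < j + k n \<Longrightarrow> V_far D \<omega> (k n) j n \<noteq> {}"
  using card_V_far[OF Fr kD nD j] by (metis card.empty less_le_not_le zero_less_numeral zero_less_power)

lemma V_far_admissible: "v \<in> V_far D \<omega> (k n) j n \<Longrightarrow> admissible \<omega> j v"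
  using V_set_admissible[OF Fr, of "2 * k n" v j] kD by (auto simp: V_far_def)

lemma set_F_pmf: "set_pmf (F_pmf D \<omega> k j n) \<subseteq> {g \<in> Grig \<omega>. swaps j g}"
proof (cases "\<omega> (j - 1) = L2 \<and> n < j + k n")
  case True
  then have "set_pmf (F_pmf D \<omega> k j n) = g_tilde \<omega> j ` V_far D \<omega> (k n) j n"
    using V_far_nonempty finite_V_far by (simp add: F_pmf_cases[OF j])
  then show ?thesis using True g_tilde_props(1,2)[OF Fr_rich[OF Fr]] V_far_admissible by auto
next
  case False
  then show ?thesis using g_elt_props(1,2)[OF Fr_rich[OF Fr]] by (auto simp: F_pmf_cases[OF j])
qed

text \<open>The predicate \<open>P\<close> stands for a nontrivial germ of $g$ or of $g^{-1}$. Distinct vertices give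
  distinct sources, so at each ray at most one element of the family has a nontrivial germ.\<close>

lemma F_pmf_germs:
  assumes t: "t \<in> carrier Aut_T"
    and P1: "\<And>v y. \<omega> (j - 1) = L2 \<Longrightarrow> admissible \<omega> j v \<Longrightarrow> P (g_tilde \<omega> j v) y \<longleftrightarrow> source t j y = pad v"
    and P2: "\<And>y. P (g_elt \<omega> j) y \<longleftrightarrow> \<omega> (j - 1) = L2 \<and> source t j y = ones"
  shows "rate P (F_pmf D \<omega> k j n) y \<le> ennreal (weight D \<omega> k n j)"
    and "mass (rate P (F_pmf D \<omega> k j n)) \<le> ennreal (2 ^ j)"
proof -
  let ?V = "V_far D \<omega> (k n) j n"
  have fibre: "(\<integral>\<^sup>+y. indicator {y. source t j y = p} y \<partial>count_space UNIV) \<le> ennreal (2 ^ j)" for p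
  proof -
    have "(\<integral>\<^sup>+y. indicator {y. source t j y = p} y \<partial>count_space UNIV) = of_nat (card {y. source t j y = p})"
      using source_fibre(1)[OF t] by simp
    also have "\<dots> \<le> of_nat (2 ^ j)" using source_fibre(2)[OF t] by (simp only: of_nat_le_iff)
    finally show ?thesis by (simp add: ennreal_of_nat_eq_real_of_nat[symmetric] ennreal_power[symmetric])
  qed
  have "rate P (F_pmf D \<omega> k j n) y \<le> ennreal (weight D \<omega> k n j) \<and>
    mass (rate P (F_pmf D \<omega> k j n)) \<le> ennreal (2 ^ j)"
  proof (cases "\<omega> (j - 1) = L2 \<and> n < j + k n")
    case True
    have V: "?V \<noteq> {}" "finite ?V" using V_far_nonempty finite_V_far True by auto
    have "rate P (F_pmf D \<omega> k j n) y
        = (\<integral>\<^sup>+v. indicator {v. P (g_tilde \<omega> j v) y} v \<partial>measure_pmf (pmf_of_set ?V))" for y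
      using True by (simp add: F_pmf_cases[OF j] vimage_def)
    also have "(\<integral>\<^sup>+v. indicator {v. P (g_tilde \<omega> j v) y} v \<partial>measure_pmf (pmf_of_set ?V))
        = (\<integral>\<^sup>+v. indicator {y. source t j y = pad v} y \<partial>measure_pmf (pmf_of_set ?V))" for y
      using V True P1 V_far_admissible
      by (intro nn_integral_cong_AE) (auto simp: AE_measure_pmf_iff indicator_def)
    finally have e: "rate P (F_pmf D \<omega> k j n) y
        = (\<integral>\<^sup>+v. indicator {y. source t j y = pad v} y \<partial>measure_pmf (pmf_of_set ?V))" for y .
    have "rate P (F_pmf D \<omega> k j n) y \<le> ennreal (weight D \<omega> k n j)"
    proof -
      have "card {v \<in> ?V. source t j y = pad v} \<le> 1"
      proof (rule card_le_Suc0_iff_eq[THEN iffD2, simplified One_nat_def[symmetric]])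
        show "finite {v \<in> ?V. source t j y = pad v}" using V by simp
        show "\<forall>v\<in>{v \<in> ?V. source t j y = pad v}. \<forall>w\<in>{v \<in> ?V. source t j y = pad v}. v = w"
          using V_set_length pad_inject by (auto simp: V_far_def)
      qed
      have "rate P (F_pmf D \<omega> k j n) y
          = (\<Sum>v\<in>?V. indicator {y. source t j y = pad v} y) / of_nat (card ?V)"
        unfolding e using V by (simp add: nn_integral_pmf_of_set)
      also have "(\<Sum>v\<in>?V. indicator {y. source t j y = pad v} y) = (of_nat (card {v \<in> ?V. source t j y = pad v}) :: ennreal)"
        using V by (simp add: indicator_def sum.If_cases Int_def)
      also have "\<dots> / of_nat (card ?V) \<le> 1 / of_nat (card ?V)"
        using \<open>card {v \<in> ?V. source t j y = pad v} \<le> 1\<close>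
        by (intro divide_right_mono_ennreal) (metis of_nat_1 of_nat_le_iff)
      also have "\<dots> = ennreal (1 / real (card ?V))"
        using V by (simp add: divide_ennreal[symmetric] ennreal_of_nat_eq_real_of_nat card_gt_0_iff)
      also have "\<dots> \<le> ennreal (weight D \<omega> k n j)"
      proof (rule ennreal_leI)
        have "2 ^ (2 * k n div D - (n - j + j mod D) div D) \<le> real (card ?V)"
          using card_V_far[OF Fr kD nD j] True by (metis of_nat_le_iff of_nat_numeral of_nat_power)
        then show "1 / real (card ?V) \<le> weight D \<omega> k n j"
          using True by (simp add: weight_def frac_le)
      qed
      finally show ?thesis .
    qed
    moreover have "mass (rate P (F_pmf D \<omega> k j n))
        \<le> (\<integral>\<^sup>+v. ennreal (2 ^ j) \<partial>measure_pmf (pmf_of_set ?V))"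
      unfolding e nn_integral_pmf_count_space_swap by (intro nn_integral_mono fibre)
    ultimately show ?thesis by simp
  next
    case False
    have e: "rate P (F_pmf D \<omega> k j n) y
        = (if \<omega> (j - 1) = L2 then indicator {y. source t j y = ones} y else 0)" for y
      using False P2 by (auto simp: F_pmf_cases[OF j] indicator_def)
    show ?thesis
    proof (cases "\<omega> (j - 1) = L2")
      case True
      then have "weight D \<omega> k n j = 1" using False by (simp add: weight_def)
      then show ?thesis using True fibre[of ones] unfolding e by (auto simp: indicator_def)
    next
      case False
      then show ?thesis unfolding e by simp
    qed
  qed
  then show "rate P (F_pmf D \<omega> k j n) y \<le> ennreal (weight D \<omega> k n j)"
    "mass (rate P (F_pmf D \<omega> k j n)) \<le> ennreal (2 ^ j)"
    by blast+
qed

end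

lemma weight_nonneg: "0 \<le> weight D \<omega> k n j"
  by (simp add: weight_def)

text \<open>For the inverse of a product the translates in \<open>product_bound\<close> come from the other factor, and the sources use
  $id$ in place of $a$.\<close>

lemma upsilon_germ_rate:
  assumes Fr: "Fr D \<omega>" and kD: "D dvd k n" and nD: "D dvd n" and K: "0 \<le> K" and \<beta>: "0 < \<beta>" "\<beta> < 1"
    and green: "\<And>w a b. (\<And>y. w y \<le> ennreal a) \<Longrightarrow> mass w \<le> ennreal b \<Longrightarrow> 0 \<le> a \<Longrightarrow> 0 < b
      \<Longrightarrow> green M x w \<le> ennreal (K * (a powr (1 - \<beta>) * b powr \<beta>))"
  shows "green M x (germ_rate \<omega> (upsilon D \<omega> k n)) \<le> ennreal (K * (\<Sum>j\<in>{1..n}. weight D \<omega> k n j powr (1 - \<beta>) * (2 ^ j) powr \<beta>))"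
    and "green M x (germ_rate \<omega> (upsilon_check D \<omega> k n)) \<le> ennreal (K * (\<Sum>j\<in>{1..n}. weight D \<omega> k n j powr (1 - \<beta>) * (2 ^ j) powr \<beta>))"
proof -
  have r: "rich \<omega>" by (rule Fr_rich[OF Fr])
  let ?F = "\<lambda>i. F_pmf D \<omega> k i n" and ?a = "\<lambda>j. ennreal (weight D \<omega> k n j)" and ?b = "\<lambda>j. ennreal (2 ^ j)"
  let ?B = "ennreal (K * (\<Sum>j\<in>{1..n}. weight D \<omega> k n j powr (1 - \<beta>) * (2 ^ j) powr \<beta>))"
  have set: "set_pmf (coin (?F i)) \<subseteq> Grig \<omega>" if "i \<in> {1..n}" for i
    using set_F_pmf[where D = D and \<omega> = \<omega> and k = k and n = n and j = i, OF Fr kD nD] set_coin[of "?F i"] that Grig_id(1)[of \<omega>] by (auto dest!: subsetD)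
  have total: "green M x v \<le> ?B"
    if W: "\<exists>w. (\<forall>i\<in>{1..n}. (\<forall>y. w i y \<le> ?a i) \<and> mass (w i) \<le> ?b i) \<and>
      (\<forall>y. v y \<le> (\<Sum>i\<in>{1..n}. w i y))" for v
  proof -
    obtain w where w: "\<And>i y. i \<in> {1..n} \<Longrightarrow> w i y \<le> ?a i"
      "\<And>i. i \<in> {1..n} \<Longrightarrow> mass (w i) \<le> ?b i"
      "\<And>y. v y \<le> (\<Sum>i\<in>{1..n}. w i y)" using W by blast
    have "green M x v \<le> (\<Sum>i\<in>{1..n}. green M x (w i))"
      unfolding green_sum[symmetric] by (rule green_mono) (rule w(3))
    also have "\<dots> \<le> (\<Sum>i\<in>{1..n}. ennreal (K * (weight D \<omega> k n i powr (1 - \<beta>) * (2 ^ i) powr \<beta>)))"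
      by (intro sum_mono green w weight_nonneg) auto
    also have "\<dots> = ?B"
      using K by (subst sum_ennreal) (auto simp: sum_distrib_left)
    finally show ?thesis .
  qed
  have germ: "rate P (coin (?F i)) y \<le> ?a i"
    "mass (rate P (coin (?F i))) \<le> ?b i"
    if i: "i \<in> {1..n}" and t: "t \<in> carrier Aut_T"
      and P0: "\<And>y. \<not> P id y"
      and P1: "\<And>v y. \<omega> (i - 1) = L2 \<Longrightarrow> admissible \<omega> i v \<Longrightarrow> P (g_tilde \<omega> i v) y \<longleftrightarrow> source t i y = pad v"
      and P2: "\<And>y. P (g_elt \<omega> i) y \<longleftrightarrow> \<omega> (i - 1) = L2 \<and> source t i y = ones" for i t P y
  proof -
    have le: "rate P (coin (?F i)) y \<le> rate P (?F i) y" for y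
      by (rule emeasure_coin_le) (rule P0)
    have j: "i \<le> n" using i by simp
    note F = F_pmf_germs[where D = D and \<omega> = \<omega> and k = k and n = n and j = i and P = P and t = t, OF Fr kD nD j t P1 P2]
    show "rate P (coin (?F i)) y \<le> ?a i"
      using le[of y] F(1)[of y] by (rule order_trans)
    have "mass (rate P (coin (?F i)))
        \<le> mass (rate P (?F i))"
      by (intro nn_integral_mono le)
    then show "mass (rate P (coin (?F i))) \<le> ?b i"
      using F(2) by (rule order_trans)
  qed
  show "green M x (germ_rate \<omega> (upsilon D \<omega> k n)) \<le> ?B"
    unfolding germ_rate_def upsilon_product_law
  proof (rule total, rule product_bound[where s = "\<lambda>_. id" and t = "\<lambda>g. g" and \<omega> = \<omega>])
    fix i y assume i: "i \<in> {1..n}"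
    note g = germ[OF i gen_a_Aut, where P = "odd_germ \<omega>"]
    show "rate (odd_germ \<omega>) (coin (?F i)) y \<le> ?a i" "mass (rate (odd_germ \<omega>) (coin (?F i))) \<le> ?b i"
      by (rule g; use r g_tilde_props(3)[OF r] g_elt_props(3)[OF r] in auto)+
  qed (use r set odd_germ_mult[OF r] in auto)
  have "germ_rate \<omega> (upsilon_check D \<omega> k n) = rate (\<lambda>g. odd_germ \<omega> (inv_T g)) (product_law (\<lambda>i. coin (?F i)) n)"
    by (rule ext) (simp add: germ_rate_def upsilon_check_def upsilon_product_law vimage_def)
  then have "green M x (germ_rate \<omega> (upsilon_check D \<omega> k n))
      = green M x (rate (\<lambda>g. odd_germ \<omega> (inv_T g)) (product_law (\<lambda>i. coin (?F i)) n))"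
    by (simp only:)
  also have "\<dots> \<le> ?B"
  proof (rule total, rule product_bound[where s = inv_T and t = "\<lambda>_. id" and \<omega> = \<omega>])
    fix i y assume i: "i \<in> {1..n}"
    note g = germ[OF i id_in_Aut_T(1), where P = "\<lambda>g. odd_germ \<omega> (inv_T g)"]
    show "rate (\<lambda>g. odd_germ \<omega> (inv_T g)) (coin (?F i)) y \<le> ?a i"
      "mass (rate (\<lambda>g. odd_germ \<omega> (inv_T g)) (coin (?F i))) \<le> ?b i"
      by (rule g; use r g_tilde_props(4)[OF r] g_elt_props(4)[OF r] in auto)+
  next
    fix g h y assume g: "g \<in> Grig \<omega>" and h: "h \<in> Grig \<omega>" and "odd_germ \<omega> (inv_T (g \<cdot> h)) y"
    then show "odd_germ \<omega> (inv_T g) (act y (inv_T h)) \<or> odd_germ \<omega> (inv_T h) (act y id)"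
      using inv_T_mult[OF Grig_Aut[OF g] Grig_Aut[OF h]] odd_germ_mult[OF r Grig_inv[OF h] Grig_inv[OF g], of y] by auto
  qed (use r set in auto)
  finally show "green M x (germ_rate \<omega> (upsilon_check D \<omega> k n)) \<le> ?B" .
qed

section \<open>Summation over the levels\<close>

text \<open>With $i=n-j$ each term is at most $2\cdot 2^{-2k_n(1-\beta)/D}\,2^{-i\eta}$. For $i\ge k_n$ the weight is at most $1$ and a part
  $2^{-2i(1-\beta)/D}$ of the factor $2^{-i\beta}$ supplies the first power. For $i<k_n$ it is supplied by the number of
  vertices, up to the loss $2^{i(1-\beta)/D}$ caused by the required prefix of ones. The exponent $\eta$ is positive
  since $\beta>2/3$ and $D\ge 3$.\<close>

lemma weight_sum:
  assumes D: "3 \<le> D" and kD: "D dvd k n" and \<beta>: "1 - 1 / real D < \<beta>" "\<beta> < 1"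
  defines "\<eta> \<equiv> \<beta> - 2 * (1 - \<beta>) / real D"
  shows "0 < \<eta>"
    and "2 powr (- real n * \<beta>) * (\<Sum>j\<in>{1..n}. weight D \<omega> k n j powr (1 - \<beta>) * (2 ^ j) powr \<beta>)
      \<le> 2 / (1 - 2 powr (- \<eta>)) * 2 powr (- 2 * real (k n) * (1 - \<beta>) / real D)"
proof -
  have D0: "real D > 0" using D by simp
  have "1 / real D \<le> 1 / 3" using D by (intro divide_left_mono) auto
  then have b: "2 / 3 < \<beta>" using \<beta> by linarith
  define y where "y = (1 - \<beta>) / real D"
  have \<eta>y: "\<eta> = \<beta> - 2 * y" by (simp add: \<eta>_def y_def)
  have y0: "0 \<le> y" using \<beta> D0 by (simp add: y_def)
  have "y \<le> (1 - \<beta>) / 3" unfolding y_def using D \<beta> by (intro divide_left_mono) auto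
  then show \<eta>: "0 < \<eta>" using b unfolding \<eta>y by simp
  let ?R = "2 powr (- 2 * real (k n) * (1 - \<beta>) / real D)"
  have term_le: "2 powr (- real n * \<beta>) * (weight D \<omega> k n j powr (1 - \<beta>) * (2 ^ j) powr \<beta>)
      \<le> 2 * ?R * (2 powr (- \<eta>)) ^ (n - j)" if j: "j \<in> {1..n}" for j
  proof -
    define i where "i = n - j"
    have nj: "real n = real i + real j" using j by (simp add: i_def)
    have "(2 ^ j) powr \<beta> = 2 powr (real j * \<beta>)"
      by (simp add: powr_realpow[symmetric] powr_powr)
    then have e: "2 powr (- real n * \<beta>) * (weight D \<omega> k n j powr (1 - \<beta>) * (2 ^ j) powr \<beta>)
        = weight D \<omega> k n j powr (1 - \<beta>) * 2 powr (- real i * \<beta>)"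
      by (simp add: nj powr_add[symmetric] algebra_simps)
    have rhs: "2 * ?R * (2 powr (- \<eta>)) ^ (n - j) = 2 powr (1 - 2 * real (k n) * (1 - \<beta>) / real D - real i * \<eta>)"
    proof -
      have "((2::real) powr (- \<eta>)) ^ i = 2 powr (- real i * \<eta>)"
        using powr_realpow[of "2 powr (- \<eta>)" i] by (simp add: powr_powr mult.commute)
      moreover have "2 * ?R * 2 powr (- real i * \<eta>) = 2 powr (1 + - 2 * real (k n) * (1 - \<beta>) / real D + - real i * \<eta>)"
        by (simp only: powr_add) simp
      moreover have "1 + - 2 * real (k n) * (1 - \<beta>) / real D + - real i * \<eta>
          = 1 - 2 * real (k n) * (1 - \<beta>) / real D - real i * \<eta>" by simp
      ultimately show ?thesis unfolding i_def[symmetric] by (simp only:)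
    qed
    show ?thesis
    proof (cases "\<omega> (j - 1) = L2")
      case False
      then show ?thesis unfolding e rhs by (simp add: weight_def)
    next
      case True
      show ?thesis
      proof (cases "n < j + k n")
        case special: True
        define x where "x = 2 * k n div D - (i + j mod D) div D"
        have "real (2 * k n div D) = 2 * real (k n) / real D"
          using kD by (simp add: real_of_nat_div)
        moreover have "real ((i + j mod D) div D) \<le> real i / real D + 1"
        proof -
          have "(i + j mod D) div D \<le> (i + D) div D"
            using D by (intro div_le_mono) (simp add: less_imp_le)
          also have "\<dots> = i div D + 1" using D by simp
          finally have "real ((i + j mod D) div D) \<le> real (i div D) + 1"
            by (metis of_nat_1 of_nat_add of_nat_le_iff)
          moreover have "real (i div D) \<le> real i / real D"
          proof -
            have "real (i div D * D) \<le> real i" by (simp only: of_nat_le_iff div_times_less_eq_dividend)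
            then show ?thesis using D0 by (simp add: pos_le_divide_eq)
          qed
          ultimately show ?thesis by linarith
        qed
        ultimately have x: "2 * real (k n) / real D - real i / real D - 1 \<le> real x"
          by (simp add: x_def)
        have "weight D \<omega> k n j = 2 powr (- real x)"
          using True special by (simp add: weight_def x_def i_def powr_minus powr_realpow inverse_eq_divide)
        then have "weight D \<omega> k n j powr (1 - \<beta>) * 2 powr (- real i * \<beta>) = 2 powr (- real x * (1 - \<beta>) + - real i * \<beta>)"
          by (simp only: powr_powr powr_add)
        then have "weight D \<omega> k n j powr (1 - \<beta>) * 2 powr (- real i * \<beta>) = 2 powr (- real x * (1 - \<beta>) - real i * \<beta>)"
          by simp
        also have "\<dots> \<le> 2 powr (1 - 2 * real (k n) * (1 - \<beta>) / real D - real i * \<eta>)"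
        proof (rule powr_mono)
          have "(2 * real (k n) / real D - real i / real D - 1) * (1 - \<beta>) \<le> real x * (1 - \<beta>)"
            using x \<beta> by (intro mult_right_mono) auto
          moreover have "(2 * real (k n) / real D - real i / real D - 1) * (1 - \<beta>)
              = 2 * real (k n) * y - real i * y - (1 - \<beta>)"
            by (simp add: y_def left_diff_distrib)
          moreover have "2 * real (k n) * (1 - \<beta>) / real D = 2 * real (k n) * y" by (simp add: y_def)
          moreover have "real i * \<eta> = real i * \<beta> - 2 * (real i * y)"
            by (simp add: \<eta>y right_diff_distrib)
          moreover have "0 \<le> real i * y" using y0 by simp
          ultimately show "- real x * (1 - \<beta>) - real i * \<beta> \<le> 1 - 2 * real (k n) * (1 - \<beta>) / real D - real i * \<eta>"
            using b by simp
        qed simp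
        finally show ?thesis unfolding e rhs .
      next
        case far: False
        have "weight D \<omega> k n j powr (1 - \<beta>) * 2 powr (- real i * \<beta>) = 2 powr (- real i * \<beta>)"
          using True far by (simp add: weight_def)
        also have "\<dots> \<le> 2 powr (1 - 2 * real (k n) * (1 - \<beta>) / real D - real i * \<eta>)"
        proof (rule powr_mono)
          have "real (k n) \<le> real i" using far j by (simp add: i_def)
          then have "real (k n) * y \<le> real i * y"
            using y0 by (intro mult_right_mono) auto
          moreover have "2 * real (k n) * (1 - \<beta>) / real D = 2 * (real (k n) * y)" by (simp add: y_def)
          moreover have "real i * \<eta> = real i * \<beta> - 2 * (real i * y)"
            by (simp add: \<eta>y right_diff_distrib)
          ultimately show "- real i * \<beta> \<le> 1 - 2 * real (k n) * (1 - \<beta>) / real D - real i * \<eta>"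
            by simp
        qed simp
        finally show ?thesis unfolding e rhs .
      qed
    qed
  qed
  let ?z = "2 powr (- \<eta>) :: real"
  have z: "0 < ?z" "?z < 1" using \<eta> by (auto simp: powr_less_one)
  have "2 powr (- real n * \<beta>) * (\<Sum>j\<in>{1..n}. weight D \<omega> k n j powr (1 - \<beta>) * (2 ^ j) powr \<beta>)
      \<le> (\<Sum>j\<in>{1..n}. 2 * ?R * ?z ^ (n - j))"
    unfolding sum_distrib_left by (intro sum_mono term_le)
  also have "\<dots> = 2 * ?R * (\<Sum>j\<in>{1..n}. ?z ^ (n - j))" by (simp add: sum_distrib_left)
  also have "(\<Sum>j\<in>{1..n}. ?z ^ (n - j)) = (\<Sum>i<n. ?z ^ i)"
    by (rule sum.reindex_bij_witness[where i = "\<lambda>i. n - i" and j = "\<lambda>j. n - j"]) auto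
  also have "(\<Sum>i<n. ?z ^ i) \<le> 1 / (1 - ?z)"
    using z \<eta> by (simp add: sum_gp_strict divide_right_mono)
  finally show "2 powr (- real n * \<beta>) * (\<Sum>j\<in>{1..n}. weight D \<omega> k n j powr (1 - \<beta>) * (2 ^ j) powr \<beta>)
      \<le> 2 / (1 - ?z) * ?R"
    by (simp add: mult_left_mono mult_ac)
qed

lemma log_floor_powr:
  assumes "0 < n" "0 \<le> c"
  shows "2 powr (- c * real (nat \<lfloor>log 2 (real n)\<rfloor>)) \<le> 2 powr c * real n powr (- c)"
proof -
  have l: "0 \<le> log 2 (real n)" using assms by simp
  then have "log 2 (real n) - 1 \<le> real (nat \<lfloor>log 2 (real n)\<rfloor>)" by linarith
  then have "c * (log 2 (real n) - 1) \<le> c * real (nat \<lfloor>log 2 (real n)\<rfloor>)"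
    using assms by (intro mult_left_mono) auto
  then have "2 powr (- c * real (nat \<lfloor>log 2 (real n)\<rfloor>)) \<le> 2 powr (c + log 2 (real n) * (- c))"
    by (intro powr_mono) (simp_all add: algebra_simps)
  also have "\<dots> = 2 powr c * real n powr (- c)"
    using assms by (simp only: powr_add powr_powr[symmetric]) simp
  finally show ?thesis .
qed

lemma pmf_bind_ge: "pmf N n * pmf (f n) i \<le> pmf (bind_pmf N f) i"
proof -
  have "ennreal (pmf N n * pmf (f n) i) = (\<integral>\<^sup>+x. ennreal (pmf (f n) i) * indicator {n} x \<partial>measure_pmf N)"
    by (simp add: nn_integral_cmult_indicator emeasure_pmf_single ennreal_mult mult.commute)
  also have "\<dots> \<le> (\<integral>\<^sup>+x. ennreal (pmf (f x) i) \<partial>measure_pmf N)"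
    by (intro nn_integral_mono) (auto split: split_indicator)
  also have "\<dots> = ennreal (pmf (bind_pmf N f) i)" by (rule ennreal_pmf_bind[symmetric])
  finally show ?thesis by simp
qed

theorem theorem7p13:
  fixes \<omega> :: "nat \<Rightarrow> letter" and D A :: nat and \<beta> :: real
  assumes "Fr D \<omega>"
    and "1 - 1 / real D < \<beta>" and "\<beta> < 1"
    and "real D * (1 + \<beta>) / (2 * (1 - \<beta>)) < real A" and "D dvd A"
  shows "nontrivial_poisson_boundary (grig \<omega>)
           (mu D \<omega> (\<lambda>n. A * nat \<lfloor>log 2 (real n)\<rfloor>) \<beta>)"
proof -
  define k where "k = (\<lambda>n::nat. A * nat \<lfloor>log 2 (real n)\<rfloor>)"
  have Fr: "Fr D \<omega>" and \<beta>1: "\<beta> < 1" using assms by auto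
  have D: "3 \<le> D" by (rule Fr_D[OF Fr])
  have r: "rich \<omega>" by (rule Fr_rich[OF Fr])
  have "1 / real D \<le> 1" using D by simp
  then have \<beta>0: "0 < \<beta>" using assms(2) by linarith
  have D0: "0 < D" using D by simp
  have kD: "D dvd k n" for n using assms(5) by (simp add: k_def)
  have lev: "D dvd n" "0 < n" if "n \<in> levels D" for n using that by (auto simp: levels_def)
  have C: "C_const D \<beta> > 0" by (rule mu_has_sum_1(1)[OF D0 \<beta>0])
  let ?M = "mu_pmf D \<omega> k \<beta>"
  have setF: "set_pmf (F_pmf D \<omega> k i n) \<subseteq> {g \<in> Grig \<omega>. swaps i g}" if "n \<in> levels D" "i \<in> {1..n}" for i n
    using set_F_pmf[where D = D and \<omega> = \<omega> and k = k and n = n and j = i, OF Fr kD lev(1)[OF that(1)]] that(2) by simp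
  have setU: "set_pmf (upsilon D \<omega> k n) \<subseteq> Grig \<omega>" if "n \<in> levels D" for n
    unfolding upsilon_product_law
  proof (rule product_law_Grig)
    fix i assume "i \<in> {1..n}"
    from setF[OF that this] show "set_pmf (coin (F_pmf D \<omega> k i n)) \<subseteq> Grig \<omega>"
      using set_coin[of "F_pmf D \<omega> k i n"] Grig_id(1)[of \<omega>] by blast
  qed
  have setU': "set_pmf (upsilon_check D \<omega> k n) \<subseteq> Grig \<omega>" if "n \<in> levels D" for n
    using setU[OF that] by (auto simp: upsilon_check_def)
  have set_level: "set_pmf (level_pmf D \<beta>) \<subseteq> levels D"
    by (auto simp: set_pmf_iff pmf_level_pmf[OF D0 \<beta>0] split: if_splits)
  have S: "set_pmf (pmf_of_set (gen_set \<omega>)) = gen_set \<omega>" "finite (gen_set \<omega>)"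
    by (simp_all add: gen_set_def)
  have SG: "gen_set \<omega> \<subseteq> Grig \<omega>" by (auto simp: gen_set_def)
  have setM: "set_pmf ?M \<subseteq> Grig \<omega>"
  proof -
    have L: "set_pmf (upsilon D \<omega> k n) \<subseteq> Grig \<omega> \<and> set_pmf (upsilon_check D \<omega> k n) \<subseteq> Grig \<omega>"
      if "n \<in> set_pmf (level_pmf D \<beta>)" for n
      using setU setU' set_level that by blast
    moreover have "set_pmf (pmf_of_set (gen_set \<omega>)) \<subseteq> Grig \<omega>" using S SG by simp
    ultimately show ?thesis
      unfolding mu_pmf_def set_bind_pmf by (intro UN_least)
        (auto split: if_splits dest: L[THEN conjunct1, THEN subsetD] L[THEN conjunct2, THEN subsetD])
  qed
  then have setMA: "set_pmf ?M \<subseteq> carrier Aut_T" using Grig_Aut by blast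
  have sym: "map_pmf inv_T ?M = ?M"
  proof -
    let ?b = "bernoulli_pmf (1 / 2)" and ?U = "upsilon D \<omega> k" and ?V = "upsilon_check D \<omega> k"
    have "map_pmf inv_T (pmf_of_set (gen_set \<omega>)) = map_pmf id (pmf_of_set (gen_set \<omega>))"
      by (rule map_pmf_cong) (auto simp: S gen_set_def)
    then have 1: "map_pmf inv_T (pmf_of_set (gen_set \<omega>)) = pmf_of_set (gen_set \<omega>)" by simp
    have 2: "map_pmf inv_T (bind_pmf ?b (\<lambda>t. if t then ?U n else ?V n)) = bind_pmf ?b (\<lambda>t. if t then ?U n else ?V n)"
      if "n \<in> levels D" for n
    proof -
      have "map_pmf (\<lambda>g. inv_T (inv_T g)) (?U n) = map_pmf id (?U n)"
        by (rule map_pmf_cong) (use setU[OF that] in auto)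
      then have V: "map_pmf inv_T (?V n) = ?U n" by (simp add: upsilon_check_def map_pmf_comp)
      have U: "map_pmf inv_T (?U n) = ?V n" by (simp only: upsilon_check_def)
      have "map_pmf inv_T (bind_pmf ?b (\<lambda>t. if t then ?U n else ?V n)) = bind_pmf ?b (\<lambda>t. if t then ?V n else ?U n)"
        unfolding map_bind_pmf by (rule bind_pmf_cong) (auto simp: U V)
      also have "\<dots> = bind_pmf ?b (\<lambda>t. if t then ?U n else ?V n)"
        by (rule pmf_eqI) (simp add: pmf_bind)
      finally show ?thesis .
    qed
    have 3: "map_pmf inv_T (bind_pmf (level_pmf D \<beta>) (\<lambda>n. bind_pmf ?b (\<lambda>t. if t then ?U n else ?V n)))
        = bind_pmf (level_pmf D \<beta>) (\<lambda>n. bind_pmf ?b (\<lambda>t. if t then ?U n else ?V n))"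
      unfolding map_bind_pmf[of _ "level_pmf D \<beta>"] by (rule bind_pmf_cong) (use 2 set_level in auto)
    show ?thesis
      unfolding mu_pmf_def map_bind_pmf[of _ ?b] by (rule bind_pmf_cong) (auto simp: 1 3)
  qed
  have dom: "C_const D \<beta> / 2 * 2 powr (- real n * \<beta>) * pmf (upsilon D \<omega> k n) g \<le> pmf ?M g" if "n \<in> levels D" for n g
  proof -
    let ?L = "bind_pmf (bernoulli_pmf (1 / 2)) (\<lambda>t. if t then upsilon D \<omega> k n else upsilon_check D \<omega> k n)"
    have "pmf (level_pmf D \<beta>) n * (1 / 2 * pmf (upsilon D \<omega> k n) g) \<le> pmf (level_pmf D \<beta>) n * pmf ?L g"
      by (rule mult_left_mono) (simp_all add: pmf_bind)
    also have "\<dots> \<le> pmf (bind_pmf (level_pmf D \<beta>) (\<lambda>n. bind_pmf (bernoulli_pmf (1 / 2)) (\<lambda>t.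
        if t then upsilon D \<omega> k n else upsilon_check D \<omega> k n))) g"
      by (rule pmf_bind_ge)
    also have "\<dots> \<le> 2 * pmf ?M g"
      by (simp add: mu_pmf_def pmf_bind[of "bernoulli_pmf (1 / 2)" "\<lambda>s. if s then pmf_of_set (gen_set \<omega>) else q s" for q])
    finally show ?thesis using that by (simp add: pmf_level_pmf[OF D0 \<beta>0])
  qed
  have cube: "emeasure (measure_pmf (upsilon D \<omega> k n)) {h. act y h = z} \<le> ennreal ((1 / 2) ^ n)"
    if "n \<in> levels D" for n y z
    unfolding upsilon_product_law
    by (rule cube_independence) (use setF[OF that] Grig_Aut in blast)
  obtain C1 where C1: "C1 > 0" "\<And>t x y. pmf (ray_walk ?M t x) y \<le> C1 * (real t + 1) powr (- 1 / \<beta>)"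
  proof (rule heat_kernel[where M = ?M and \<beta> = \<beta> and D = D and \<kappa> = "C_const D \<beta> / 2"
        and U = "upsilon D \<omega> k", OF setMA sym \<beta>0 D0])
    show "0 < C_const D \<beta> / 2" using C by simp
    show "set_pmf (upsilon D \<omega> k n) \<subseteq> carrier Aut_T" if "n \<in> levels D" for n
      using setU[OF that] Grig_Aut by blast
  qed (use dom cube that in auto)
  define K where "K = (2 + 1 / (1 / \<beta> - 1)) * C1 powr \<beta>"
  have K: "0 \<le> K" using \<beta>0 \<beta>1 by (simp add: K_def)
  have green: "green ?M x w \<le> ennreal (K * (a powr (1 - \<beta>) * b powr \<beta>))"
    if w: "\<And>y. w y \<le> ennreal a" "mass w \<le> ennreal b" and ab: "0 \<le> a" "0 < b" for x w a b
  proof (cases "a = 0")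
    case True
    then have "w y = 0" for y using w(1)[of y] by simp
    then show ?thesis by (simp add: green_def)
  next
    case False
    then show ?thesis
      unfolding K_def using green_bound[OF \<beta>0 \<beta>1 C1 w] ab by simp
  qed
  define B where "B n = K * (\<Sum>j\<in>{1..n}. weight D \<omega> k n j powr (1 - \<beta>) * (2 ^ j) powr \<beta>)" for n
  have B0: "0 \<le> B n" for n
    unfolding B_def using K by (intro mult_nonneg_nonneg sum_nonneg) auto
  have rates: "green ?M x (germ_rate \<omega> (upsilon D \<omega> k n)) \<le> ennreal (B n)"
    "green ?M x (germ_rate \<omega> (upsilon_check D \<omega> k n)) \<le> ennreal (B n)" if "n \<in> levels D" for x n
    unfolding B_def
    by (rule upsilon_germ_rate[where D = D and k = k and n = n, OF Fr kD lev(1)[OF that] K \<beta>0 \<beta>1]; rule green; assumption)+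
  define p where "p = 2 * real A * (1 - \<beta>) / real D"
  have p: "1 < p"
  proof -
    have "real D * (1 + \<beta>) < 2 * real A * (1 - \<beta>)"
      using assms(4) \<beta>1 by (simp add: pos_divide_less_eq mult_ac)
    then have "1 + \<beta> < p" using D0 by (simp add: p_def pos_less_divide_eq mult_ac)
    then show ?thesis using \<beta>0 by simp
  qed
  define \<eta> where "\<eta> = \<beta> - 2 * (1 - \<beta>) / real D"
  have \<eta>: "0 < \<eta>" unfolding \<eta>_def by (rule weight_sum(1)[where D = D and k = k, OF D kD assms(2,3)])
  define C2 where "C2 = 4 * C_const D \<beta> * K * (2 / (1 - 2 powr (- \<eta>))) * 2 powr p"
  have C2: "0 \<le> C2"
    using C K \<eta> by (simp add: C2_def less_imp_le powr_less_one)
  have term_le: "pmf (level_pmf D \<beta>) n * (2 * B n) \<le> C2 * real n powr (- p)" for n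
  proof (cases "n \<in> levels D")
    case True
    let ?S = "\<Sum>j\<in>{1..n}. weight D \<omega> k n j powr (1 - \<beta>) * (2 ^ j) powr \<beta>"
    have "2 powr (- real n * \<beta>) * ?S \<le> 2 / (1 - 2 powr (- \<eta>)) * 2 powr (- 2 * real (k n) * (1 - \<beta>) / real D)"
      unfolding \<eta>_def by (rule weight_sum(2)[where D = D and k = k, OF D kD assms(2,3)])
    also have "- 2 * real (k n) * (1 - \<beta>) / real D = - p * real (nat \<lfloor>log 2 (real n)\<rfloor>)"
      using D0 by (simp add: k_def p_def field_simps)
    also have "2 / (1 - 2 powr (- \<eta>)) * 2 powr (- p * real (nat \<lfloor>log 2 (real n)\<rfloor>)) \<le> 2 / (1 - 2 powr (- \<eta>)) * (2 powr p * real n powr (- p))"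
      using log_floor_powr[of n p] lev(2)[OF True] p \<eta>
      by (intro mult_left_mono) (auto simp: powr_less_one less_imp_le)
    finally have "4 * C_const D \<beta> * K * (2 powr (- real n * \<beta>) * ?S)
        \<le> 4 * C_const D \<beta> * K * (2 / (1 - 2 powr (- \<eta>)) * (2 powr p * real n powr (- p)))"
      using C K by (intro mult_left_mono) auto
    then show ?thesis using True by (simp add: pmf_level_pmf[OF D0 \<beta>0] B_def C2_def mult_ac)
  next
    case False
    then show ?thesis using C2 by (simp add: pmf_level_pmf[OF D0 \<beta>0])
  qed
  have level_sum: "(\<integral>\<^sup>+n. ennreal (2 * B n) \<partial>measure_pmf (level_pmf D \<beta>)) < \<infinity>"
  proof -
    have "(\<integral>\<^sup>+n. ennreal (2 * B n) \<partial>measure_pmf (level_pmf D \<beta>)) = (\<Sum>n. ennreal (pmf (level_pmf D \<beta>) n * (2 * B n)))"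
      using B0 by (simp add: nn_integral_measure_pmf nn_integral_count_space_nat ennreal_mult)
    also have "\<dots> \<le> (\<Sum>n. ennreal (C2 * real n powr (- p)))"
      by (intro suminf_le summableI ennreal_leI term_le)
    also have "\<dots> < \<infinity>"
    proof -
      have "summable (\<lambda>n. C2 * real n powr (- p))"
        using p by (intro summable_mult) (simp add: summable_real_powr_iff)
      then show ?thesis using C2 ennreal_suminf_neq_top by (simp add: less_top)
    qed
    finally show ?thesis .
  qed
  have "green ?M x (germ_rate \<omega> ?M) < \<infinity>" for x
  proof -
    let ?gS = "germ_rate \<omega> (pmf_of_set (gen_set \<omega>))"
    have "germ_rate \<omega> ?M y \<le> ?gS y + (\<integral>\<^sup>+n. germ_rate \<omega> (upsilon D \<omega> k n) y
        + germ_rate \<omega> (upsilon_check D \<omega> k n) y \<partial>measure_pmf (level_pmf D \<beta>))" for y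
      using nn_integral_mu_pmf[where f = "indicator {g. odd_germ \<omega> g y}" and D = D and \<omega> = \<omega> and k = k and \<beta> = \<beta>] by (simp add: germ_rate_def)
    then have "green ?M x (germ_rate \<omega> ?M) \<le> green ?M x (\<lambda>y. ?gS y + (\<integral>\<^sup>+n. germ_rate \<omega> (upsilon D \<omega> k n) y
        + germ_rate \<omega> (upsilon_check D \<omega> k n) y \<partial>measure_pmf (level_pmf D \<beta>)))"
      by (rule green_mono)
    also have "\<dots> = green ?M x ?gS + (\<integral>\<^sup>+n. green ?M x (germ_rate \<omega> (upsilon D \<omega> k n))
        + green ?M x (germ_rate \<omega> (upsilon_check D \<omega> k n)) \<partial>measure_pmf (level_pmf D \<beta>))"
      by (simp only: green_add green_nn_integral)
    also have "\<dots> < \<infinity>"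
    proof -
      have g: "?gS y \<le> indicator {ones} y" for y
      proof (cases "y = ones")
        case False
        have "?gS y = emeasure (measure_pmf (pmf_of_set (gen_set \<omega>))) {}"
          unfolding germ_rate_def
          by (rule emeasure_eq_AE) (use False r in \<open>auto simp: AE_measure_pmf_iff S gen_set_def odd_germ_gen\<close>)
        then show ?thesis by simp
      qed (simp add: germ_rate_def measure_pmf.emeasure_le_1)
      have "mass ?gS \<le> mass (indicator {ones})"
        by (intro nn_integral_mono g)
      then have "green ?M x ?gS \<le> ennreal (K * (1 powr (1 - \<beta>) * 1 powr \<beta>))"
        by (intro green) (simp_all add: germ_rate_def measure_pmf.emeasure_le_1)
      also have "\<dots> < \<infinity>" by simp
      finally have 1: "green ?M x ?gS < \<infinity>" .
      have "(\<integral>\<^sup>+n. green ?M x (germ_rate \<omega> (upsilon D \<omega> k n))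
        + green ?M x (germ_rate \<omega> (upsilon_check D \<omega> k n)) \<partial>measure_pmf (level_pmf D \<beta>))
        \<le> (\<integral>\<^sup>+n. ennreal (2 * B n) \<partial>measure_pmf (level_pmf D \<beta>))"
      proof (rule nn_integral_mono_AE, unfold AE_measure_pmf_iff, intro ballI)
        fix n assume "n \<in> set_pmf (level_pmf D \<beta>)"
        then have n: "n \<in> levels D" using set_level by blast
        have "green ?M x (germ_rate \<omega> (upsilon D \<omega> k n)) + green ?M x (germ_rate \<omega> (upsilon_check D \<omega> k n))
            \<le> ennreal (B n) + ennreal (B n)"
          by (intro add_mono rates n)
        also have "\<dots> = ennreal (2 * B n)" using B0[of n] by (simp add: ennreal_plus[symmetric] del: ennreal_plus)
        finally show "green ?M x (germ_rate \<omega> (upsilon D \<omega> k n)) + green ?M x (germ_rate \<omega> (upsilon_check D \<omega> k n))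
            \<le> ennreal (2 * B n)" .
      qed
      then show ?thesis using 1 level_sum by (auto simp: less_top[symmetric] top_unique)
    qed
    finally show ?thesis .
  qed
  then have "nontrivial_poisson_boundary (grig \<omega>) (pmf ?M)"
    by (rule stabilization[OF r setM])
  moreover have "pmf ?M = mu D \<omega> k \<beta>"
    by (rule ext) (rule pmf_mu_pmf[OF D0 \<beta>0])
  ultimately show ?thesis by (simp add: k_def)
qed

end
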